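(* Let $B_1,\dots,B_m$ be arbitrary $n\times n$ quaternionic matrices. (1) If $m\ge 3$, then $$\sum_{r,s=1}^m\|[B_r,B_s]\|^2\le\frac83\left(\sum_{r=1}^m\|B_r\|^2\right)^2 .$$ For $1\le r\le m$ let $B_r^1=\frac12(\Psi(B_r)+\Psi(B_r)^* )$ and $B_r^2=\frac12(\Psi(B_r)-\Psi(B_r)^* )$. Equality holds if and only if $\sum_{r=1}^m[\Psi(B_r),\Psi(B_r)^*]=0$ and there exists $(P,R)\in K(2n,2m)$ such that $$(P,R)\cdot(B_1^1,\dots,B_m^1,\mathbf{i}B_1^2,\dots,\mathbf{i}B_m^2)=(\mathrm{diag}(H_1,0),\mathrm{diag}(H_2,0),\mathrm{diag}(H_3,0),0,\dots,0),$$ where for some real $\lambda\ge 0$, $$H_1=\begin{pmatrix}\lambda&0\\0&-\lambda\end{pmatrix},\quad H_2=\begin{pmatrix}0&\lambda\\\lambda&0\end{pmatrix},\quad H_3=\begin{pmatrix}0&-\lambda\mathbf{i}\\\lambda\mathbf{i}&0\end{pmatrix}.$$ (2) If $m=2$, then $$\sum_{r,s=1}^2\|[B_r,B_s]\|^2\le 2\left(\sum_{r=1}^2\|B_r\|^2\right)^2 .$$ Equality holds if and only if $B_1=upu^*$ and $B_2=uqu^*$ for some unit column vector $u\in\mathbb{H}^n$, where $p,q\in\mathbb{H}$ are orthogonal imaginary quaternions and $\|p\|=\|q\|$.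
   Context: $\mathbb{H}$ denotes the quaternions with canonical basis $1,\mathbf{i},\mathbf{j},\mathbf{k}$, and $M(n,\mathbb{H})$ the $n\times n$ quaternionic matrices; $[X,Y]=XY-YX$; $X^*$ is the conjugate transpose (complex or quaternionic); for $X=(x_{ij})$ complex or quaternionic, $\|X\|^2=\sum_{i,j}|x_{ij}|^2$ is the squared Frobenius norm, and $\|p\|$ is the usual norm of a quaternion $p$. Imaginary quaternions have zero real part; orthogonality of quaternions is with respect to the standard real inner product on $\mathbb{H}\cong\mathbb{R}^4$. $\mathrm{diag}(H,0)$ denotes the $2n\times 2n$ block diagonal matrix with upper-left block $H$ and all other entries zero (the zero block may be empty). The map $\Psi:M(n,\mathbb{H})\to M(2n,\mathbb{C})$ is defined, for $X=X_1+X_2\mathbf{j}$ with $X_1,X_2\in M(n,\mathbb{C})$ (where $\mathbb{C}=\mathbb{R}+\mathbb{R}\mathbf{i}\subset\mathbb{H}$), by $$\Psi(X)=\begin{pmatrix}X_1&X_2\\-\overline{X_2}&\overline{X_1}\end{pmatrix}.$$ For positive integers $d,k$, $K(d,k):=U(d)\times O(k)$ (unitary group times real orthogonal group), acting on $k$-tuples of $d\times d$ complex matrices by $$(P,R)\cdot(A_1,\dots,A_k):=\left(\sum_{j=1}^kR_{j1}P^*A_jP,\dots,\sum_{j=1}^kR_{jk}P^*A_jP\right),\qquad R=(R_{jl})\in O(k).$$ *)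

theory Defs
  imports "HOL-Analysis.Inner_Product" "Jordan_Normal_Form.Schur_Decomposition"
begin

section \<open>Quaternions\<close>

codatatype quat = Quat (qRe: real) (qIm1: real) (qIm2: real) (qIm3: real)

lemma quat_eq_iff:
  "p = q \<longleftrightarrow> qRe p = qRe q \<and> qIm1 p = qIm1 q \<and> qIm2 p = qIm2 q \<and> qIm3 p = qIm3 q"
  by (cases p; cases q) simp

instantiation quat :: ring_1
begin

primcorec zero_quat where
  "qRe 0 = 0" | "qIm1 0 = 0" | "qIm2 0 = 0" | "qIm3 0 = 0"

primcorec one_quat where
  "qRe 1 = 1" | "qIm1 1 = 0" | "qIm2 1 = 0" | "qIm3 1 = 0"

primcorec plus_quat where
  "qRe (p + q) = qRe p + qRe q"
| "qIm1 (p + q) = qIm1 p + qIm1 q"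
| "qIm2 (p + q) = qIm2 p + qIm2 q"
| "qIm3 (p + q) = qIm3 p + qIm3 q"

primcorec uminus_quat where
  "qRe (- p) = - qRe p"
| "qIm1 (- p) = - qIm1 p"
| "qIm2 (- p) = - qIm2 p"
| "qIm3 (- p) = - qIm3 p"

primcorec minus_quat where
  "qRe (p - q) = qRe p - qRe q"
| "qIm1 (p - q) = qIm1 p - qIm1 q"
| "qIm2 (p - q) = qIm2 p - qIm2 q"
| "qIm3 (p - q) = qIm3 p - qIm3 q"

primcorec times_quat where
  "qRe (p * q) = qRe p * qRe q - qIm1 p * qIm1 q - qIm2 p * qIm2 q - qIm3 p * qIm3 q"
| "qIm1 (p * q) = qRe p * qIm1 q + qIm1 p * qRe q + qIm2 p * qIm3 q - qIm3 p * qIm2 q"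
| "qIm2 (p * q) = qRe p * qIm2 q - qIm1 p * qIm3 q + qIm2 p * qRe q + qIm3 p * qIm1 q"
| "qIm3 (p * q) = qRe p * qIm3 q + qIm1 p * qIm2 q - qIm2 p * qIm1 q + qIm3 p * qRe q"

instance
  by standard (auto simp: quat_eq_iff algebra_simps)

end

instantiation quat :: real_algebra_1
begin

primcorec scaleR_quat where
  "qRe (scaleR r p) = r * qRe p"
| "qIm1 (scaleR r p) = r * qIm1 p"
| "qIm2 (scaleR r p) = r * qIm2 p"
| "qIm3 (scaleR r p) = r * qIm3 p"

instance
  by standard (auto simp: quat_eq_iff algebra_simps)

end

instantiation quat :: real_inner
begin

definition inner_quat :: "quat \<Rightarrow> quat \<Rightarrow> real" where
  "inner p q = qRe p * qRe q + qIm1 p * qIm1 q + qIm2 p * qIm2 q + qIm3 p * qIm3 q"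

definition norm_quat :: "quat \<Rightarrow> real" where
  "norm p = sqrt ((qRe p)\<^sup>2 + (qIm1 p)\<^sup>2 + (qIm2 p)\<^sup>2 + (qIm3 p)\<^sup>2)"

definition sgn_quat :: "quat \<Rightarrow> quat" where
  "sgn p = p /\<^sub>R norm (p :: quat)"

definition dist_quat :: "quat \<Rightarrow> quat \<Rightarrow> real" where
  "dist p q = norm (p - q :: quat)"

definition uniformity_quat :: "(quat \<times> quat) filter" where
  "uniformity = (INF e\<in>{0<..}. principal {(p, q :: quat). dist p q < e})"

definition open_quat :: "quat set \<Rightarrow> bool" where
  "open (U :: quat set) \<longleftrightarrow> (\<forall>p\<in>U. \<forall>\<^sub>F (p', q) in uniformity. p' = p \<longrightarrow> q \<in> U)"

instance
proof
  fix p :: quat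
  show "0 \<le> inner p p"
    by (simp add: inner_quat_def)
  show "inner p p = 0 \<longleftrightarrow> p = 0"
    by (simp add: inner_quat_def quat_eq_iff add_nonneg_eq_0_iff)
  show "norm p = sqrt (inner p p)"
    by (simp add: inner_quat_def norm_quat_def power2_eq_square)
qed (auto simp: inner_quat_def sgn_quat_def dist_quat_def uniformity_quat_def open_quat_def
       algebra_simps)

end

definition qi :: quat where "qi = Quat 0 1 0 0"
definition qj :: quat where "qj = Quat 0 0 1 0"
definition qk :: quat where "qk = Quat 0 0 0 1"

lemma quat_basis_mult:
  "qi * qi = - 1" "qj * qj = - 1" "qk * qk = - 1"
  "qi * qj = qk" "qj * qk = qi" "qk * qi = qj"
  "qj * qi = - qk" "qk * qj = - qi" "qi * qk = - qj"
  by (simp_all add: quat_eq_iff qi_def qj_def qk_def)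

definition qcnj :: "quat \<Rightarrow> quat" where
  "qcnj p = Quat (qRe p) (- qIm1 p) (- qIm2 p) (- qIm3 p)"

lemma mult_qcnj: "p * qcnj p = of_real ((norm p)\<^sup>2)"
  by (simp add: quat_eq_iff qcnj_def norm_quat_def of_real_def power2_eq_square)

definition quat_of_complex :: "complex \<Rightarrow> quat" where
  "quat_of_complex z = Quat (Re z) (Im z) 0 0"

definition cpart1 :: "quat \<Rightarrow> complex" where "cpart1 p = Complex (qRe p) (qIm1 p)"
definition cpart2 :: "quat \<Rightarrow> complex" where "cpart2 p = Complex (qIm2 p) (qIm3 p)"

lemma quat_complex_decomposition:
  "p = quat_of_complex z + quat_of_complex w * qj \<longleftrightarrow> z = cpart1 p \<and> w = cpart2 p"
  by (auto simp: quat_eq_iff quat_of_complex_def cpart1_def cpart2_def qj_def complex_eq_iff)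


section \<open>Matrices\<close>

definition frob_norm :: "'a::real_normed_vector mat \<Rightarrow> real" where
  "frob_norm X = sqrt (\<Sum>i<dim_row X. \<Sum>j<dim_col X. (norm (X $$ (i, j)))\<^sup>2)"

definition commutator :: "'a::ring mat \<Rightarrow> 'a mat \<Rightarrow> 'a mat" where
  "commutator X Y = X * Y - Y * X"

text \<open>The library's \<open>mat_adjoint\<close> needs a commutative field, so it serves complex matrices only.\<close>

definition quat_adjoint :: "quat mat \<Rightarrow> quat mat" where
  "quat_adjoint X = transpose_mat (map_mat qcnj X)"

definition mat_sum :: "nat \<Rightarrow> ('i \<Rightarrow> 'a::comm_monoid_add mat) \<Rightarrow> 'i set \<Rightarrow> 'a mat" where
  "mat_sum d F I = mat d d (\<lambda>ab. \<Sum>i\<in>I. F i $$ ab)"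

definition Psi :: "quat mat \<Rightarrow> complex mat" where
  "Psi X = (let X1 = map_mat cpart1 X; X2 = map_mat cpart2 X
            in four_block_mat X1 X2 (- map_mat cnj X2) (map_mat cnj X1))"

definition herm_part :: "complex mat \<Rightarrow> complex mat" where
  "herm_part A = (1/2) \<cdot>\<^sub>m (A + mat_adjoint A)"

definition skew_part :: "complex mat \<Rightarrow> complex mat" where
  "skew_part A = (1/2) \<cdot>\<^sub>m (A - mat_adjoint A)"

definition unitary_group :: "nat \<Rightarrow> complex mat set" where
  "unitary_group d = {P \<in> carrier_mat d d. mat_adjoint P * P = 1\<^sub>m d}"

definition orthogonal_group :: "nat \<Rightarrow> real mat set" where
  "orthogonal_group k = {R \<in> carrier_mat k k. transpose_mat R * R = 1\<^sub>m k}"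

definition K_group :: "nat \<Rightarrow> nat \<Rightarrow> (complex mat \<times> real mat) set" where
  "K_group d k = unitary_group d \<times> orthogonal_group k"

text \<open>Tuples of matrices are lists, so \<open>A\<^sub>j\<close> is \<open>As ! (j - 1)\<close>.\<close>

definition K_act ::
  "nat \<Rightarrow> nat \<Rightarrow> complex mat \<times> real mat \<Rightarrow> complex mat list \<Rightarrow> complex mat list" where
  "K_act d k = (\<lambda>(P, R) As.
     map (\<lambda>l. mat_sum d
            (\<lambda>j. complex_of_real (R $$ (j, l)) \<cdot>\<^sub>m (mat_adjoint P * As ! j * P)) {..<k})
       [0..<k])"

text \<open>Pads a \<open>2 \<times> 2\<close> matrix by zeros to size \<open>N \<times> N\<close>, for \<open>N \<ge> 2\<close>.\<close>

definition diag_pad :: "nat \<Rightarrow> complex mat \<Rightarrow> complex mat" where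
  "diag_pad N H = four_block_mat H (0\<^sub>m 2 (N - 2)) (0\<^sub>m (N - 2) 2) (0\<^sub>m (N - 2) (N - 2))"

definition H1 :: "real \<Rightarrow> complex mat" where
  "H1 l = mat_of_rows_list 2 [[complex_of_real l, 0], [0, - complex_of_real l]]"

definition H2 :: "real \<Rightarrow> complex mat" where
  "H2 l = mat_of_rows_list 2 [[0, complex_of_real l], [complex_of_real l, 0]]"

definition H3 :: "real \<Rightarrow> complex mat" where
  "H3 l = mat_of_rows_list 2
     [[0, - complex_of_real l * \<i>], [complex_of_real l * \<i>, 0]]"

end

theory Submission
  imports Defs "HOL-Analysis.Function_Topology" "HOL-Analysis.Topology_Euclidean_Space"
    "HOL-Combinatorics.Transposition"
begin

text \<open>
  For \<open>m = 2\<close> the bound is submultiplicativity of the Frobenius norm; equality forces equality in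
  Cauchy--Schwarz for every row of \<open>B\<^sub>1\<close> against every column of \<open>B\<^sub>2\<close>, which makes both matrices
  rank one, and \<open>B\<^sub>1 B\<^sub>2 = - B\<^sub>2 B\<^sub>1\<close> then identifies the remaining quaternions.

  For \<open>m \<ge> 3\<close> put \<open>A\<^sub>r = \<Psi>(B\<^sub>r)\<close>. The pointwise identity
  \<open>\<parallel>[X, Y\<^sup>*]\<parallel>\<^sup>2 = \<parallel>[X, Y]\<parallel>\<^sup>2 + Re \<langle>[X, X\<^sup>*], [Y, Y\<^sup>*]\<rangle>\<close> and the parallelogram law express
  \<open>\<Sum> \<parallel>[A\<^sub>r, A\<^sub>s]\<parallel>\<^sup>2\<close> as the commutator sum of the \<open>2m\<close> Hermitian parts minus
  \<open>\<parallel>\<Sum> [A\<^sub>r, A\<^sub>r\<^sup>*]\<parallel>\<^sup>2 / 2\<close>, so it remains to bound the former by \<open>4/3 (\<Sum> \<parallel>\<cdot>\<parallel>\<^sup>2)\<^sup>2\<close>.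
  After an orthogonal rotation the Hermitian family is pairwise orthogonal with squared norms
  \<open>b\<^sub>0 \<ge> b\<^sub>1 \<ge> \<dots>\<close>. If \<open>A\<close> has eigenvalues \<open>\<eta>\<^sub>i\<close>, Bessel's inequality and the estimate
  \<open>\<Sum> max 0 ((\<eta>\<^sub>i - \<eta>\<^sub>j)\<^sup>2 - \<parallel>A\<parallel>\<^sup>2) \<le> 2 \<parallel>A\<parallel>\<^sup>2\<close> give
  \<open>\<Sum>\<^sub>s \<parallel>[A, X\<^sub>s]\<parallel>\<^sup>2 \<le> \<parallel>A\<parallel>\<^sup>2 (\<Sum>\<^sub>s \<parallel>X\<^sub>s\<parallel>\<^sup>2 + the two largest \<parallel>X\<^sub>s\<parallel>\<^sup>2)\<close> for orthogonal \<open>X\<^sub>s\<close>,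
  and summing over the family leaves a sum of squares in the \<open>b\<^sub>l\<close>. It vanishes only for
  \<open>b\<^sub>0 = b\<^sub>1 = b\<^sub>2\<close> and all other \<open>b\<^sub>l = 0\<close>, where extremality of the commutators forces Pauli matrices.
\<close>

text \<open>Otherwise \<open>mat\<close> would denote the scalar matrices of HOL-Analysis.\<close>

hide_const (open) Finite_Cartesian_Product.mat

text \<open>The obstacle is that the family may be long. Used pair by pair,
  \<open>|[A, X]|^2 \<le> 2 |A|^2 |X|^2\<close> gives the factor \<open>2 (1 - 1/M)\<close> for
  \<open>M\<close> matrices of equal norm, which is the required 4/3 for \<open>M = 3\<close> but
  exceeds it for every larger \<open>M\<close>. A family must therefore be estimated as a whole:
  beyond the share \<open>|A|^2 |X|^2\<close> of each member, orthonormal \<open>X\<close> have a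
  total excess of at most \<open>2 |A|^2\<close> however many they are, while a single excess is at
  most \<open>|A|^2\<close>. The extreme case has three equal squared norms \<open>b\<close>, where
  six ordered pairs give \<open>12 b^2 = 4/3 (3 b)^2\<close>.

  The reductions serve this estimate. Hermitian matrices have real eigenvalues and a symmetry
  between the entries \<open>(i, j)\<close> and \<open>(j, i)\<close> that sharpens Bessel's
  inequality, and a rotation supplies orthogonality without changing either side. Since
  \<open>\<Psi>\<close> doubles squared norms, \<open>2 S \<le> 4/3 (2 T)^2\<close> turns into
  \<open>S \<le> 8/3 T^2\<close>.\<close>

lemma frob_norm_sq:
  "(frob_norm X)\<^sup>2 = (\<Sum>i<dim_row X. \<Sum>j<dim_col X. (norm (X $$ (i, j)))\<^sup>2)"
  unfolding frob_norm_def by (simp add: sum_nonneg)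

lemma frob_norm_nonneg: "0 \<le> frob_norm X"
  unfolding frob_norm_def by (simp add: sum_nonneg)

lemma frob_norm_eq_0_iff:
  "X \<in> carrier_mat nr nc \<Longrightarrow> frob_norm X = 0 \<longleftrightarrow> X = 0\<^sub>m nr nc"
  unfolding frob_norm_def
  by (auto simp: real_sqrt_eq_zero_cancel_iff sum_nonneg_eq_0_iff sum_nonneg intro!: eq_matI)

lemma index_mult_mat_sum:
  assumes "A \<in> carrier_mat nr n" "B \<in> carrier_mat n nc" "i < nr" "j < nc"
  shows "(A * B) $$ (i, j) = (\<Sum>k<n. A $$ (i, k) * B $$ (k, j))"
  using assms by (simp add: scalar_prod_def atLeast0LessThan)

lemma commutator_carrier [simp]:
  "X \<in> carrier_mat n n \<Longrightarrow> Y \<in> carrier_mat n n \<Longrightarrow> commutator X Y \<in> carrier_mat n n"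
  unfolding commutator_def by (metis minus_carrier_mat mult_carrier_mat)

lemma frob_norm_commutator_swap:
  fixes X Y :: "'a::{real_normed_algebra} mat"
  assumes "X \<in> carrier_mat n n" "Y \<in> carrier_mat n n"
  shows "frob_norm (commutator X Y) = frob_norm (commutator Y X)"
  using assms unfolding frob_norm_def commutator_def
  by (auto intro!: sum.cong simp: norm_minus_commute)

text \<open>Holds entry by entry, so an inner product on the entries suffices; it serves
  quaternionic products as well as complex Hermitian parts.\<close>

lemma frob_parallelogram:
  fixes A B :: "'a::real_inner mat"
  assumes A: "A \<in> carrier_mat nr nc" and B: "B \<in> carrier_mat nr nc"
  shows "(frob_norm (A - B))\<^sup>2 + (frob_norm (A + B))\<^sup>2 = 2 * (frob_norm A)\<^sup>2 + 2 * (frob_norm B)\<^sup>2"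
proof -
  have par: "(norm (x - y))\<^sup>2 + (norm (x + y))\<^sup>2 = 2 * (norm x)\<^sup>2 + 2 * (norm y)\<^sup>2" for x y :: 'a
    by (simp add: power2_norm_eq_inner inner_diff_left inner_diff_right inner_add_left inner_add_right)
  have "(frob_norm (A - B))\<^sup>2 + (frob_norm (A + B))\<^sup>2
    = (\<Sum>i<nr. \<Sum>j<nc. (norm (A $$ (i, j) - B $$ (i, j)))\<^sup>2 + (norm (A $$ (i, j) + B $$ (i, j)))\<^sup>2)"
    unfolding frob_norm_sq sum.distrib using A B by simp
  also have "\<dots> = 2 * (frob_norm A)\<^sup>2 + 2 * (frob_norm B)\<^sup>2"
    unfolding par sum.distrib frob_norm_sq using A B by (simp add: sum_distrib_left)
  finally show ?thesis .
qed

section \<open>Quaternions\<close>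

lemma qcnj_simps [simp]:
  "qRe (qcnj p) = qRe p" "qIm1 (qcnj p) = - qIm1 p"
  "qIm2 (qcnj p) = - qIm2 p" "qIm3 (qcnj p) = - qIm3 p"
  by (simp_all add: qcnj_def)

lemma qcnj_qcnj [simp]: "qcnj (qcnj p) = p"
  by (simp add: quat_eq_iff)

lemma qcnj_zero [simp]: "qcnj 0 = 0"
  by (simp add: quat_eq_iff)

lemma qcnj_mult: "qcnj (p * q) = qcnj q * qcnj p"
  by (simp add: quat_eq_iff algebra_simps)

lemma qcnj_sum: "qcnj (sum f A) = (\<Sum>a\<in>A. qcnj (f a))"
proof (cases "finite A")
  case True
  then show ?thesis by (induction rule: finite_induct) (simp_all add: quat_eq_iff)
qed simp

lemma quat_norm_sq: "(norm p)\<^sup>2 = (qRe p)\<^sup>2 + (qIm1 p)\<^sup>2 + (qIm2 p)\<^sup>2 + (qIm3 p)\<^sup>2"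
  by (simp add: norm_quat_def)

lemma quat_norm_mult: "norm (p * q) = norm p * norm (q :: quat)"
proof -
  have "(norm (p * q))\<^sup>2 = (norm p * norm q)\<^sup>2"
    unfolding power_mult_distrib quat_norm_sq
    by (simp add: power2_eq_square algebra_simps)
  then show ?thesis by (simp add: power2_eq_iff_nonneg)
qed

lemma norm_qcnj [simp]: "norm (qcnj p) = norm p"
  by (simp add: norm_quat_def)

instance quat :: real_normed_algebra
  by standard (simp add: quat_norm_mult)

lemma norm_quat_one [simp]: "norm (1 :: quat) = 1"
  by (simp add: norm_quat_def)

lemma qcnj_mult_self: "qcnj p * p = (norm p)\<^sup>2 *\<^sub>R 1"
  unfolding quat_norm_sq by (simp add: quat_eq_iff power2_eq_square)

lemma mult_qcnj_self: "p * qcnj p = (norm p)\<^sup>2 *\<^sub>R 1"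
  unfolding quat_norm_sq by (simp add: quat_eq_iff power2_eq_square)

lemma sum_qcnj_mult_self: "(\<Sum>k\<in>A. qcnj (f k) * f k) = (\<Sum>k\<in>A. (norm (f k))\<^sup>2) *\<^sub>R 1"
  unfolding qcnj_mult_self scaleR_sum_left ..

text \<open>Left multiplication by \<open>qcnj x\<close> is adjoint to left multiplication by
  \<open>x\<close>. This makes projection onto the right multiples of a vector computable without
  commutativity.\<close>

lemma inner_qcnj_mult_right: "inner y (qcnj x * c) = inner (x * y) c"
  by (simp add: inner_quat_def algebra_simps)

lemma quat_mult_eq_0_iff [simp]: "p * q = 0 \<longleftrightarrow> p = 0 \<or> q = (0 :: quat)"
  using quat_norm_mult[of p q] by (metis mult_eq_0_iff norm_eq_zero mult_zero_left mult_zero_right)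

lemma quat_right_inverse:
  assumes "c \<noteq> (0 :: quat)"
  obtains d where "c * d = 1"
proof
  show "c * ((1 / (norm c)\<^sup>2) *\<^sub>R qcnj c) = 1"
    using assms by (simp add: mult_qcnj_self)
qed

lemma quat_left_inverse:
  assumes "c \<noteq> (0 :: quat)"
  obtains d where "d * c = 1"
proof
  show "((1 / (norm c)\<^sup>2) *\<^sub>R qcnj c) * c = 1"
    using assms by (simp add: qcnj_mult_self)
qed

text \<open>The real part of \<open>x * y + y * x = 0\<close> equates \<open>qRe x * qRe y\<close>
  with the inner product of the imaginary parts; the imaginary components say that
  \<open>qRe x\<close> times those of \<open>y\<close> is minus \<open>qRe y\<close> times those of
  \<open>x\<close>. Inserted into \<open>qRe x\<close> times the squared norm of \<open>y\<close>,
  everything cancels.\<close>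

lemma quat_anticommute_imp:
  fixes p q :: quat
  assumes pq: "p * q + q * p = 0" and nz: "p \<noteq> 0" "q \<noteq> 0"
  shows "qRe p = 0" "qRe q = 0" "inner p q = 0"
proof -
  have gen: "qRe x = 0" if xy: "x * y + y * x = 0" and y: "y \<noteq> 0" for x y :: quat
  proof (rule ccontr)
    assume a: "qRe x \<noteq> 0"
    have e: "qRe x * qRe y = qIm1 x * qIm1 y + qIm2 x * qIm2 y + qIm3 x * qIm3 y"
      "qRe x * qIm1 y = - (qRe y * qIm1 x)" "qRe x * qIm2 y = - (qRe y * qIm2 x)"
      "qRe x * qIm3 y = - (qRe y * qIm3 x)"
      using xy by (simp_all add: quat_eq_iff algebra_simps)
    have "qRe x * (norm y)\<^sup>2 = qRe x * qRe y * qRe y + qRe x * qIm1 y * qIm1 y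
        + qRe x * qIm2 y * qIm2 y + qRe x * qIm3 y * qIm3 y"
      unfolding quat_norm_sq by (simp add: power2_eq_square algebra_simps)
    also have "\<dots> = 0"
      unfolding e by (simp add: algebra_simps)
    finally show False using a y by simp
  qed
  show p: "qRe p = 0" using gen[OF pq nz(2)] .
  show q: "qRe q = 0" using gen[of q p] pq nz(1) by (simp add: add.commute)
  show "inner p q = 0" using pq p q by (simp add: quat_eq_iff inner_quat_def)
qed

lemma quat_commutator_orthogonal:
  assumes "qRe p = 0" "qRe q = 0" "inner p q = 0"
  shows "p * q - q * p = 2 *\<^sub>R (p * q)"
  using assms by (simp add: quat_eq_iff inner_quat_def algebra_simps)

section \<open>Cauchy-Schwarz over the quaternions and its equality case\<close>

lemma power2_norm_diff:
  fixes x y :: "'a::real_inner"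
  shows "(norm (x - y))\<^sup>2 = (norm x)\<^sup>2 - 2 * inner x y + (norm y)\<^sup>2"
  by (simp add: power2_norm_eq_inner inner_diff_left inner_diff_right inner_commute)

text \<open>The coefficient \<open>S / \<rho>\<close> minimises the distance from \<open>y\<close>
  to the right multiples of \<open>qcnj x\<close>, so the left side is the squared residual. With
  the Cauchy-Schwarz defect written as a sum of squares, the inequality and its equality case come
  together.\<close>

lemma quat_weighted_cauchy:
  fixes x y :: "nat \<Rightarrow> quat" and n :: nat
  defines "\<rho> \<equiv> (\<Sum>k<n. (norm (x k))\<^sup>2)" and "S \<equiv> (\<Sum>k<n. x k * y k)"
  assumes "\<rho> \<noteq> 0"
  shows "(\<Sum>k<n. (norm (y k - qcnj (x k) * ((1 / \<rho>) *\<^sub>R S)))\<^sup>2) = (\<Sum>k<n. (norm (y k))\<^sup>2) - (norm S)\<^sup>2 / \<rho>"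
proof -
  define c where "c = (1 / \<rho>) *\<^sub>R S"
  have "(\<Sum>k<n. (norm (y k - qcnj (x k) * c))\<^sup>2)
      = (\<Sum>k<n. (norm (y k))\<^sup>2 - 2 * inner (x k * y k) c + (norm (x k))\<^sup>2 * (norm c)\<^sup>2)"
    by (simp add: power2_norm_diff inner_qcnj_mult_right quat_norm_mult power_mult_distrib)
  also have "\<dots> = (\<Sum>k<n. (norm (y k))\<^sup>2) - 2 * inner S c + \<rho> * (norm c)\<^sup>2"
    by (simp add: sum.distrib sum_subtractf S_def \<rho>_def inner_sum_left sum_distrib_left sum_distrib_right)
  also have "\<dots> = (\<Sum>k<n. (norm (y k))\<^sup>2) - (norm S)\<^sup>2 / \<rho>"
    using assms(3) by (simp add: c_def power2_norm_eq_inner[symmetric] power2_eq_square)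
  finally show ?thesis unfolding c_def .
qed

lemma quat_cauchy_schwarz:
  fixes x y :: "nat \<Rightarrow> quat"
  shows "(norm (\<Sum>k<n. x k * y k))\<^sup>2 \<le> (\<Sum>k<n. (norm (x k))\<^sup>2) * (\<Sum>k<n. (norm (y k))\<^sup>2)"
proof (cases "(\<Sum>k<n. (norm (x k))\<^sup>2) = 0")
  case True
  then have "\<forall>k<n. x k = 0" by (auto simp: sum_nonneg_eq_0_iff)
  then show ?thesis by simp
next
  case False
  then have pos: "(\<Sum>k<n. (norm (x k))\<^sup>2) > 0" by (simp add: order_less_le sum_nonneg)
  have "0 \<le> (\<Sum>k<n. (norm (y k))\<^sup>2) - (norm (\<Sum>k<n. x k * y k))\<^sup>2 / (\<Sum>k<n. (norm (x k))\<^sup>2)"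
    unfolding quat_weighted_cauchy[OF False, of y, symmetric] by (intro sum_nonneg) simp
  then show ?thesis using pos by (simp add: pos_divide_le_eq mult.commute)
qed

lemma quat_cauchy_schwarz_eq:
  fixes x y :: "nat \<Rightarrow> quat"
  assumes eq: "(norm (\<Sum>k<n. x k * y k))\<^sup>2 = (\<Sum>k<n. (norm (x k))\<^sup>2) * (\<Sum>k<n. (norm (y k))\<^sup>2)"
    and x: "k0 < n" "x k0 \<noteq> 0"
  obtains c where "\<And>k. k < n \<Longrightarrow> y k = qcnj (x k) * c"
proof -
  let ?\<rho> = "\<Sum>k<n. (norm (x k))\<^sup>2"
  have \<rho>: "?\<rho> \<noteq> 0" using x by (auto simp: sum_nonneg_eq_0_iff)
  define c where "c = (1 / ?\<rho>) *\<^sub>R (\<Sum>k<n. x k * y k)"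
  have "(\<Sum>k<n. (norm (y k - qcnj (x k) * c))\<^sup>2) = 0"
    unfolding c_def quat_weighted_cauchy[OF \<rho>] eq using \<rho> by simp
  then have "\<forall>k<n. y k = qcnj (x k) * c" by (auto simp: sum_nonneg_eq_0_iff)
  then show ?thesis using that by blast
qed

section \<open>Two quaternionic matrices\<close>

context
  fixes n :: nat and X Y :: "quat mat"
  assumes X: "X \<in> carrier_mat n n" and Y: "Y \<in> carrier_mat n n"
begin

lemma quat_frob_mult_le: "frob_norm (X * Y) \<le> frob_norm X * frob_norm Y"
  and quat_frob_mult_eq:
    "frob_norm (X * Y) = frob_norm X * frob_norm Y \<Longrightarrow> i < n \<Longrightarrow> j < n \<Longrightarrow>
      (norm (\<Sum>k<n. X $$ (i, k) * Y $$ (k, j)))\<^sup>2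
        = (\<Sum>k<n. (norm (X $$ (i, k)))\<^sup>2) * (\<Sum>k<n. (norm (Y $$ (k, j)))\<^sup>2)"
proof -
  let ?l = "\<lambda>i j. (norm (\<Sum>k<n. X $$ (i, k) * Y $$ (k, j)))\<^sup>2"
  let ?r = "\<lambda>i j. (\<Sum>k<n. (norm (X $$ (i, k)))\<^sup>2) * (\<Sum>k<n. (norm (Y $$ (k, j)))\<^sup>2)"
  have l: "(frob_norm (X * Y))\<^sup>2 = (\<Sum>i<n. \<Sum>j<n. ?l i j)"
    unfolding frob_norm_sq using X Y by (simp add: index_mult_mat_sum[OF X Y] del: index_mult_mat(1))
  have r: "(frob_norm X * frob_norm Y)\<^sup>2 = (\<Sum>i<n. \<Sum>j<n. ?r i j)"
  proof -
    have "(frob_norm Y)\<^sup>2 = (\<Sum>j<n. \<Sum>k<n. (norm (Y $$ (k, j)))\<^sup>2)"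
      unfolding frob_norm_sq using Y by (subst sum.swap) auto
    then show ?thesis unfolding power_mult_distrib using X
      by (simp add: frob_norm_sq sum_product)
  qed
  have le: "?l i j \<le> ?r i j" for i j by (rule quat_cauchy_schwarz)
  have "(frob_norm (X * Y))\<^sup>2 \<le> (frob_norm X * frob_norm Y)\<^sup>2"
    unfolding l r by (intro sum_mono le)
  then show "frob_norm (X * Y) \<le> frob_norm X * frob_norm Y"
    by (rule power2_le_imp_le) (simp add: frob_norm_nonneg)
  assume eq: "frob_norm (X * Y) = frob_norm X * frob_norm Y" and ij: "i < n" "j < n"
  have "(\<Sum>i<n. \<Sum>j<n. ?r i j - ?l i j) = 0"
    using l r eq by (simp add: sum_subtractf)
  then have "\<forall>i<n. (\<Sum>j<n. ?r i j - ?l i j) = 0"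
    by (subst (asm) sum_nonneg_eq_0_iff) (auto intro!: sum_nonneg simp: le)
  then have "\<forall>i<n. \<forall>j<n. ?r i j - ?l i j = 0"
    by (subst (asm) sum_nonneg_eq_0_iff) (auto simp: le)
  then show "?l i j = ?r i j" using ij by simp
qed


end

context
  fixes n :: nat and X Y :: "quat mat"
  assumes X: "X \<in> carrier_mat n n" and Y: "Y \<in> carrier_mat n n"
begin

text \<open>By the parallelogram law \<open>|XY - YX|^2\<close> is
  \<open>2 |XY|^2 + 2 |YX|^2\<close> less \<open>|XY + YX|^2\<close>, so equality needs both full
  submultiplicativity and anticommutation. The constant 2 is attained already by the 1 by 1 matrices
  \<open>qi\<close> and \<open>qj\<close>.\<close>

lemma quat_commutator_bound:
  "frob_norm (commutator X Y) \<le> 2 * frob_norm X * frob_norm Y"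
  and quat_commutator_bound_eq:
  "frob_norm (commutator X Y) = 2 * frob_norm X * frob_norm Y \<Longrightarrow>
     frob_norm (X * Y) = frob_norm X * frob_norm Y \<and> X * Y = - (Y * X)"
proof -
  have car: "X * Y \<in> carrier_mat n n" "Y * X \<in> carrier_mat n n" using X Y by auto
  let ?a = "X * Y" and ?b = "Y * X"
  have par: "(frob_norm (commutator X Y))\<^sup>2 + (frob_norm (?a + ?b))\<^sup>2
      = 2 * (frob_norm ?a)\<^sup>2 + 2 * (frob_norm ?b)\<^sup>2"
    unfolding commutator_def by (rule frob_parallelogram[OF car])
  have le: "frob_norm ?a \<le> frob_norm X * frob_norm Y" "frob_norm ?b \<le> frob_norm X * frob_norm Y"
    using quat_frob_mult_le[OF X Y] quat_frob_mult_le[OF Y X] by (simp_all add: mult.commute)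
  let ?p = "frob_norm X * frob_norm Y"
  have sq: "(frob_norm ?a)\<^sup>2 \<le> ?p\<^sup>2" "(frob_norm ?b)\<^sup>2 \<le> ?p\<^sup>2"
    using le by (simp_all add: power_mono frob_norm_nonneg)
  have "(2 * ?p)\<^sup>2 = 4 * ?p\<^sup>2" by (simp add: power_mult_distrib)
  then have "(frob_norm (commutator X Y))\<^sup>2 \<le> (2 * ?p)\<^sup>2"
    using par sq zero_le_power2[of "frob_norm (?a + ?b)"] by linarith
  then show "frob_norm (commutator X Y) \<le> 2 * frob_norm X * frob_norm Y"
    using power2_le_imp_le[of "frob_norm (commutator X Y)" "2 * ?p"]
    by (simp add: frob_norm_nonneg mult.assoc)
  assume "frob_norm (commutator X Y) = 2 * frob_norm X * frob_norm Y"
  then have "(frob_norm (commutator X Y))\<^sup>2 = 4 * ?p\<^sup>2"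
    by (simp add: power_mult_distrib)
  then have "(frob_norm (?a + ?b))\<^sup>2 = 0" "(frob_norm ?a)\<^sup>2 = ?p\<^sup>2"
    using par sq zero_le_power2[of "frob_norm (?a + ?b)"] by linarith+
  then have z: "frob_norm (?a + ?b) = 0" and "frob_norm ?a = ?p"
    by (simp_all add: power2_eq_iff_nonneg frob_norm_nonneg)
  have "?a + ?b = 0\<^sub>m n n"
    using z frob_norm_eq_0_iff[of "?a + ?b" n n] car by simp
  then have "?a $$ (i, j) + ?b $$ (i, j) = 0" if "i < n" "j < n" for i j
    using that car by (metis carrier_matD index_add_mat(1) index_zero_mat(1))
  then have "?a = - ?b"
    using X Y by (intro eq_matI) (auto simp: eq_neg_iff_add_eq_0 simp del: index_mult_mat(1))
  with \<open>frob_norm ?a = ?p\<close> show "frob_norm ?a = ?p \<and> ?a = - ?b" by simp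
qed

end

section \<open>Quaternionic matrices of rank one\<close>

definition quat_rank_one :: "quat mat \<Rightarrow> quat \<Rightarrow> quat mat" where
  "quat_rank_one u p = u * mat 1 1 (\<lambda>_. p) * quat_adjoint u"

lemma quat_rank_one_entry:
  assumes u: "u \<in> carrier_mat n 1" and ij: "i < n" "j < n"
  shows "quat_rank_one u p $$ (i, j) = u $$ (i, 0) * p * qcnj (u $$ (j, 0))"
proof -
  have c: "mat 1 1 (\<lambda>_. p) \<in> carrier_mat 1 1" "quat_adjoint u \<in> carrier_mat 1 n"
    "u * mat 1 1 (\<lambda>_. p) \<in> carrier_mat n 1"
    using u by (auto simp: quat_adjoint_def)
  have "(u * mat 1 1 (\<lambda>_. p)) $$ (i, 0) = u $$ (i, 0) * p"
    by (subst index_mult_mat_sum[OF u c(1)]) (use ij in auto)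
  moreover have "quat_adjoint u $$ (0, j) = qcnj (u $$ (j, 0))"
    using u ij by (simp add: quat_adjoint_def)
  ultimately show ?thesis
    unfolding quat_rank_one_def by (subst index_mult_mat_sum[OF c(3,2)]) (use ij in auto)
qed

lemma quat_rank_one_carrier:
  "u \<in> carrier_mat n 1 \<Longrightarrow> quat_rank_one u p \<in> carrier_mat n n"
  by (auto simp: quat_rank_one_def quat_adjoint_def)

lemma dim_quat_rank_one [simp]:
  "dim_row (quat_rank_one u p) = dim_row u" "dim_col (quat_rank_one u p) = dim_row u"
  by (simp_all add: quat_rank_one_def quat_adjoint_def)

lemma quat_rank_one_norm:
  assumes u: "u \<in> carrier_mat n 1" "frob_norm u = 1"
  shows "frob_norm (quat_rank_one u p) = norm p"
proof -
  have s: "(\<Sum>i<n. (norm (u $$ (i, 0)))\<^sup>2) = 1"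
    using u frob_norm_sq[of u] by simp
  have "(frob_norm (quat_rank_one u p))\<^sup>2
      = (\<Sum>i<n. \<Sum>j<n. (norm (u $$ (i, 0)))\<^sup>2 * (norm p)\<^sup>2 * (norm (u $$ (j, 0)))\<^sup>2)"
    unfolding frob_norm_sq using u(1)
    by (simp add: quat_rank_one_entry[OF u(1)] quat_norm_mult power_mult_distrib)
  also have "\<dots> = (norm p)\<^sup>2"
    by (simp add: s flip: sum_distrib_left sum_distrib_right)
  finally show ?thesis by (simp add: power2_eq_iff_nonneg frob_norm_nonneg)
qed

lemma quat_unit_sum:
  assumes u: "u \<in> carrier_mat n 1" "frob_norm u = 1"
  shows "(\<Sum>k<n. qcnj (u $$ (k, 0)) * u $$ (k, 0)) = 1"
  using u frob_norm_sq[of u] by (simp add: sum_qcnj_mult_self)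

text \<open>For a unit vector the product of \<open>quat_adjoint u\<close> and \<open>u\<close>
  arising in the middle is 1. So \<open>quat_rank_one u\<close> is a multiplicative isometry, and
  relations between \<open>p\<close> and \<open>q\<close> can be read off from the matrices and
  conversely.\<close>

lemma quat_rank_one_mult:
  assumes u: "u \<in> carrier_mat n 1" "frob_norm u = 1"
  shows "(quat_rank_one u p) * (quat_rank_one u q)
    = quat_rank_one u (p * q)" (is "?P * ?Q = ?R")
proof (rule eq_matI)
  note c = quat_rank_one_carrier[OF u(1)]
  show "dim_row (?P * ?Q) = dim_row ?R" "dim_col (?P * ?Q) = dim_col ?R"
    using c[of p] c[of q] c[of "p * q"] by auto
  fix i j assume "i < dim_row ?R" "j < dim_col ?R"
  then have ij: "i < n" "j < n" using c[of "p * q"] by auto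
  have "(?P * ?Q) $$ (i, j) = (\<Sum>k<n. u $$ (i, 0) * p * (qcnj (u $$ (k, 0)) * u $$ (k, 0)) * q * qcnj (u $$ (j, 0)))"
    using ij by (simp add: index_mult_mat_sum[OF c c] quat_rank_one_entry[OF u(1)] mult.assoc
       )
  also have "\<dots> = u $$ (i, 0) * p * q * qcnj (u $$ (j, 0))"
    by (simp add: quat_unit_sum[OF u] flip: sum_distrib_left sum_distrib_right)
  finally show "(?P * ?Q) $$ (i, j) = ?R $$ (i, j)"
    using ij by (simp add: quat_rank_one_entry[OF u(1)] mult.assoc)
qed

lemma quat_rank_one_commutator_norm:
  assumes u: "u \<in> carrier_mat n 1" "frob_norm u = 1"
    and "qRe p = 0" "qRe q = 0" "inner p q = 0"
  shows "frob_norm (commutator (quat_rank_one u p) (quat_rank_one u q))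
    = 2 * norm p * norm q"
proof -
  have "commutator (quat_rank_one u p) (quat_rank_one u q)
    = quat_rank_one u (p * q - q * p)" (is "_ = ?R")
    unfolding commutator_def quat_rank_one_mult[OF u]
    using u(1) by (intro eq_matI) (auto simp: quat_rank_one_entry[OF u(1)] algebra_simps)
  then show ?thesis
    by (simp add: quat_rank_one_norm[OF u] quat_commutator_orthogonal[OF assms(3-5)] quat_norm_mult)
qed

lemma quat_commutator_eq_imp_rank_one:
  assumes X: "X \<in> carrier_mat n n" and Y: "Y \<in> carrier_mat n n" and n: "n \<ge> 1"
    and eq: "frob_norm (commutator X Y) = (frob_norm X)\<^sup>2 + (frob_norm Y)\<^sup>2"
  shows "\<exists>u \<in> carrier_mat n 1. \<exists>p q :: quat.
              frob_norm u = 1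
              \<and> qRe p = 0 \<and> qRe q = 0 \<and> inner p q = 0 \<and> norm p = norm q
              \<and> X = quat_rank_one u p
              \<and> Y = quat_rank_one u q"
proof -
  \<comment> \<open>For the two norms, the hypothesis and the commutator bound give
    \<open>x^2 + y^2 \<le> 2 x y\<close>.\<close>
  have "(frob_norm X - frob_norm Y)\<^sup>2 \<le> 0"
    using quat_commutator_bound[OF X Y] eq by (simp add: power2_diff)
  then have nxy: "frob_norm X = frob_norm Y" by simp
  have "frob_norm (commutator X Y) = 2 * frob_norm X * frob_norm Y"
    using eq nxy by (simp add: power2_eq_square)
  from quat_commutator_bound_eq[OF X Y this]
  have fXY: "frob_norm (X * Y) = frob_norm X * frob_norm Y" and anti: "X * Y = - (Y * X)" by auto
  show ?thesis
  proof (cases "frob_norm X = 0")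
    case True
    then have z: "X = 0\<^sub>m n n" "Y = 0\<^sub>m n n"
      using nxy frob_norm_eq_0_iff[OF X] frob_norm_eq_0_iff[OF Y] by simp_all
    \<comment> \<open>Any unit vector represents the zero matrix with \<open>p = q = 0\<close>; the
      first basis vector exists because \<open>n \<ge> 1\<close>.\<close>
    define u :: "quat mat" where "u = mat n 1 (\<lambda>(i, j). if i = 0 then 1 else 0)"
    have u: "u \<in> carrier_mat n 1" by (simp add: u_def)
    have "(frob_norm u)\<^sup>2 = (\<Sum>i<n. if i = 0 then 1 else 0)"
      unfolding frob_norm_sq by (simp add: u_def if_distrib[of norm] if_distrib[of "\<lambda>x. x\<^sup>2"] cong: if_cong)
    also have "\<dots> = 1" using n by (simp add: sum.delta)
    finally have "frob_norm u = 1" using frob_norm_nonneg[of u] by (simp add: power2_eq_1_iff)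
    moreover have "0\<^sub>m n n = quat_rank_one u 0"
      using quat_rank_one_carrier[OF u, of 0]
      by (intro eq_matI) (auto simp: quat_rank_one_entry[OF u])
    ultimately show ?thesis using u z
      by (intro bexI[of _ u] exI[of _ 0]) auto
  next
    case False
    note cs = quat_frob_mult_eq[OF X Y fXY]
    have "X \<noteq> 0\<^sub>m n n" "Y \<noteq> 0\<^sub>m n n"
      using False nxy frob_norm_eq_0_iff[OF X] frob_norm_eq_0_iff[OF Y] by simp_all
    obtain i0 k0 where i0: "i0 < n" "k0 < n" "X $$ (i0, k0) \<noteq> 0"
    proof (rule ccontr)
      assume "\<not> thesis"
      then have "X = 0\<^sub>m n n" using X that by (intro eq_matI) auto
      with \<open>X \<noteq> 0\<^sub>m n n\<close> show False ..
    qed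
    obtain k1 j0 where j0: "k1 < n" "j0 < n" "Y $$ (k1, j0) \<noteq> 0"
    proof (rule ccontr)
      assume "\<not> thesis"
      then have "Y = 0\<^sub>m n n" using Y that by (intro eq_matI) auto
      with \<open>Y \<noteq> 0\<^sub>m n n\<close> show False ..
    qed
    define r where "r = sqrt (\<Sum>k<n. (norm (X $$ (i0, k)))\<^sup>2)"
    have "(\<Sum>k<n. (norm (X $$ (i0, k)))\<^sup>2) > 0"
      using i0 by (intro sum_pos2[of _ k0]) auto
    then have r: "r > 0" "r\<^sup>2 = (\<Sum>k<n. (norm (X $$ (i0, k)))\<^sup>2)"
      by (simp_all add: r_def)
    \<comment> \<open>The common direction: the conjugate of row \<open>i0\<close> of
      \<open>X\<close>, normalised. Equality in Cauchy-Schwarz against this one row makes every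
      column of \<open>Y\<close> a right multiple of \<open>v\<close>.\<close>
    define v where "v k = (1 / r) *\<^sub>R qcnj (X $$ (i0, k))" for k
    have v1: "(\<Sum>k<n. (norm (v k))\<^sup>2) = 1"
      using r unfolding v_def by (simp add: power_mult_distrib power_divide flip: sum_divide_distrib r(2))
    then have vv: "(\<Sum>k<n. qcnj (v k) * v k) = 1"
      by (simp add: sum_qcnj_mult_self)
    have "\<exists>c. \<forall>k<n. Y $$ (k, j) = v k * c" if "j < n" for j
    proof -
      from quat_cauchy_schwarz_eq[OF cs[OF i0(1) that] i0(2,3)]
      obtain c where c: "\<And>k. k < n \<Longrightarrow> Y $$ (k, j) = qcnj (X $$ (i0, k)) * c" by blast
      have "Y $$ (k, j) = v k * (r *\<^sub>R c)" if "k < n" for k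
        using c[OF that] r by (simp add: v_def)
      then show ?thesis by blast
    qed
    then obtain c where c: "\<And>j k. j < n \<Longrightarrow> k < n \<Longrightarrow> Y $$ (k, j) = v k * c j" by metis
    have cj0: "c j0 \<noteq> 0" using c[OF j0(2,1)] j0(3) by auto
    have "\<exists>d. \<forall>k<n. X $$ (i, k) = d * qcnj (v k)" if i: "i < n" for i
    proof -
      \<comment> \<open>Conjugation reverses products, so column \<open>j0\<close> of
        \<open>Y\<close> becomes the fixed left factor, and the rows of \<open>X\<close> turn out to
        be left multiples of the conjugate of \<open>v\<close>.\<close>
      have e: "(\<Sum>k<n. qcnj (Y $$ (k, j0)) * qcnj (X $$ (i, k))) = qcnj (\<Sum>k<n. X $$ (i, k) * Y $$ (k, j0))"
        by (simp add: qcnj_sum qcnj_mult)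
      have "(norm (\<Sum>k<n. qcnj (Y $$ (k, j0)) * qcnj (X $$ (i, k))))\<^sup>2 =
        (\<Sum>k<n. (norm (qcnj (Y $$ (k, j0))))\<^sup>2) * (\<Sum>k<n. (norm (qcnj (X $$ (i, k))))\<^sup>2)"
        using cs[OF i j0(2)] unfolding e by (simp add: mult.commute)
      from quat_cauchy_schwarz_eq[OF this j0(1)] j0(3)
      obtain c' where c': "\<And>k. k < n \<Longrightarrow> qcnj (X $$ (i, k)) = Y $$ (k, j0) * c'"
        by (metis qcnj_qcnj qcnj_zero)
      have "X $$ (i, k) = (qcnj c' * qcnj (c j0)) * qcnj (v k)" if k: "k < n" for k
      proof -
        have "X $$ (i, k) = qcnj (v k * c j0 * c')"
          using c'[OF k] c[OF j0(2) k] by (metis qcnj_qcnj)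
        then show ?thesis by (simp add: qcnj_mult mult.assoc)
      qed
      then show ?thesis by blast
    qed
    then obtain d where d: "\<And>i k. i < n \<Longrightarrow> k < n \<Longrightarrow> X $$ (i, k) = d i * qcnj (v k)" by metis
    have di0: "d i0 \<noteq> 0" using d[OF i0(1,2)] i0(3) by auto
    \<comment> \<open>\<open>g\<close> is the scalar produced in the middle of \<open>Y * X\<close>,
      so \<open>X * Y = - (Y * X)\<close> reads \<open>d i * c j = - (v i * g * qcnj (v j))\<close>.
      Cancelling the nonzero \<open>c j0\<close> on the right and \<open>d i0\<close> on the left
      shows that \<open>d\<close> is \<open>v\<close> times a constant \<open>p\<close> and
      \<open>c\<close> a constant \<open>q\<close> times the conjugate of \<open>v\<close>.\<close>
    define g where "g = (\<Sum>k<n. c k * d k)"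
    have dc: "d i * c j = - (v i * g * qcnj (v j))" if ij: "i < n" "j < n" for i j
    proof -
      have "d i * c j = d i * (\<Sum>k<n. qcnj (v k) * v k) * c j" by (simp add: vv)
      also have "\<dots> = (\<Sum>k<n. X $$ (i, k) * Y $$ (k, j))"
        using ij by (simp add: d c sum_distrib_left sum_distrib_right mult.assoc)
      also have "\<dots> = (X * Y) $$ (i, j)" using index_mult_mat_sum[OF X Y ij] by simp
      also have "\<dots> = - ((Y * X) $$ (i, j))" unfolding anti using ij X Y by simp
      also have "\<dots> = - (\<Sum>k<n. Y $$ (i, k) * X $$ (k, j))" using index_mult_mat_sum[OF Y X ij] by simp
      also have "\<dots> = - (v i * g * qcnj (v j))"
        using ij by (simp add: d c g_def sum_distrib_left sum_distrib_right mult.assoc)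
      finally show ?thesis .
    qed
    obtain ci where ci: "c j0 * ci = 1" using quat_right_inverse[OF cj0] .
    define p where "p = - (g * qcnj (v j0) * ci)"
    have dp: "d i = v i * p" if "i < n" for i
    proof -
      have "d i = d i * (c j0 * ci)" by (simp add: ci)
      also have "\<dots> = - (v i * g * qcnj (v j0)) * ci" using dc[OF that j0(2)] by (simp add: mult.assoc[symmetric])
      finally show ?thesis by (simp add: p_def mult.assoc)
    qed
    obtain di where di: "di * d i0 = 1" using quat_left_inverse[OF di0] .
    define q where "q = - (di * v i0 * g)"
    have cq: "c j = q * qcnj (v j)" if "j < n" for j
    proof -
      have "c j = di * (d i0 * c j)" by (simp add: di flip: mult.assoc)
      then show ?thesis using dc[OF i0(1) that] by (simp add: q_def mult.assoc)
    qed
    define u where "u = mat n 1 (\<lambda>(i, j). v i)"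
    have u: "u \<in> carrier_mat n 1" by (simp add: u_def)
    have ui: "u $$ (i, 0) = v i" if "i < n" for i using that by (simp add: u_def)
    have "(frob_norm u)\<^sup>2 = 1" unfolding frob_norm_sq using v1 by (simp add: u_def)
    then have u1: "frob_norm u = 1" using frob_norm_nonneg[of u] by (simp add: power2_eq_1_iff)
    have Xu: "X = quat_rank_one u p"
      using X u by (intro eq_matI) (auto simp: quat_rank_one_entry[OF u] d dp ui)
    have Yu: "Y = quat_rank_one u q"
      using Y u by (intro eq_matI) (auto simp: quat_rank_one_entry[OF u] c cq ui mult.assoc)
    have np: "norm p = frob_norm X" "norm q = frob_norm Y"
      using Xu Yu quat_rank_one_norm[OF u u1] by metis+
    have nz: "p \<noteq> 0" "q \<noteq> 0" using np False nxy by auto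
    \<comment> \<open>Anticommutation is pulled back from the matrices to \<open>p\<close> and
      \<open>q\<close>, as \<open>quat_rank_one u\<close> preserves norms.\<close>
    have "quat_rank_one u (p * q + q * p) = 0\<^sub>m n n" (is "?R = _")
    proof (rule eq_matI)
      show "dim_row ?R = dim_row (0\<^sub>m n n)" "dim_col ?R = dim_col (0\<^sub>m n n)"
        using quat_rank_one_carrier[OF u, of "p * q + q * p"] by auto
      fix i j assume "i < dim_row (0\<^sub>m n n)" "j < dim_col (0\<^sub>m n n)"
      then have ij: "i < n" "j < n" by auto
      have a: "X * Y = quat_rank_one u (p * q)"
        "Y * X = quat_rank_one u (q * p)"
        unfolding Xu Yu quat_rank_one_mult[OF u u1] by simp_all
      have "(X * Y) $$ (i, j) = - ((Y * X) $$ (i, j))"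
        unfolding anti using ij X Y by simp
      then show "?R $$ (i, j) = 0\<^sub>m n n $$ (i, j)"
        unfolding a using ij by (simp add: quat_rank_one_entry[OF u] distrib_left distrib_right)
    qed
    moreover have "frob_norm (0\<^sub>m n n :: quat mat) = 0" using frob_norm_eq_0_iff[of "0\<^sub>m n n :: quat mat" n n] by simp
    ultimately have "p * q + q * p = 0"
      using quat_rank_one_norm[OF u u1, of "p * q + q * p"] by simp
    from quat_anticommute_imp[OF this nz] u u1 Xu Yu np nxy show ?thesis
      by (intro bexI[of _ u] exI[of _ p] exI[of _ q]) auto
  qed
qed

text \<open>The factor 2 on the left counts the ordered pairs \<open>(1, 2)\<close> and
  \<open>(2, 1)\<close>. The estimate joins the commutator bound with
  \<open>2 x y \<le> x^2 + y^2\<close>.\<close>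

theorem two_quat_matrices:
  assumes X: "X \<in> carrier_mat n n" and Y: "Y \<in> carrier_mat n n" and n: "n \<ge> 1"
  shows "2 * (frob_norm (commutator X Y))\<^sup>2 \<le> 2 * ((frob_norm X)\<^sup>2 + (frob_norm Y)\<^sup>2)\<^sup>2"
    and "2 * (frob_norm (commutator X Y))\<^sup>2 = 2 * ((frob_norm X)\<^sup>2 + (frob_norm Y)\<^sup>2)\<^sup>2 \<longleftrightarrow>
      (\<exists>u \<in> carrier_mat n 1. \<exists>p q :: quat.
              frob_norm u = 1
              \<and> qRe p = 0 \<and> qRe q = 0 \<and> inner p q = 0 \<and> norm p = norm q
              \<and> X = quat_rank_one u p
              \<and> Y = quat_rank_one u q)" (is "_ \<longleftrightarrow> ?R")
proof -
  have "2 * frob_norm X * frob_norm Y \<le> (frob_norm X)\<^sup>2 + (frob_norm Y)\<^sup>2"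
    by (rule sum_squares_bound)
  then have le: "frob_norm (commutator X Y) \<le> (frob_norm X)\<^sup>2 + (frob_norm Y)\<^sup>2"
    using quat_commutator_bound[OF X Y] by simp
  then show "2 * (frob_norm (commutator X Y))\<^sup>2 \<le> 2 * ((frob_norm X)\<^sup>2 + (frob_norm Y)\<^sup>2)\<^sup>2"
    by (simp add: power_mono frob_norm_nonneg)
  have "2 * (frob_norm (commutator X Y))\<^sup>2 = 2 * ((frob_norm X)\<^sup>2 + (frob_norm Y)\<^sup>2)\<^sup>2 \<longleftrightarrow>
    frob_norm (commutator X Y) = (frob_norm X)\<^sup>2 + (frob_norm Y)\<^sup>2"
    by (simp add: power2_eq_iff_nonneg frob_norm_nonneg)
  also have "\<dots> \<longleftrightarrow> ?R"
  proof
    assume ?R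
    then obtain u p q where u: "u \<in> carrier_mat n 1" "frob_norm u = 1" and pq: "qRe p = 0" "qRe q = 0" "inner p q = 0"
      and npq: "norm p = norm q"
      and "X = quat_rank_one u p" "Y = quat_rank_one u q" by blast
    then show "frob_norm (commutator X Y) = (frob_norm X)\<^sup>2 + (frob_norm Y)\<^sup>2"
      unfolding \<open>X = _\<close> \<open>Y = _\<close> quat_rank_one_commutator_norm[OF u pq] quat_rank_one_norm[OF u]
      by (simp add: npq power2_eq_square)
  qed (rule quat_commutator_eq_imp_rank_one[OF X Y n])
  finally show "2 * (frob_norm (commutator X Y))\<^sup>2 = 2 * ((frob_norm X)\<^sup>2 + (frob_norm Y)\<^sup>2)\<^sup>2 \<longleftrightarrow> ?R" .
qed

section \<open>Orthonormal frames and diagonalisation\<close>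

text \<open>Vectors and forms are plain functions because the compactness argument takes place in
  the product topology on functions.\<close>

definition herm_form :: "nat \<Rightarrow> (nat \<Rightarrow> nat \<Rightarrow> complex) \<Rightarrow> (nat \<Rightarrow> complex) \<Rightarrow> (nat \<Rightarrow> complex) \<Rightarrow> complex" where
  "herm_form N G x y = (\<Sum>a<N. \<Sum>b<N. cnj (x a) * G a b * y b)"

text \<open>The vectors are \<open>p 0\<close> to \<open>p (N - 1)\<close>, with coordinates in
  \<open>K\<close>. Taking \<open>K = \<real>\<close> gives orthogonal matrices and
  \<open>K = UNIV\<close> unitary ones, so one maximisation argument serves both.\<close>

definition orthonormal_frame :: "nat \<Rightarrow> complex set \<Rightarrow> (nat \<Rightarrow> nat \<Rightarrow> complex) \<Rightarrow> bool" where
  "orthonormal_frame N K p \<longleftrightarrow> (\<forall>l<N. \<forall>a<N. p l a \<in> K) \<and>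
     (\<forall>l<N. \<forall>l'<N. (\<Sum>a<N. cnj (p l a) * p l' a) = (if l = l' then 1 else 0))"

text \<open>The weights decrease strictly, so that a maximal frame diagonalises the form with its values
  in decreasing order.\<close>

definition frame_weight :: "nat \<Rightarrow> (nat \<Rightarrow> nat \<Rightarrow> complex) \<Rightarrow> (nat \<Rightarrow> nat \<Rightarrow> complex) \<Rightarrow> real" where
  "frame_weight N G p = (\<Sum>l<N. - real l * Re (herm_form N G (p l) (p l)))"

text \<open>Tychonoff's theorem, carried over to the topology of the function type.\<close>

lemma compact_Pi_UNIV:
  fixes S :: "'a \<Rightarrow> 'b::topological_space set"
  assumes "\<And>i. compact (S i)"
  shows "compact {f. \<forall>i. f i \<in> S i}"
proof -
  have "compactin (product_topology (\<lambda>i. euclidean) UNIV) (PiE UNIV S)"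
    unfolding compactin_PiE using assms by (simp add: compactin_euclidean_iff)
  moreover have "PiE UNIV S = {f. \<forall>i. f i \<in> S i}" by auto
  ultimately show ?thesis by (simp add: euclidean_product_topology compactin_euclidean_iff)
qed

lemma continuous_on_frame_entry [continuous_intros]:
  "continuous_on UNIV (\<lambda>p :: nat \<Rightarrow> nat \<Rightarrow> complex. p l a)"
proof -
  have "continuous_on UNIV (\<lambda>p :: nat \<Rightarrow> nat \<Rightarrow> complex. p l)" by simp
  then show ?thesis by (rule continuous_on_product_then_coordinatewise)
qed

lemma orthonormal_frame_norm_le:
  assumes "orthonormal_frame N K p" "l < N" "a < N"
  shows "norm (p l a) \<le> 1"
proof -
  have "complex_of_real (\<Sum>a<N. (norm (p l a))\<^sup>2) = (\<Sum>a<N. cnj (p l a) * p l a)"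
    unfolding of_real_sum complex_norm_square by (simp add: mult.commute)
  also have "\<dots> = 1" using assms unfolding orthonormal_frame_def by simp
  finally have "(\<Sum>a<N. (norm (p l a))\<^sup>2) = 1" using of_real_eq_1_iff by blast
  moreover have "(norm (p l a))\<^sup>2 \<le> (\<Sum>a<N. (norm (p l a))\<^sup>2)"
    using assms(3) by (intro member_le_sum) auto
  ultimately show ?thesis by (simp add: power2_nonneg_ge_1_iff abs_square_le_1[of "norm (p l a)"])
qed

lemma frame_weight_max_exists:
  assumes K: "closed K" "0 \<in> K" "1 \<in> K"
  obtains p where "orthonormal_frame N K p"
    and "\<And>q. orthonormal_frame N K q \<Longrightarrow> frame_weight N G q \<le> frame_weight N G p"
proof -
  \<comment> \<open>Coordinates beyond \<open>N\<close> are pinned to 0: the frame conditions leave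
    them free, and the set would not be compact otherwise. The unit ball excludes no frame, since
    frame vectors have norm 1.\<close>
  define B where "B l a = (if l < N \<and> a < N then cball 0 1 \<inter> K else {0 :: complex})" for l a :: nat
  define S where "S = {p. \<forall>l a. p l a \<in> B l a} \<inter>
    {p. \<forall>l<N. \<forall>l'<N. (\<Sum>a<N. cnj (p l a) * p l' a) = (if l = l' then 1 else 0)}"
  have "compact {p. \<forall>l. p l \<in> {f. \<forall>a. f a \<in> B l a}}"
    by (intro compact_Pi_UNIV) (auto simp: B_def intro!: compact_Int_closed K)
  then have c1: "compact {p. \<forall>l a. p l a \<in> B l a}" by simp
  have "closed {p :: nat \<Rightarrow> nat \<Rightarrow> complex. \<forall>l<N. \<forall>l'<N. (\<Sum>a<N. cnj (p l a) * p l' a) = (if l = l' then 1 else 0)}"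
    by (intro closed_Collect_all closed_Collect_imp open_Collect_const closed_Collect_eq continuous_intros)
  with c1 have "compact S" unfolding S_def by (rule compact_Int_closed)
  moreover have "(\<lambda>l a. if l = a \<and> l < N then 1 else 0) \<in> S"
  proof -
    have "(\<Sum>a<N. cnj (if l = a \<and> l < N then 1 else 0) * (if l' = a \<and> l' < N then 1 else 0))
      = (if l = l' then 1 else (0::complex))" if "l < N" "l' < N" for l l'
    proof -
      have "(\<Sum>a<N. cnj (if l = a \<and> l < N then 1 else 0) * (if l' = a \<and> l' < N then 1 else 0))
        = (\<Sum>a<N. if a = l then (if l = l' then 1 else 0) else (0 :: complex))"
        by (intro sum.cong) (use that in auto)
      then show ?thesis using that by simp
    qed
    then show ?thesis unfolding S_def B_def using K by auto
  qed
  moreover have "continuous_on S (frame_weight N G)"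
    unfolding frame_weight_def herm_form_def
    by (rule continuous_on_subset[of UNIV]) (intro continuous_intros, simp)
  ultimately obtain p where p: "p \<in> S" and max: "\<And>q. q \<in> S \<Longrightarrow> frame_weight N G q \<le> frame_weight N G p"
    using continuous_attains_sup[of S "frame_weight N G"] by blast
  show ?thesis
  proof
    show "orthonormal_frame N K p"
      using p unfolding S_def B_def orthonormal_frame_def by (auto split: if_splits)
    fix q assume q: "orthonormal_frame N K q"
    \<comment> \<open>Truncation brings an arbitrary frame into the compact set without changing its
      weight.\<close>
    define q' where "q' l a = (if l < N \<and> a < N then q l a else 0)" for l a
    have "frame_weight N G q = frame_weight N G q'"
      unfolding frame_weight_def herm_form_def q'_def by (intro sum.cong arg_cong2[of _ _ _ _ "(*)"] arg_cong[of _ _ Re] refl) auto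
    moreover have "q' \<in> S"
      using q orthonormal_frame_norm_le[OF q] unfolding S_def B_def orthonormal_frame_def q'_def by auto
    ultimately show "frame_weight N G q \<le> frame_weight N G p" using max by simp
  qed
qed

lemma herm_form_add_left:
  "herm_form N G (\<lambda>a. x a + y a) z = herm_form N G x z + herm_form N G y z"
  by (simp add: herm_form_def algebra_simps sum.distrib)

lemma herm_form_add_right:
  "herm_form N G z (\<lambda>a. x a + y a) = herm_form N G z x + herm_form N G z y"
  by (simp add: herm_form_def algebra_simps sum.distrib)

lemma herm_form_scale_left:
  "herm_form N G (\<lambda>a. c * x a) z = cnj c * herm_form N G x z"
  by (simp add: herm_form_def sum_distrib_left mult.assoc)

lemma herm_form_scale_right:
  "herm_form N G z (\<lambda>a. c * x a) = c * herm_form N G z x"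
  by (simp add: herm_form_def sum_distrib_left mult_ac)

lemmas herm_form_simps = herm_form_add_left herm_form_add_right herm_form_scale_left herm_form_scale_right

lemma herm_form_cnj:
  assumes "\<And>a b. a < N \<Longrightarrow> b < N \<Longrightarrow> G b a = cnj (G a b)"
  shows "cnj (herm_form N G x y) = herm_form N G y x"
proof -
  have "cnj (G a b) = G b a" if "a < N" "b < N" for a b
    using assms[OF that] by simp
  then have "cnj (herm_form N G x y) = (\<Sum>a<N. \<Sum>b<N. cnj (y b) * G b a * x a)"
    unfolding herm_form_def by (auto intro!: sum.cong simp: mult_ac)
  also have "\<dots> = herm_form N G y x"
    unfolding herm_form_def by (rule sum.swap)
  finally show ?thesis .
qed

text \<open>With orthonormality phrased through the form of the identity matrix,
  \<open>herm_form_simps\<close> treats it in the same way as the form to be diagonalised.\<close>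

lemma orthonormal_frame_iff_herm_form:
  "orthonormal_frame N K p \<longleftrightarrow> (\<forall>l<N. \<forall>a<N. p l a \<in> K) \<and>
     (\<forall>l<N. \<forall>l'<N. herm_form N (\<lambda>a b. if a = b then 1 else 0) (p l) (p l') = (if l = l' then 1 else 0))"
proof -
  have "herm_form N (\<lambda>a b. if a = b then 1 else 0) x y = (\<Sum>a<N. cnj (x a) * y a)" for x y
    unfolding herm_form_def by (intro sum.cong refl) (simp add: if_distrib if_distribR cong: if_cong)
  then show ?thesis unfolding orthonormal_frame_def by simp
qed

lemma quadratic_nonpos_imp_linear_zero:
  fixes D \<beta> :: real
  assumes "\<And>t. t\<^sup>2 * D + 2 * t * \<beta> \<le> 0" and D: "D \<le> 0"
  shows "\<beta> = 0"
proof (rule ccontr)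
  assume "\<beta> \<noteq> 0"
  \<comment> \<open>The maximiser would be \<open>- \<beta> / D\<close>; replacing its denominator
    by \<open>1 - D\<close> covers \<open>D = 0\<close> and still yields a positive value.\<close>
  have "(\<beta> / (1 - D))\<^sup>2 * D + 2 * (\<beta> / (1 - D)) * \<beta> = \<beta>\<^sup>2 * (2 - D) / (1 - D)\<^sup>2"
    using D by (simp add: power_divide divide_simps) (simp add: algebra_simps power2_eq_square)
  also have "\<dots> > 0" using D \<open>\<beta> \<noteq> 0\<close> by (auto intro!: divide_pos_pos mult_pos_pos)
  finally show False using assms(1)[of "\<beta> / (1 - D)"] by linarith
qed

text \<open>A Jacobi rotation in the plane of two frame vectors cannot increase the weight.\<close>

lemma frame_weight_max_imp:
  assumes herm: "\<And>a b. a < N \<Longrightarrow> b < N \<Longrightarrow> G b a = cnj (G a b)"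
    and K: "\<And>x y c s. x \<in> K \<Longrightarrow> y \<in> K \<Longrightarrow> complex_of_real c * x + complex_of_real s * y \<in> K"
    and p: "orthonormal_frame N K p"
    and max: "\<And>q. orthonormal_frame N K q \<Longrightarrow> frame_weight N G q \<le> frame_weight N G p"
    and l: "l < l'" "l' < N"
  shows "Re (herm_form N G (p l') (p l')) \<le> Re (herm_form N G (p l) (p l))"
    and "Re (herm_form N G (p l) (p l')) = 0"
proof -
  let ?h = "herm_form N G"
  let ?e = "herm_form N (\<lambda>a b. if a = b then 1 else 0)"
  define A D \<beta> where "A = Re (?h (p l) (p l))" and "D = Re (?h (p l') (p l')) - A"
    and "\<beta> = Re (?h (p l) (p l'))"
  have sym: "Re (?h (p l') (p l)) = \<beta>"
    unfolding \<beta>_def by (subst herm_form_cnj[OF herm, symmetric]) simp_all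
  \<comment> \<open>A rotation with cosine \<open>c\<close> and sine \<open>s\<close> keeps the
    trace on the plane, so one vector gains what the other loses, and the weight changes by
    \<open>(l' - l) (s^2 D + 2 c s \<beta>)\<close>.\<close>
  have rot: "s\<^sup>2 * D + 2 * c * s * \<beta> \<le> 0" if cs: "c\<^sup>2 + s\<^sup>2 = 1" for c s
  proof -
    define u where "u = (\<lambda>a. of_real c * p l a + of_real s * p l' a)"
    define t where "t = - s"
    define v where "v = (\<lambda>a. of_real t * p l a + of_real c * p l' a)"
    define q where "q = p(l := u, l' := v)"
    have e: "?e (p k) (p k') = (if k = k' then 1 else 0)" if "k < N" "k' < N" for k k'
      using p that unfolding orthonormal_frame_iff_herm_form by blast
    have cs': "complex_of_real c * of_real c + of_real s * of_real s = 1"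
      using cs by (metis of_real_1 of_real_add of_real_mult power2_eq_square)
    then have ct: "complex_of_real c * of_real c + of_real t * of_real t = 1"
      "complex_of_real c * of_real t + of_real c * of_real s = 0"
      by (simp_all add: t_def)
    have "orthonormal_frame N K q"
      unfolding orthonormal_frame_iff_herm_form
    proof (intro conjI allI impI)
      fix k a assume "k < N" "a < N"
      then show "q k a \<in> K"
        using p l unfolding q_def u_def v_def orthonormal_frame_def
        by (auto intro!: K)
    next
      fix k k' assume k: "k < N" "k' < N"
      then show "?e (q k) (q k') = (if k = k' then 1 else 0)"
        using l cs' ct by (auto simp: q_def u_def v_def herm_form_simps e add.commute mult.commute)
    qed
    then have "frame_weight N G q \<le> frame_weight N G p" by (rule max)
    moreover have split: "(\<Sum>k<N. f k) = (\<Sum>k\<in>{..<N} - {l, l'}. f k) + (f l + f l')" for f :: "nat \<Rightarrow> real"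
      using l by (subst sum.subset_diff[of "{l, l'}"]) auto
    have "(\<Sum>k\<in>{..<N} - {l, l'}. - real k * Re (?h (q k) (q k))) = (\<Sum>k\<in>{..<N} - {l, l'}. - real k * Re (?h (p k) (p k)))"
      by (intro sum.cong) (auto simp: q_def)
    ultimately have "- real l * Re (?h u u) - real l' * Re (?h v v) \<le> - real l * A - real l' * (A + D)"
      unfolding frame_weight_def split using l by (simp add: q_def A_def D_def)
    moreover have "Re (?h u u) = c\<^sup>2 * A + 2 * c * s * \<beta> + s\<^sup>2 * (A + D)"
      using sym by (simp add: u_def herm_form_simps A_def D_def \<beta>_def power2_eq_square algebra_simps)
    moreover have "Re (?h v v) = t\<^sup>2 * A + 2 * c * t * \<beta> + c\<^sup>2 * (A + D)"
      using sym by (simp add: v_def herm_form_simps A_def D_def \<beta>_def power2_eq_square algebra_simps)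
    moreover have "c\<^sup>2 = 1 - s\<^sup>2" using cs by simp
    ultimately have "(real l' - real l) * (s\<^sup>2 * D + 2 * c * s * \<beta>) \<le> 0"
      by (simp add: t_def algebra_simps)
    then show ?thesis using l by (simp add: mult_le_0_iff)
  qed
  \<comment> \<open>A quarter turn exchanges the two vectors up to sign.\<close>
  have D: "D \<le> 0" using rot[of 0 1] by simp
  then show "Re (?h (p l') (p l')) \<le> Re (?h (p l) (p l))" by (simp add: D_def A_def)
  \<comment> \<open>Here \<open>t\<close> is the tangent of the angle, so \<open>c = 1 / r\<close>
    and \<open>s = t / r\<close>.\<close>
  have "t\<^sup>2 * D + 2 * t * \<beta> \<le> 0" for t
  proof -
    define r where "r = sqrt (1 + t\<^sup>2)"
    have r: "r > 0" "r\<^sup>2 = 1 + t\<^sup>2" by (simp_all add: r_def add_pos_nonneg)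
    have pos: "1 + t\<^sup>2 > 0" using zero_le_power2[of t] by linarith
    then have "(1 / r)\<^sup>2 + (t / r)\<^sup>2 = 1" using r by (simp add: power_divide flip: add_divide_distrib)
    from rot[OF this] have "(t\<^sup>2 * D + 2 * t * \<beta>) / r\<^sup>2 \<le> 0"
      by (simp add: power2_eq_square add_divide_distrib)
    then show ?thesis using r pos by (auto simp: divide_le_0_iff)
  qed
  then show "Re (?h (p l) (p l')) = 0"
    using quadratic_nonpos_imp_linear_zero[OF _ D] by (simp add: \<beta>_def)
qed

lemma closed_Reals_complex: "closed (\<real> :: complex set)"
proof -
  have "closed {z. Im z = 0}" by (intro closed_Collect_eq continuous_intros)
  then show ?thesis by (simp add: complex_is_Real_iff Collect_mem_eq flip: complex_is_Real_iff)
qed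

text \<open>The families are rotated by real orthogonal matrices, hence frames over
  \<open>\<real>\<close>; the form is read as a complex one to reuse the maximisation, and its
  maximality also supplies the decreasing order.\<close>

lemma real_form_diagonalisation:
  fixes g :: "nat \<Rightarrow> nat \<Rightarrow> real"
  assumes sym: "\<And>a b. a < N \<Longrightarrow> b < N \<Longrightarrow> g b a = g a b"
  obtains r :: "nat \<Rightarrow> nat \<Rightarrow> real"
  where "\<And>l l'. l < N \<Longrightarrow> l' < N \<Longrightarrow> (\<Sum>a<N. r l a * r l' a) = (if l = l' then 1 else 0)"
    and "\<And>l l'. l < N \<Longrightarrow> l' < N \<Longrightarrow> l \<noteq> l' \<Longrightarrow> (\<Sum>a<N. \<Sum>b<N. r l a * g a b * r l' b) = 0"
    and "\<And>l l'. l \<le> l' \<Longrightarrow> l' < N \<Longrightarrow>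
      (\<Sum>a<N. \<Sum>b<N. r l' a * g a b * r l' b) \<le> (\<Sum>a<N. \<Sum>b<N. r l a * g a b * r l b)"
proof -
  let ?G = "\<lambda>a b. complex_of_real (g a b)"
  obtain p where p: "orthonormal_frame N \<real> p"
    and max: "\<And>q. orthonormal_frame N \<real> q \<Longrightarrow> frame_weight N ?G q \<le> frame_weight N ?G p"
    using frame_weight_max_exists[of \<real> N ?G] closed_Reals_complex by auto
  define r where "r l a = Re (p l a)" for l a
  have pr: "p l a = of_real (r l a)" if "l < N" "a < N" for l a
    using p that unfolding orthonormal_frame_def r_def by (metis of_real_Re)
  have h: "herm_form N ?G (p l) (p l') = of_real (\<Sum>a<N. \<Sum>b<N. r l a * g a b * r l' b)"
    if "l < N" "l' < N" for l l'
    unfolding herm_form_def using that by (auto intro!: sum.cong simp: pr)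
  have main: "Re (herm_form N ?G (p l') (p l')) \<le> Re (herm_form N ?G (p l) (p l))"
    "Re (herm_form N ?G (p l) (p l')) = 0" if "l < l'" "l' < N" for l l'
    using frame_weight_max_imp[where G = ?G and K = \<real> and p = p and N = N and l = l and l' = l']
      sym p max that by auto
  show ?thesis
  proof (rule that[of r])
    fix l l' assume l: "l < N" "l' < N"
    have "complex_of_real (\<Sum>a<N. r l a * r l' a) = (\<Sum>a<N. cnj (p l a) * p l' a)"
      using l by (simp add: pr)
    also have "\<dots> = (if l = l' then 1 else 0)" using p l unfolding orthonormal_frame_def by blast
    finally show "(\<Sum>a<N. r l a * r l' a) = (if l = l' then 1 else 0)"
      by (metis of_real_0 of_real_1 of_real_eq_iff)
    assume ne: "l \<noteq> l'"
    have z: "(\<Sum>a<N. \<Sum>b<N. r l a * g a b * r l' b) = 0" if "l < l'" "l' < N" for l l'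
      using main(2)[OF that] that by (simp add: h)
    have "(\<Sum>a<N. \<Sum>b<N. r l a * g a b * r l' b) = (\<Sum>a<N. \<Sum>b<N. r l' a * g a b * r l b)"
      by (subst sum.swap) (auto intro!: sum.cong simp: sym mult_ac)
    then show "(\<Sum>a<N. \<Sum>b<N. r l a * g a b * r l' b) = 0"
      using z[of l l'] z[of l' l] l ne by linarith
  next
    fix l l' assume "l \<le> l'" "l' < N"
    then show "(\<Sum>a<N. \<Sum>b<N. r l' a * g a b * r l' b) \<le> (\<Sum>a<N. \<Sum>b<N. r l a * g a b * r l b)"
      using main(1)[of l l'] by (cases "l = l'") (auto simp: h)
  qed
qed

lemma hermitian_form_diagonalisation:
  assumes herm: "\<And>a b. a < N \<Longrightarrow> b < N \<Longrightarrow> G b a = cnj (G a b)"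
  obtains p where "orthonormal_frame N UNIV p"
    and "\<And>l l'. l < N \<Longrightarrow> l' < N \<Longrightarrow> l \<noteq> l' \<Longrightarrow> herm_form N G (p l) (p l') = 0"
proof -
  obtain p where p: "orthonormal_frame N UNIV p"
    and max: "\<And>q. orthonormal_frame N UNIV q \<Longrightarrow> frame_weight N G q \<le> frame_weight N G p"
    using frame_weight_max_exists[of UNIV N G] by auto
  have z: "herm_form N G (p l) (p l') = 0" if l: "l < l'" "l' < N" for l l'
  proof -
    \<comment> \<open>Real rotations control only the real part of an off-diagonal value.
      Multiplying one vector by \<open>\<i>\<close> keeps the weight, so the new frame is maximal
      too, and its real part is minus the old imaginary part.\<close>
    define q where "q = p(l' := (\<lambda>a. \<i> * p l' a))"
    have q: "orthonormal_frame N UNIV q"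
      using p unfolding q_def orthonormal_frame_iff_herm_form by (auto simp: herm_form_simps)
    have "frame_weight N G q = frame_weight N G p"
      unfolding frame_weight_def q_def by (intro sum.cong refl) (simp add: herm_form_simps)
    with max have maxq: "\<And>q'. orthonormal_frame N UNIV q' \<Longrightarrow> frame_weight N G q' \<le> frame_weight N G q"
      by simp
    have "Re (herm_form N G (q l) (q l')) = 0"
      by (rule frame_weight_max_imp(2)[OF herm _ q maxq l]) auto
    moreover have "Re (herm_form N G (p l) (p l')) = 0"
      by (rule frame_weight_max_imp(2)[OF herm _ p max l]) auto
    ultimately show ?thesis using l by (simp add: q_def herm_form_simps complex_eq_iff)
  qed
  show ?thesis
  proof (rule that[OF p])
    fix l l' :: nat assume "l < N" "l' < N" "l \<noteq> l'"
    moreover have "cnj (herm_form N G (p l') (p l)) = herm_form N G (p l) (p l')"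
      by (rule herm_form_cnj[OF herm])
    ultimately show "herm_form N G (p l) (p l') = 0"
      using z[of l l'] z[of l' l] by (metis complex_cnj_zero nat_neq_iff)
  qed
qed

section \<open>Frobenius inner product of complex matrices\<close>

lemma dim_mat_adjoint [simp]:
  "dim_row (mat_adjoint A) = dim_col A" "dim_col (mat_adjoint A) = dim_row A"
  by (simp_all add: mat_adjoint_def)

lemma mat_adjoint_carrier [simp]: "A \<in> carrier_mat nr nc \<Longrightarrow> mat_adjoint A \<in> carrier_mat nc nr"
  by auto

lemma mat_adjoint_index [simp]:
  fixes A :: "complex mat"
  shows "i < dim_col A \<Longrightarrow> j < dim_row A \<Longrightarrow> mat_adjoint A $$ (i, j) = cnj (A $$ (j, i))"
  by (simp add: mat_adjoint_def mat_of_rows_index conjugate_complex_def)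

lemma mat_adjoint_adjoint [simp]: "mat_adjoint (mat_adjoint A) = (A :: complex mat)"
  by (rule eq_matI) auto

lemma mat_adjoint_mult:
  fixes A B :: "complex mat"
  assumes A: "A \<in> carrier_mat n n" and B: "B \<in> carrier_mat n n"
  shows "mat_adjoint (A * B) = mat_adjoint B * mat_adjoint A"
proof (rule eq_matI)
  show "dim_row (mat_adjoint (A * B)) = dim_row (mat_adjoint B * mat_adjoint A)"
    "dim_col (mat_adjoint (A * B)) = dim_col (mat_adjoint B * mat_adjoint A)" by auto
  fix i j assume "i < dim_row (mat_adjoint B * mat_adjoint A)" "j < dim_col (mat_adjoint B * mat_adjoint A)"
  then have ij: "i < n" "j < n" using A B by auto
  have "mat_adjoint (A * B) $$ (i, j) = cnj ((A * B) $$ (j, i))"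
    using A B ij by (intro mat_adjoint_index) auto
  also have "\<dots> = (\<Sum>k<n. cnj (A $$ (j, k) * B $$ (k, i)))"
    by (simp add: index_mult_mat_sum[OF A B ij(2,1)])
  also have "\<dots> = (mat_adjoint B * mat_adjoint A) $$ (i, j)"
    using A B ij by (subst index_mult_mat_sum[OF mat_adjoint_carrier[OF B] mat_adjoint_carrier[OF A]])
      (auto intro!: sum.cong simp: mult.commute)
  finally show "mat_adjoint (A * B) $$ (i, j) = (mat_adjoint B * mat_adjoint A) $$ (i, j)" .
qed

text \<open>For matrices of equal size, the trace of \<open>X * mat_adjoint Y\<close>; linear in the
  first argument and conjugate linear in the second.\<close>

definition frob_inner :: "complex mat \<Rightarrow> complex mat \<Rightarrow> complex" where
  "frob_inner X Y = (\<Sum>i<dim_row X. \<Sum>j<dim_col X. X $$ (i, j) * cnj (Y $$ (i, j)))"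

lemma frob_inner_sum:
  "X \<in> carrier_mat n n \<Longrightarrow> frob_inner X Y = (\<Sum>i<n. \<Sum>j<n. X $$ (i, j) * cnj (Y $$ (i, j)))"
  by (simp add: frob_inner_def)

lemma frob_norm_sq_sum:
  "X \<in> carrier_mat n n \<Longrightarrow> (frob_norm X)\<^sup>2 = (\<Sum>i<n. \<Sum>j<n. (norm (X $$ (i, j)))\<^sup>2)"
  by (simp add: frob_norm_sq)

lemma frob_inner_self: "frob_inner X X = complex_of_real ((frob_norm X)\<^sup>2)"
  by (simp add: frob_inner_def frob_norm_sq complex_norm_square del: of_real_power)

lemma frob_norm_sq_inner: "(frob_norm X)\<^sup>2 = Re (frob_inner X X)"
  by (simp add: frob_inner_self del: of_real_power)

lemma frob_inner_cnj:
  assumes "X \<in> carrier_mat n n" "Y \<in> carrier_mat n n"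
  shows "cnj (frob_inner X Y) = frob_inner Y X"
  using assms by (simp add: frob_inner_sum mult.commute)

lemma frob_inner_minus_left:
  assumes "X \<in> carrier_mat n n" "Y \<in> carrier_mat n n"
  shows "frob_inner (X - Y) Z = frob_inner X Z - frob_inner Y Z"
  using assms by (simp add: frob_inner_def left_diff_distrib sum_subtractf)

lemma frob_inner_minus_right:
  assumes "X \<in> carrier_mat n n" "Y \<in> carrier_mat n n" "Z \<in> carrier_mat n n"
  shows "frob_inner Z (X - Y) = frob_inner Z X - frob_inner Z Y"
  using assms by (simp add: frob_inner_def right_diff_distrib sum_subtractf)

lemma frob_inner_mult_left:
  assumes X: "X \<in> carrier_mat n n" and Y: "Y \<in> carrier_mat n n" and Z: "Z \<in> carrier_mat n n"
  shows "frob_inner (X * Y) Z = frob_inner Y (mat_adjoint X * Z)"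
proof -
  have a: "mat_adjoint X \<in> carrier_mat n n" using X by simp
  have "frob_inner (X * Y) Z = (\<Sum>i<n. \<Sum>j<n. \<Sum>k<n. X $$ (i, k) * Y $$ (k, j) * cnj (Z $$ (i, j)))"
    using X Y by (simp add: frob_inner_sum[of _ n] index_mult_mat_sum[OF X Y] sum_distrib_right del: index_mult_mat(1))
  also have "\<dots> = (\<Sum>i<n. \<Sum>k<n. \<Sum>j<n. X $$ (i, k) * Y $$ (k, j) * cnj (Z $$ (i, j)))"
    by (intro sum.cong refl sum.swap)
  also have "\<dots> = (\<Sum>k<n. \<Sum>i<n. \<Sum>j<n. X $$ (i, k) * Y $$ (k, j) * cnj (Z $$ (i, j)))"
    by (rule sum.swap)
  also have "\<dots> = (\<Sum>k<n. \<Sum>j<n. \<Sum>i<n. X $$ (i, k) * Y $$ (k, j) * cnj (Z $$ (i, j)))"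
    by (intro sum.cong refl sum.swap)
  also have "\<dots> = frob_inner Y (mat_adjoint X * Z)"
    using X Y by (simp add: frob_inner_sum[of _ n] index_mult_mat_sum[OF a Z] sum_distrib_left mult_ac
        del: index_mult_mat(1))
  finally show ?thesis .
qed

lemma frob_inner_adjoint:
  assumes "X \<in> carrier_mat n n" "Y \<in> carrier_mat n n"
  shows "frob_inner (mat_adjoint X) (mat_adjoint Y) = frob_inner Y X"
proof -
  have "frob_inner (mat_adjoint X) (mat_adjoint Y) = (\<Sum>i<n. \<Sum>j<n. Y $$ (j, i) * cnj (X $$ (j, i)))"
    using assms by (simp add: frob_inner_sum[of _ n] mult.commute)
  also have "\<dots> = frob_inner Y X"
    using assms by (simp add: frob_inner_sum[of _ n]) (rule sum.swap)
  finally show ?thesis .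
qed

lemma frob_norm_adjoint:
  assumes "X \<in> carrier_mat n n"
  shows "frob_norm (mat_adjoint X :: complex mat) = frob_norm X"
proof -
  have "(frob_norm (mat_adjoint X))\<^sup>2 = (frob_norm X)\<^sup>2"
    unfolding frob_norm_sq_inner frob_inner_adjoint[OF assms assms] ..
  then show ?thesis by (simp add: power2_eq_iff_nonneg frob_norm_nonneg)
qed

lemma frob_inner_mult_right:
  assumes X: "X \<in> carrier_mat n n" and Y: "Y \<in> carrier_mat n n" and Z: "Z \<in> carrier_mat n n"
  shows "frob_inner (X * Y) Z = frob_inner X (Z * mat_adjoint Y)"
proof -
  have "frob_inner (X * Y) Z = frob_inner (mat_adjoint Z) (mat_adjoint Y * mat_adjoint X)"
    using frob_inner_adjoint[OF Z, of "X * Y"] X Y by (simp add: mat_adjoint_mult[OF X Y])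
  also have "\<dots> = cnj (frob_inner (mat_adjoint Y * mat_adjoint X) (mat_adjoint Z))"
    using X Y Z by (subst frob_inner_cnj[of _ n]) auto
  also have "\<dots> = cnj (frob_inner (mat_adjoint X) (Y * mat_adjoint Z))"
    using X Y Z by (subst frob_inner_mult_left[of _ n]) auto
  also have "\<dots> = frob_inner (Y * mat_adjoint Z) (mat_adjoint X)"
    using X Y Z by (subst frob_inner_cnj[of _ n]) auto
  also have "\<dots> = frob_inner X (mat_adjoint (Y * mat_adjoint Z))"
    using frob_inner_adjoint[of "mat_adjoint (Y * mat_adjoint Z)" n X] X Y Z by simp
  also have "mat_adjoint (Y * mat_adjoint Z) = Z * mat_adjoint Y"
    using Y Z by (simp add: mat_adjoint_mult[of _ n])
  finally show ?thesis .
qed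

lemma mat_sum_carrier [simp]: "mat_sum n F I \<in> carrier_mat n n"
  by (simp add: mat_sum_def)

lemma mat_sum_index [simp]: "i < n \<Longrightarrow> j < n \<Longrightarrow> mat_sum n F I $$ (i, j) = (\<Sum>k\<in>I. F k $$ (i, j))"
  by (simp add: mat_sum_def)

lemma dim_mat_sum [simp]: "dim_row (mat_sum n F I) = n" "dim_col (mat_sum n F I) = n"
  by (simp_all add: mat_sum_def)

lemma mat_sum_cong:
  "(\<And>k. k \<in> I \<Longrightarrow> F k = G k) \<Longrightarrow> mat_sum n F I = mat_sum n G I"
  unfolding mat_sum_def by simp

lemma frob_inner_mat_sum_left:
  assumes "\<And>k. k \<in> I \<Longrightarrow> F k \<in> carrier_mat n n"
  shows "frob_inner (mat_sum n F I) Z = (\<Sum>k\<in>I. frob_inner (F k) Z)"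
proof -
  have "frob_inner (mat_sum n F I) Z = (\<Sum>i<n. \<Sum>j<n. \<Sum>k\<in>I. F k $$ (i, j) * cnj (Z $$ (i, j)))"
    by (simp add: frob_inner_sum[of _ n] sum_distrib_right)
  also have "\<dots> = (\<Sum>i<n. \<Sum>k\<in>I. \<Sum>j<n. F k $$ (i, j) * cnj (Z $$ (i, j)))"
    by (intro sum.cong refl sum.swap)
  also have "\<dots> = (\<Sum>k\<in>I. \<Sum>i<n. \<Sum>j<n. F k $$ (i, j) * cnj (Z $$ (i, j)))"
    by (rule sum.swap)
  also have "\<dots> = (\<Sum>k\<in>I. frob_inner (F k) Z)"
    using assms by (simp add: frob_inner_sum[of _ n])
  finally show ?thesis .
qed

lemma frob_inner_mat_sum_right:
  assumes F: "\<And>k. k \<in> I \<Longrightarrow> F k \<in> carrier_mat n n" and Z: "Z \<in> carrier_mat n n"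
  shows "frob_inner Z (mat_sum n F I) = (\<Sum>k\<in>I. frob_inner Z (F k))"
proof -
  have "frob_inner Z (mat_sum n F I) = cnj (\<Sum>k\<in>I. frob_inner (F k) Z)"
    using Z frob_inner_cnj[of "mat_sum n F I" n Z] by (simp add: frob_inner_mat_sum_left[OF F] del: cnj_sum)
  also have "\<dots> = (\<Sum>k\<in>I. frob_inner Z (F k))"
    using F Z by (auto intro!: sum.cong simp: frob_inner_cnj[of _ n])
  finally show ?thesis .
qed

lemma frob_inner_smult_left:
  "frob_inner (c \<cdot>\<^sub>m X) Z = c * frob_inner X Z"
  by (simp add: frob_inner_def sum_distrib_left mult.assoc)

lemma frob_inner_smult_right:
  assumes "X \<in> carrier_mat n n" "Z \<in> carrier_mat n n"
  shows "frob_inner Z (c \<cdot>\<^sub>m X) = cnj c * frob_inner Z X"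
  using assms by (simp add: frob_inner_def sum_distrib_left mult_ac)

lemma frob_norm_smult: "(frob_norm (c \<cdot>\<^sub>m (X :: complex mat)))\<^sup>2 = (norm c)\<^sup>2 * (frob_norm X)\<^sup>2"
  by (simp add: frob_norm_sq norm_mult power_mult_distrib sum_distrib_left)

section \<open>Commutators and Hermitian parts\<close>

text \<open>Expand both squared norms into four products. The mixed terms are the same on both
  sides, while the square terms pair \<open>X * mat_adjoint X\<close> and
  \<open>mat_adjoint X * X\<close> with the two products of \<open>Y\<close> and its adjoint, in
  exchanged order. The difference is the inner product of the two self-commutators.\<close>

lemma commutator_adjoint_identity:
  fixes X Y :: "complex mat"
  assumes X: "X \<in> carrier_mat n n" and Y: "Y \<in> carrier_mat n n"
  shows "(frob_norm (commutator X (mat_adjoint Y)))\<^sup>2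
    = (frob_norm (commutator X Y))\<^sup>2
      + Re (frob_inner (commutator X (mat_adjoint X)) (commutator Y (mat_adjoint Y)))"
proof -
  let ?X = "mat_adjoint X" and ?Y = "mat_adjoint Y" and ?f = frob_inner
  have X': "?X \<in> carrier_mat n n" and Y': "?Y \<in> carrier_mat n n" using X Y by auto
  have m [simp]: "A * B \<in> carrier_mat n n" if "A \<in> carrier_mat n n" "B \<in> carrier_mat n n"
    for A B :: "complex mat" using that by auto
  have comm: "?f (commutator A B) (commutator C D) = ?f (A * B) (C * D) - ?f (A * B) (D * C)
      - ?f (B * A) (C * D) + ?f (B * A) (D * C)"
    if "A \<in> carrier_mat n n" "B \<in> carrier_mat n n" "C \<in> carrier_mat n n" "D \<in> carrier_mat n n" for A B C D
  proof -
    have "A * B \<in> carrier_mat n n" "B * A \<in> carrier_mat n n" "C * D \<in> carrier_mat n n" "D * C \<in> carrier_mat n n"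
      "A * B - B * A \<in> carrier_mat n n" using that by auto
    moreover have "a - c - (b - d) = a - b - c + d" for a b c d :: complex by simp
    ultimately show ?thesis unfolding commutator_def
      by (simp only: frob_inner_minus_left[of _ n] frob_inner_minus_right[of _ n])
  qed
  have a1: "?f (X * Z) (X * Z) = ?f (?X * X) (Z * mat_adjoint Z)"
    and a2: "?f (Z * X) (Z * X) = ?f (X * ?X) (mat_adjoint Z * Z)" if Z: "Z \<in> carrier_mat n n" for Z
  proof -
    have Z': "mat_adjoint Z \<in> carrier_mat n n" using Z by simp
    have "?f (X * Z) (X * Z) = ?f X (X * (Z * mat_adjoint Z))"
      by (simp only: frob_inner_mult_right[OF X Z m[OF X Z]] assoc_mult_mat[OF X Z Z'])
    also have "\<dots> = ?f (?X * X) (Z * mat_adjoint Z)"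
      by (simp only: frob_inner_mult_left[OF X' X m[OF Z Z']] mat_adjoint_adjoint)
    finally show "?f (X * Z) (X * Z) = ?f (?X * X) (Z * mat_adjoint Z)" .
    have "?f (Z * X) (Z * X) = ?f X ((mat_adjoint Z * Z) * X)"
      by (simp only: frob_inner_mult_left[OF Z X m[OF Z X]] assoc_mult_mat[OF Z' Z X])
    also have "\<dots> = ?f (X * ?X) (mat_adjoint Z * Z)"
      by (simp only: frob_inner_mult_right[OF X X' m[OF Z' Z]] mat_adjoint_adjoint)
    finally show "?f (Z * X) (Z * X) = ?f (X * ?X) (mat_adjoint Z * Z)" .
  qed
  have c: "?f (X * ?Y) (?Y * X) = ?f (Y * X) (X * Y)"
  proof -
    have "?f (X * ?Y) (?Y * X) = ?f X (?Y * (X * Y))"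
      by (simp only: frob_inner_mult_right[OF X Y' m[OF Y' X]] assoc_mult_mat[OF Y' X Y] mat_adjoint_adjoint)
    also have "\<dots> = ?f (Y * X) (X * Y)"
      by (simp only: frob_inner_mult_left[OF Y X m[OF X Y]])
    finally show ?thesis .
  qed
  then have c': "?f (?Y * X) (X * ?Y) = ?f (X * Y) (Y * X)"
    using frob_inner_cnj[OF m[OF X Y'] m[OF Y' X]] frob_inner_cnj[OF m[OF Y X] m[OF X Y]] by simp
  show ?thesis
    unfolding frob_norm_sq_inner comm[OF X Y' X Y'] comm[OF X Y X Y] comm[OF X X' Y Y']
      a1[OF Y] a2[OF Y] a1[OF Y'] a2[OF Y'] c c'
    by (simp add: algebra_simps)
qed

section \<open>Cartesian decomposition of a complex matrix\<close>

lemma commutator_lincomb_right: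
  fixes X C D :: "complex mat"
  assumes "X \<in> carrier_mat n n" "C \<in> carrier_mat n n" "D \<in> carrier_mat n n"
  shows "commutator X (C - \<i> \<cdot>\<^sub>m D) = commutator X C - \<i> \<cdot>\<^sub>m commutator X D"
    and "commutator X (C + \<i> \<cdot>\<^sub>m D) = commutator X C + \<i> \<cdot>\<^sub>m commutator X D"
proof -
  have iD: "\<i> \<cdot>\<^sub>m D \<in> carrier_mat n n" using assms by simp
  have e: "X * (\<i> \<cdot>\<^sub>m D) = \<i> \<cdot>\<^sub>m (X * D)" "(\<i> \<cdot>\<^sub>m D) * X = \<i> \<cdot>\<^sub>m (D * X)"
    using assms by (auto intro: mult_smult_distrib mult_smult_assoc_mat)
  show "commutator X (C - \<i> \<cdot>\<^sub>m D) = commutator X C - \<i> \<cdot>\<^sub>m commutator X D"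
    unfolding commutator_def mult_minus_distrib_mat[OF assms(1,2) iD] minus_mult_distrib_mat[OF assms(2) iD assms(1)] e
    by (rule eq_matI) (use assms in \<open>auto simp: algebra_simps simp del: index_mult_mat(1)\<close>)
  show "commutator X (C + \<i> \<cdot>\<^sub>m D) = commutator X C + \<i> \<cdot>\<^sub>m commutator X D"
    unfolding commutator_def mult_add_distrib_mat[OF assms(1,2) iD] add_mult_distrib_mat[OF assms(2) iD assms(1)] e
    by (rule eq_matI) (use assms in \<open>auto simp: algebra_simps simp del: index_mult_mat(1)\<close>)
qed

lemma frob_parallelogram_i:
  assumes "C \<in> carrier_mat n n" "D \<in> carrier_mat n n"
  shows "(frob_norm (C - \<i> \<cdot>\<^sub>m D))\<^sup>2 + (frob_norm (C + \<i> \<cdot>\<^sub>m D))\<^sup>2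
    = 2 * (frob_norm C)\<^sup>2 + 2 * (frob_norm D)\<^sup>2"
  using frob_parallelogram[of C n n "\<i> \<cdot>\<^sub>m D"] assms by (simp add: frob_norm_smult)

lemma commutator_parallelogram:
  fixes X C D :: "complex mat"
  assumes "X \<in> carrier_mat n n" "C \<in> carrier_mat n n" "D \<in> carrier_mat n n"
  shows "(frob_norm (commutator X (C - \<i> \<cdot>\<^sub>m D)))\<^sup>2 + (frob_norm (commutator X (C + \<i> \<cdot>\<^sub>m D)))\<^sup>2
    = 2 * (frob_norm (commutator X C))\<^sup>2 + 2 * (frob_norm (commutator X D))\<^sup>2"
  unfolding commutator_lincomb_right[OF assms] using assms by (intro frob_parallelogram_i[of _ n]) auto

text \<open>The factor \<open>\<i>\<close> makes the skew-Hermitian part Hermitian, so that both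
  parts of a matrix can enter one Hermitian family.\<close>

definition i_skew_part :: "complex mat \<Rightarrow> complex mat" where
  "i_skew_part A = \<i> \<cdot>\<^sub>m skew_part A"

context
  fixes A :: "complex mat" and n :: nat
  assumes A: "A \<in> carrier_mat n n"
begin

lemma herm_part_carrier: "herm_part A \<in> carrier_mat n n" and i_skew_part_carrier: "i_skew_part A \<in> carrier_mat n n"
  using A by (auto simp: herm_part_def i_skew_part_def skew_part_def)

lemma herm_part_hermitian: "mat_adjoint (herm_part A) = herm_part A"
  by (rule eq_matI) (use A in \<open>auto simp: herm_part_def add.commute\<close>)

lemma i_skew_part_hermitian: "mat_adjoint (i_skew_part A) = i_skew_part A"
  by (rule eq_matI) (use A in \<open>auto simp: i_skew_part_def skew_part_def algebra_simps\<close>)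

lemma cartesian_decomposition:
  "A = herm_part A - \<i> \<cdot>\<^sub>m i_skew_part A" "mat_adjoint A = herm_part A + \<i> \<cdot>\<^sub>m i_skew_part A"
  using A by (auto intro!: eq_matI simp: herm_part_def i_skew_part_def skew_part_def field_simps)

lemma frob_norm_cartesian:
  "(frob_norm A)\<^sup>2 = (frob_norm (herm_part A))\<^sup>2 + (frob_norm (i_skew_part A))\<^sup>2"
  using frob_parallelogram_i[OF herm_part_carrier i_skew_part_carrier]
  by (simp add: cartesian_decomposition[symmetric] frob_norm_adjoint[OF A])

lemma frob_norm_commutator_cartesian:
  assumes X: "X \<in> carrier_mat n n"
  shows "(frob_norm (commutator X A))\<^sup>2 + (frob_norm (commutator X (mat_adjoint A)))\<^sup>2
    = 2 * (frob_norm (commutator X (herm_part A)))\<^sup>2 + 2 * (frob_norm (commutator X (i_skew_part A)))\<^sup>2"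
  using commutator_parallelogram[OF X herm_part_carrier i_skew_part_carrier]
  by (simp add: cartesian_decomposition[symmetric])

text \<open>For Hermitian \<open>X\<close> the commutators with \<open>A\<close> and with its
  adjoint are adjoint to each other up to sign and have equal norms, so the parallelogram identity
  can be halved.\<close>

lemma frob_norm_commutator_hermitian:
  assumes X: "X \<in> carrier_mat n n" and h: "mat_adjoint X = X"
  shows "(frob_norm (commutator X A))\<^sup>2
    = (frob_norm (commutator X (herm_part A)))\<^sup>2 + (frob_norm (commutator X (i_skew_part A)))\<^sup>2"
proof -
  have X': "A * X \<in> carrier_mat n n" "X * A \<in> carrier_mat n n" using A X by auto
  have "mat_adjoint (commutator A X) = mat_adjoint (A * X) - mat_adjoint (X * A)"
    unfolding commutator_def by (rule eq_matI) (use A X in \<open>auto simp del: index_mult_mat(1)\<close>)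
  also have "\<dots> = commutator X (mat_adjoint A)"
    unfolding commutator_def mat_adjoint_mult[OF A X] mat_adjoint_mult[OF X A] h ..
  finally have "frob_norm (commutator X (mat_adjoint A)) = frob_norm (commutator A X)"
    using frob_norm_adjoint[OF commutator_carrier[OF A X]] by simp
  also have "\<dots> = frob_norm (commutator X A)" by (rule frob_norm_commutator_swap[OF A X])
  finally show ?thesis using frob_norm_commutator_cartesian[OF X] by simp
qed

end

lemma sum_commutators_cartesian:
  fixes A :: "nat \<Rightarrow> complex mat"
  assumes A: "\<And>r. r \<in> I \<Longrightarrow> A r \<in> carrier_mat n n"
  defines "C \<equiv> \<lambda>r. herm_part (A r)" and "D \<equiv> \<lambda>r. i_skew_part (A r)"
  shows "(\<Sum>r\<in>I. \<Sum>s\<in>I. (frob_norm (commutator (A r) (A s)))\<^sup>2)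
    + (1/2) * (frob_norm (mat_sum n (\<lambda>r. commutator (A r) (mat_adjoint (A r))) I))\<^sup>2
    = (\<Sum>r\<in>I. \<Sum>s\<in>I. (frob_norm (commutator (C r) (C s)))\<^sup>2 + (frob_norm (commutator (C r) (D s)))\<^sup>2
       + (frob_norm (commutator (D r) (C s)))\<^sup>2 + (frob_norm (commutator (D r) (D s)))\<^sup>2)"
proof -
  define Z where "Z r = commutator (A r) (mat_adjoint (A r))" for r
  have Z: "Z r \<in> carrier_mat n n" if "r \<in> I" for r
    unfolding Z_def using A[OF that] by simp
  have point: "(frob_norm (commutator (A r) (A s)))\<^sup>2 + (1/2) * Re (frob_inner (Z r) (Z s))
     = (frob_norm (commutator (C r) (C s)))\<^sup>2 + (frob_norm (commutator (C r) (D s)))\<^sup>2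
       + (frob_norm (commutator (D r) (C s)))\<^sup>2 + (frob_norm (commutator (D r) (D s)))\<^sup>2"
    if r: "r \<in> I" and s: "s \<in> I" for r s
  proof -
    note c = herm_part_carrier[OF A] i_skew_part_carrier[OF A]
    have h: "(frob_norm (commutator (A r) H))\<^sup>2
      = (frob_norm (commutator (C r) H))\<^sup>2 + (frob_norm (commutator (D r) H))\<^sup>2"
      if H: "H \<in> carrier_mat n n" "mat_adjoint H = H" for H
      unfolding C_def D_def frob_norm_commutator_swap[OF _ H(1), OF A[OF r]]
        frob_norm_commutator_swap[OF _ H(1), OF c(1)[OF r]] frob_norm_commutator_swap[OF _ H(1), OF c(2)[OF r]]
      by (rule frob_norm_commutator_hermitian[OF A[OF r] H])
    \<comment> \<open>The commutators of \<open>A r\<close> with \<open>A s\<close> and with its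
      adjoint differ in squared norm by the inner product, and together make twice the sum over the
      two Hermitian parts of \<open>A s\<close>. Averaging produces the factor 1/2 of the
      correction.\<close>
    show ?thesis
      using commutator_adjoint_identity[OF A[OF r] A[OF s]] frob_norm_commutator_cartesian[OF A[OF s] A[OF r]]
        h[OF c(1)[OF s] herm_part_hermitian[OF A[OF s]]] h[OF c(2)[OF s] i_skew_part_hermitian[OF A[OF s]]]
      unfolding Z_def[symmetric] C_def D_def by linarith
  qed
  \<comment> \<open>A single inner product of \<open>Z r\<close> and \<open>Z s\<close> has no
    definite sign; summed over all pairs they form a squared norm, which the bound may drop and
    equality forces to vanish.\<close>
  have "(frob_norm (mat_sum n Z I))\<^sup>2 = (\<Sum>r\<in>I. \<Sum>s\<in>I. Re (frob_inner (Z r) (Z s)))"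
    unfolding frob_norm_sq_inner using Z
    by (simp add: frob_inner_mat_sum_left frob_inner_mat_sum_right) (rule sum.swap)
  then have "(\<Sum>r\<in>I. \<Sum>s\<in>I. (frob_norm (commutator (A r) (A s)))\<^sup>2) + (1/2) * (frob_norm (mat_sum n Z I))\<^sup>2
    = (\<Sum>r\<in>I. \<Sum>s\<in>I. (frob_norm (commutator (A r) (A s)))\<^sup>2 + (1/2) * Re (frob_inner (Z r) (Z s)))"
    by (simp only: sum.distrib sum_distrib_left)
  also have "\<dots> = (\<Sum>r\<in>I. \<Sum>s\<in>I. (frob_norm (commutator (C r) (C s)))\<^sup>2 + (frob_norm (commutator (C r) (D s)))\<^sup>2
       + (frob_norm (commutator (D r) (C s)))\<^sup>2 + (frob_norm (commutator (D r) (D s)))\<^sup>2)"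
    by (intro sum.cong refl point)
  finally show ?thesis unfolding Z_def .
qed

section \<open>Unitary and orthogonal invariance\<close>

text \<open>The unitary half of \<open>K_act\<close>; \<open>rot_family\<close> is the orthogonal
  half. The two commute, so their invariance properties can be proved separately.\<close>

definition conj_by :: "complex mat \<Rightarrow> complex mat \<Rightarrow> complex mat" where
  "conj_by P X = mat_adjoint P * X * P"

definition rot_family :: "nat \<Rightarrow> nat \<Rightarrow> real mat \<Rightarrow> (nat \<Rightarrow> complex mat) \<Rightarrow> nat \<Rightarrow> complex mat" where
  "rot_family n M R A l = mat_sum n (\<lambda>j. complex_of_real (R $$ (j, l)) \<cdot>\<^sub>m A j) {..<M}"

definition commutator_sum :: "nat \<Rightarrow> (nat \<Rightarrow> complex mat) \<Rightarrow> real" where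
  "commutator_sum M A = (\<Sum>r<M. \<Sum>s<M. (frob_norm (commutator (A r) (A s)))\<^sup>2)"

lemma conj_by_carrier [simp]:
  "P \<in> carrier_mat n n \<Longrightarrow> X \<in> carrier_mat n n \<Longrightarrow> conj_by P X \<in> carrier_mat n n"
  unfolding conj_by_def by auto

lemma conj_by_index:
  assumes P: "P \<in> carrier_mat n n" and X: "X \<in> carrier_mat n n" and ij: "i < n" "j < n"
  shows "conj_by P X $$ (i, j)
    = herm_form n (\<lambda>a b. X $$ (a, b)) (\<lambda>a. P $$ (a, i)) (\<lambda>a. P $$ (a, j))"
proof -
  have a: "mat_adjoint P \<in> carrier_mat n n" "mat_adjoint P * X \<in> carrier_mat n n" using P X by auto
  have "conj_by P X $$ (i, j) = (\<Sum>b<n. (\<Sum>a<n. cnj (P $$ (a, i)) * X $$ (a, b)) * P $$ (b, j))"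
    unfolding conj_by_def using P ij
    by (simp add: index_mult_mat_sum[OF a(2) P] index_mult_mat_sum[OF a(1) X] del: index_mult_mat(1))
  also have "\<dots> = (\<Sum>a<n. \<Sum>b<n. cnj (P $$ (a, i)) * X $$ (a, b) * P $$ (b, j))"
    unfolding sum_distrib_right by (rule sum.swap)
  finally show ?thesis unfolding herm_form_def .
qed

lemma conj_by_hermitian:
  assumes P: "P \<in> carrier_mat n n" and X: "X \<in> carrier_mat n n" and h: "mat_adjoint X = X"
  shows "mat_adjoint (conj_by P X) = conj_by P X"
proof -
  have P': "mat_adjoint P \<in> carrier_mat n n" using P by simp
  then have PX: "mat_adjoint P * X \<in> carrier_mat n n" using X by auto
  show ?thesis
    unfolding conj_by_def mat_adjoint_mult[OF PX P] mat_adjoint_mult[OF P' X] h mat_adjoint_adjoint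
    using P P' X by (simp add: assoc_mult_mat[of _ n n _ n _ n] mult_carrier_mat[of _ n n _ n])
qed

lemma unitary_group_carrier: "P \<in> unitary_group n \<Longrightarrow> P \<in> carrier_mat n n"
  by (simp add: unitary_group_def)

lemma unitary_right_inverse:
  assumes "P \<in> unitary_group n"
  shows "P * mat_adjoint P = 1\<^sub>m n"
  using assms by (auto simp: unitary_group_def intro: mat_mult_left_right_inverse[of "mat_adjoint P"])

lemma conj_by_mult:
  assumes U: "P \<in> unitary_group n" and X: "X \<in> carrier_mat n n" and Y: "Y \<in> carrier_mat n n"
  shows "conj_by P X * conj_by P Y = conj_by P (X * Y)"
proof -
  note P = unitary_group_carrier[OF U]
  have P': "mat_adjoint P \<in> carrier_mat n n" using P by simp
  have "conj_by P X * conj_by P Y = mat_adjoint P * (X * ((P * mat_adjoint P) * (Y * P)))"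
    unfolding conj_by_def using P P' X Y by (simp add: assoc_mult_mat[of _ n n _ n _ n] mult_carrier_mat[of _ n n _ n])
  also have "\<dots> = conj_by P (X * Y)"
    unfolding conj_by_def unitary_right_inverse[OF U]
    using P P' X Y by (simp add: assoc_mult_mat[of _ n n _ n _ n] mult_carrier_mat[of _ n n _ n] left_mult_one_mat[of _ n n])
  finally show ?thesis .
qed

lemma conj_by_minus:
  assumes P: "P \<in> carrier_mat n n" and X: "X \<in> carrier_mat n n" and Y: "Y \<in> carrier_mat n n"
  shows "conj_by P (X - Y) = conj_by P X - conj_by P Y"
proof -
  have P': "mat_adjoint P \<in> carrier_mat n n" using P by simp
  have "mat_adjoint P * X \<in> carrier_mat n n" "mat_adjoint P * Y \<in> carrier_mat n n" using P X Y by auto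
  then show ?thesis unfolding conj_by_def
    by (simp only: mult_minus_distrib_mat[OF P' X Y] minus_mult_distrib_mat[OF _ _ P])
qed

lemma conj_by_commutator:
  assumes U: "P \<in> unitary_group n" and X: "X \<in> carrier_mat n n" and Y: "Y \<in> carrier_mat n n"
  shows "commutator (conj_by P X) (conj_by P Y) = conj_by P (commutator X Y)"
proof -
  have "X * Y \<in> carrier_mat n n" "Y * X \<in> carrier_mat n n" using X Y by auto
  then show ?thesis
    unfolding commutator_def conj_by_mult[OF U X Y] conj_by_mult[OF U Y X]
    by (rule conj_by_minus[OF unitary_group_carrier[OF U], symmetric])
qed

lemma conj_by_inner:
  assumes U: "P \<in> unitary_group n" and X: "X \<in> carrier_mat n n" and Y: "Y \<in> carrier_mat n n"
  shows "frob_inner (conj_by P X) (conj_by P Y) = frob_inner X Y"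
proof -
  note P = unitary_group_carrier[OF U]
  have P': "mat_adjoint P \<in> carrier_mat n n" using P by simp
  have c: "mat_adjoint P * X \<in> carrier_mat n n" "mat_adjoint P * Y \<in> carrier_mat n n"
    "conj_by P Y \<in> carrier_mat n n" using P X Y by auto
  have "frob_inner (conj_by P X) (conj_by P Y)
      = frob_inner (mat_adjoint P * X) (conj_by P Y * mat_adjoint P)"
    unfolding conj_by_def[of P X] by (rule frob_inner_mult_right[OF c(1) P c(3)])
  also have "conj_by P Y * mat_adjoint P = mat_adjoint P * Y * (P * mat_adjoint P)"
    unfolding conj_by_def using P P' Y by (simp add: assoc_mult_mat[of _ n n _ n _ n] mult_carrier_mat[of _ n n _ n])
  also have "\<dots> = mat_adjoint P * Y"
    unfolding unitary_right_inverse[OF U] by (rule right_mult_one_mat[OF c(2)])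
  also have "frob_inner (mat_adjoint P * X) (mat_adjoint P * Y) = frob_inner X (P * (mat_adjoint P * Y))"
    using frob_inner_mult_left[OF P' X c(2)] by simp
  also have "P * (mat_adjoint P * Y) = Y"
    using P P' Y unitary_right_inverse[OF U] by (simp flip: assoc_mult_mat[of _ n n _ n _ n])
  finally show ?thesis .
qed

lemma conj_by_norm:
  assumes U: "P \<in> unitary_group n" and X: "X \<in> carrier_mat n n"
  shows "(frob_norm (conj_by P X))\<^sup>2 = (frob_norm X)\<^sup>2"
  unfolding frob_norm_sq_inner conj_by_inner[OF U X X] ..

lemma conj_by_commutator_norm:
  assumes U: "P \<in> unitary_group n" and X: "X \<in> carrier_mat n n" and Y: "Y \<in> carrier_mat n n"
  shows "(frob_norm (commutator (conj_by P X) (conj_by P Y)))\<^sup>2 = (frob_norm (commutator X Y))\<^sup>2"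
  unfolding conj_by_commutator[OF assms] using X Y by (intro conj_by_norm[OF U]) auto

section \<open>Rotation of a family by a real orthogonal matrix\<close>

lemma orthogonal_right_inverse:
  assumes "R \<in> orthogonal_group M"
  shows "R * transpose_mat R = 1\<^sub>m M"
  using assms by (auto simp: orthogonal_group_def intro: mat_mult_left_right_inverse[of "transpose_mat R"])

lemma orthogonal_rows:
  assumes R: "R \<in> orthogonal_group M" and jk: "j < M" "k < M"
  shows "(\<Sum>l<M. R $$ (j, l) * R $$ (k, l)) = (if j = k then 1 else 0)"
proof -
  have c: "R \<in> carrier_mat M M" "transpose_mat R \<in> carrier_mat M M"
    using R by (auto simp: orthogonal_group_def)
  have "(\<Sum>l<M. R $$ (j, l) * R $$ (k, l)) = (R * transpose_mat R) $$ (j, k)"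
    using c jk by (simp add: index_mult_mat_sum[OF c] del: index_mult_mat(1))
  then show ?thesis using orthogonal_right_inverse[OF R] jk by simp
qed

text \<open>Expanding the squares leaves inner products of rows of \<open>R\<close>, and these are
  orthonormal because the transpose is a right inverse as well. Applied to every matrix entry, it
  shows that rotation preserves the total squared norm.\<close>

lemma orthogonal_sum_norm:
  fixes z :: "nat \<Rightarrow> complex"
  assumes R: "R \<in> orthogonal_group M"
  shows "(\<Sum>l<M. (norm (\<Sum>j<M. of_real (R $$ (j, l)) * z j))\<^sup>2) = (\<Sum>j<M. (norm (z j))\<^sup>2)"
proof -
  have "complex_of_real (\<Sum>l<M. (norm (\<Sum>j<M. of_real (R $$ (j, l)) * z j))\<^sup>2)
    = (\<Sum>l<M. (\<Sum>j<M. of_real (R $$ (j, l)) * z j) * (\<Sum>k<M. of_real (R $$ (k, l)) * cnj (z k)))"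
    unfolding of_real_sum complex_norm_square by simp
  also have "\<dots> = (\<Sum>l<M. \<Sum>j<M. \<Sum>k<M. of_real (R $$ (j, l) * R $$ (k, l)) * (z j * cnj (z k)))"
    by (simp add: sum_product mult_ac)
  also have "\<dots> = (\<Sum>j<M. \<Sum>l<M. \<Sum>k<M. of_real (R $$ (j, l) * R $$ (k, l)) * (z j * cnj (z k)))"
    by (rule sum.swap)
  also have "\<dots> = (\<Sum>j<M. \<Sum>k<M. \<Sum>l<M. of_real (R $$ (j, l) * R $$ (k, l)) * (z j * cnj (z k)))"
    by (intro sum.cong refl sum.swap)
  also have "\<dots> = (\<Sum>j<M. \<Sum>k<M. of_real (\<Sum>l<M. R $$ (j, l) * R $$ (k, l)) * (z j * cnj (z k)))"
    by (simp add: sum_distrib_right)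
  also have "\<dots> = (\<Sum>j<M. \<Sum>k<M. if k = j then z j * cnj (z j) else 0)"
    by (intro sum.cong refl) (simp add: orthogonal_rows[OF R])
  also have "\<dots> = complex_of_real (\<Sum>j<M. (norm (z j))\<^sup>2)"
    unfolding of_real_sum complex_norm_square by simp
  finally show ?thesis by (simp only: of_real_eq_iff)
qed

lemma rot_family_carrier [simp]: "rot_family n M R A l \<in> carrier_mat n n"
  by (simp add: rot_family_def)

lemma dim_rot_family [simp]:
  "dim_row (rot_family n M R A l) = n" "dim_col (rot_family n M R A l) = n"
  by (simp_all add: rot_family_def)

lemma rot_family_index:
  assumes "\<And>j. j < M \<Longrightarrow> A j \<in> carrier_mat n n" "a < n" "b < n"
  shows "rot_family n M R A l $$ (a, b) = (\<Sum>j<M. complex_of_real (R $$ (j, l)) * A j $$ (a, b))"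
  unfolding rot_family_def mat_sum_index[OF assms(2,3)]
proof (intro sum.cong refl)
  fix j assume "j \<in> {..<M}"
  then have "A j \<in> carrier_mat n n" using assms(1) by simp
  then show "(complex_of_real (R $$ (j, l)) \<cdot>\<^sub>m A j) $$ (a, b) = complex_of_real (R $$ (j, l)) * A j $$ (a, b)"
    using assms(2,3) by simp
qed

lemma rot_family_norm:
  assumes R: "R \<in> orthogonal_group M" and A: "\<And>j. j < M \<Longrightarrow> A j \<in> carrier_mat n n"
  shows "(\<Sum>l<M. (frob_norm (rot_family n M R A l))\<^sup>2) = (\<Sum>j<M. (frob_norm (A j))\<^sup>2)"
proof -
  let ?z = "\<lambda>l a b. (norm (\<Sum>j<M. complex_of_real (R $$ (j, l)) * A j $$ (a, b)))\<^sup>2"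
  have e: "rot_family n M R A l $$ (a, b) = (\<Sum>j<M. complex_of_real (R $$ (j, l)) * A j $$ (a, b))"
    if "a < n" "b < n" for l a b
    using rot_family_index[OF A that] .
  have "(\<Sum>l<M. (frob_norm (rot_family n M R A l))\<^sup>2) = (\<Sum>l<M. \<Sum>a<n. \<Sum>b<n. ?z l a b)"
    by (simp add: frob_norm_sq_sum[of _ n] e)
  also have "\<dots> = (\<Sum>a<n. \<Sum>l<M. \<Sum>b<n. ?z l a b)" by (rule sum.swap)
  also have "\<dots> = (\<Sum>a<n. \<Sum>b<n. \<Sum>l<M. ?z l a b)" by (intro sum.cong refl sum.swap)
  also have "\<dots> = (\<Sum>a<n. \<Sum>b<n. \<Sum>j<M. (norm (A j $$ (a, b)))\<^sup>2)"
    by (simp only: orthogonal_sum_norm[OF R])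
  also have "\<dots> = (\<Sum>a<n. \<Sum>j<M. \<Sum>b<n. (norm (A j $$ (a, b)))\<^sup>2)" by (intro sum.cong refl sum.swap)
  also have "\<dots> = (\<Sum>j<M. \<Sum>a<n. \<Sum>b<n. (norm (A j $$ (a, b)))\<^sup>2)" by (rule sum.swap)
  also have "\<dots> = (\<Sum>j<M. (frob_norm (A j))\<^sup>2)"
    using A by (intro sum.cong refl) (simp add: frob_norm_sq_sum[of _ n])
  finally show ?thesis .
qed

lemma rot_family_commutator:
  assumes A: "\<And>j. j < M \<Longrightarrow> A j \<in> carrier_mat n n" and Y: "Y \<in> carrier_mat n n"
  shows "commutator (rot_family n M R A l) Y = rot_family n M R (\<lambda>j. commutator (A j) Y) l"
proof (rule eq_matI)
  show "dim_row (commutator (rot_family n M R A l) Y) = dim_row (rot_family n M R (\<lambda>j. commutator (A j) Y) l)"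
    "dim_col (commutator (rot_family n M R A l) Y) = dim_col (rot_family n M R (\<lambda>j. commutator (A j) Y) l)"
    using Y by (auto simp: commutator_def rot_family_def)
  fix a b assume "a < dim_row (rot_family n M R (\<lambda>j. commutator (A j) Y) l)"
    "b < dim_col (rot_family n M R (\<lambda>j. commutator (A j) Y) l)"
  then have ab: "a < n" "b < n" by (auto simp: rot_family_def)
  let ?S = "rot_family n M R A l" and ?r = "\<lambda>j. complex_of_real (R $$ (j, l))"
  have e: "?S $$ (a, b) = (\<Sum>j<M. ?r j * A j $$ (a, b))" if "a < n" "b < n" for a b
    using rot_family_index[OF A that] .
  have S: "?S \<in> carrier_mat n n" by simp
  have c: "commutator X Y $$ (a, b) = (\<Sum>k<n. X $$ (a, k) * Y $$ (k, b)) - (\<Sum>k<n. Y $$ (a, k) * X $$ (k, b))"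
    if X: "X \<in> carrier_mat n n" for X
    unfolding commutator_def using X Y ab
    by (simp add: index_mult_mat_sum[OF X Y] index_mult_mat_sum[OF Y X] del: index_mult_mat(1))
  have cA: "commutator (A j) Y $$ (a, b) = (\<Sum>k<n. A j $$ (a, k) * Y $$ (k, b)) - (\<Sum>k<n. Y $$ (a, k) * A j $$ (k, b))"
    if "j < M" for j using c[OF A[OF that]] .
  have "commutator ?S Y $$ (a, b)
    = (\<Sum>k<n. \<Sum>j<M. ?r j * (A j $$ (a, k) * Y $$ (k, b))) - (\<Sum>k<n. \<Sum>j<M. ?r j * (Y $$ (a, k) * A j $$ (k, b)))"
    unfolding c[OF S] using ab by (simp add: e sum_distrib_left sum_distrib_right mult_ac)
  also have "\<dots> = (\<Sum>j<M. \<Sum>k<n. ?r j * (A j $$ (a, k) * Y $$ (k, b))) - (\<Sum>j<M. \<Sum>k<n. ?r j * (Y $$ (a, k) * A j $$ (k, b)))"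
    by (intro arg_cong2[of _ _ _ _ "(-)"] sum.swap)
  also have "\<dots> = (\<Sum>j<M. ?r j * commutator (A j) Y $$ (a, b))"
    by (simp add: cA sum_distrib_left right_diff_distrib sum_subtractf)
  also have "\<dots> = rot_family n M R (\<lambda>j. commutator (A j) Y) l $$ (a, b)"
  proof -
    have "commutator (A j) Y \<in> carrier_mat n n" if "j < M" for j using A[OF that] Y by simp
    then show ?thesis by (rule rot_family_index[OF _ ab, symmetric])
  qed
  finally show "commutator ?S Y $$ (a, b) = rot_family n M R (\<lambda>j. commutator (A j) Y) l $$ (a, b)" .
qed

text \<open>One slot at a time: for fixed \<open>Y\<close> the commutators with a rotated family are
  the rotated commutators, so norm invariance applies. Antisymmetry brings the second slot to the
  front.\<close>

lemma commutator_sum_rotate: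
  assumes R: "R \<in> orthogonal_group M" and A: "\<And>j. j < M \<Longrightarrow> A j \<in> carrier_mat n n"
  shows "commutator_sum M (rot_family n M R A) = commutator_sum M A"
proof -
  let ?C = "rot_family n M R A"
  have one: "(\<Sum>l<M. (frob_norm (commutator (?C l) Y))\<^sup>2) = (\<Sum>j<M. (frob_norm (commutator (A j) Y))\<^sup>2)"
    if Y: "Y \<in> carrier_mat n n" for Y
    using rot_family_norm[OF R, of "\<lambda>j. commutator (A j) Y" n] A Y
    by (simp add: rot_family_commutator[OF A Y])
  have "commutator_sum M ?C = (\<Sum>s<M. \<Sum>r<M. (frob_norm (commutator (?C r) (?C s)))\<^sup>2)"
    unfolding commutator_sum_def by (rule sum.swap)
  also have "\<dots> = (\<Sum>s<M. \<Sum>r<M. (frob_norm (commutator (A r) (?C s)))\<^sup>2)"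
    by (intro sum.cong refl one) simp
  also have "\<dots> = (\<Sum>r<M. \<Sum>s<M. (frob_norm (commutator (A r) (?C s)))\<^sup>2)"
    by (rule sum.swap)
  also have "\<dots> = (\<Sum>r<M. \<Sum>s<M. (frob_norm (commutator (?C s) (A r)))\<^sup>2)"
    using A by (intro sum.cong refl arg_cong[of _ _ "\<lambda>x. x\<^sup>2"] frob_norm_commutator_swap[of _ n]) auto
  also have "\<dots> = (\<Sum>r<M. \<Sum>s<M. (frob_norm (commutator (A s) (A r)))\<^sup>2)"
    using A by (intro sum.cong refl one) auto
  also have "\<dots> = commutator_sum M A" unfolding commutator_sum_def by (rule sum.swap)
  finally show ?thesis .
qed

lemma conj_by_rotate:
  assumes P: "P \<in> carrier_mat n n" and A: "\<And>j. j < M \<Longrightarrow> A j \<in> carrier_mat n n"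
  shows "rot_family n M R (\<lambda>j. conj_by P (A j)) l = conj_by P (rot_family n M R A l)"
proof (rule eq_matI)
  let ?S = "rot_family n M R A l" and ?r = "\<lambda>j. complex_of_real (R $$ (j, l))"
  have cS: "conj_by P ?S \<in> carrier_mat n n" using P by simp
  show "dim_row (rot_family n M R (\<lambda>j. conj_by P (A j)) l) = dim_row (conj_by P ?S)"
    "dim_col (rot_family n M R (\<lambda>j. conj_by P (A j)) l) = dim_col (conj_by P ?S)"
    using cS by (auto simp: rot_family_def)
  fix i j assume "i < dim_row (conj_by P ?S)" "j < dim_col (conj_by P ?S)"
  then have ij: "i < n" "j < n" using cS by auto
  have e: "?S $$ (a, b) = (\<Sum>j<M. ?r j * A j $$ (a, b))" if "a < n" "b < n" for a b
    using rot_family_index[OF A that] .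
  have "rot_family n M R (\<lambda>j. conj_by P (A j)) l $$ (i, j)
    = (\<Sum>k<M. ?r k * conj_by P (A k) $$ (i, j))"
  proof -
    have "conj_by P (A j) \<in> carrier_mat n n" if "j < M" for j using A[OF that] P by simp
    then show ?thesis by (rule rot_family_index[OF _ ij])
  qed
  also have "\<dots> = (\<Sum>k<M. \<Sum>a<n. \<Sum>b<n. ?r k * (cnj (P $$ (a, i)) * A k $$ (a, b) * P $$ (b, j)))"
    by (intro sum.cong refl) (simp add: conj_by_index[OF P A ij] herm_form_def sum_distrib_left)
  also have "\<dots> = (\<Sum>a<n. \<Sum>k<M. \<Sum>b<n. ?r k * (cnj (P $$ (a, i)) * A k $$ (a, b) * P $$ (b, j)))"
    by (rule sum.swap)
  also have "\<dots> = (\<Sum>a<n. \<Sum>b<n. \<Sum>k<M. ?r k * (cnj (P $$ (a, i)) * A k $$ (a, b) * P $$ (b, j)))"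
    by (intro sum.cong refl sum.swap)
  also have "\<dots> = (\<Sum>a<n. \<Sum>b<n. cnj (P $$ (a, i)) * ?S $$ (a, b) * P $$ (b, j))"
    by (intro sum.cong refl) (simp add: e sum_distrib_left sum_distrib_right mult_ac)
  also have "\<dots> = conj_by P ?S $$ (i, j)"
    unfolding conj_by_index[OF P rot_family_carrier ij] herm_form_def ..
  finally show "rot_family n M R (\<lambda>j. conj_by P (A j)) l $$ (i, j) = conj_by P ?S $$ (i, j)" .
qed

section \<open>Frames as unitary matrices and the spectral theorem\<close>

definition frame_mat :: "nat \<Rightarrow> (nat \<Rightarrow> nat \<Rightarrow> complex) \<Rightarrow> complex mat" where
  "frame_mat n p = mat n n (\<lambda>(a, l). p l a)"

lemma frame_mat_unitary:
  assumes "orthonormal_frame n UNIV p"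
  shows "frame_mat n p \<in> unitary_group n"
proof -
  have c: "frame_mat n p \<in> carrier_mat n n" "mat_adjoint (frame_mat n p) \<in> carrier_mat n n"
    by (auto simp: frame_mat_def)
  have "mat_adjoint (frame_mat n p) * frame_mat n p = 1\<^sub>m n"
  proof (rule eq_matI)
    fix i j assume "i < dim_row (1\<^sub>m n)" "j < dim_col (1\<^sub>m n)"
    then have ij: "i < n" "j < n" by auto
    have "(mat_adjoint (frame_mat n p) * frame_mat n p) $$ (i, j) = (\<Sum>k<n. cnj (p i k) * p j k)"
      using ij by (subst index_mult_mat_sum[OF c(2,1)]) (simp_all add: frame_mat_def)
    then show "(mat_adjoint (frame_mat n p) * frame_mat n p) $$ (i, j) = 1\<^sub>m n $$ (i, j)"
      using assms ij by (simp add: orthonormal_frame_def del: index_mult_mat(1))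
  qed (use c in auto)
  with c(1) show ?thesis by (simp add: unitary_group_def)
qed

lemma frame_conj_index:
  assumes X: "X \<in> carrier_mat n n" and ij: "i < n" "j < n"
  shows "conj_by (frame_mat n p) X $$ (i, j) = herm_form n (\<lambda>a b. X $$ (a, b)) (p i) (p j)"
proof -
  have "frame_mat n p \<in> carrier_mat n n" by (simp add: frame_mat_def)
  from conj_by_index[OF this X ij] show ?thesis
    using ij by (simp add: herm_form_def frame_mat_def)
qed

lemma hermitian_index:
  assumes "X \<in> carrier_mat n n" "mat_adjoint X = X" "i < n" "j < n"
  shows "X $$ (j, i) = cnj (X $$ (i, j))"
  using mat_adjoint_index[of j X i] assms by simp

definition real_diag_mat :: "nat \<Rightarrow> (nat \<Rightarrow> real) \<Rightarrow> complex mat" where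
  "real_diag_mat n \<eta> = mat n n (\<lambda>(i, j). if i = j then complex_of_real (\<eta> i) else 0)"

lemma hermitian_diagonalisation:
  assumes A: "A \<in> carrier_mat n n" and h: "mat_adjoint A = A"
  obtains p \<eta> where "orthonormal_frame n UNIV p"
    and "conj_by (frame_mat n p) A = real_diag_mat n \<eta>"
proof -
  let ?G = "\<lambda>a b. A $$ (a, b)"
  have herm: "?G b a = cnj (?G a b)" if "a < n" "b < n" for a b
    using hermitian_index[OF A h that] .
  obtain p where p: "orthonormal_frame n UNIV p"
    and z: "\<And>l l'. l < n \<Longrightarrow> l' < n \<Longrightarrow> l \<noteq> l' \<Longrightarrow> herm_form n ?G (p l) (p l') = 0"
    using hermitian_form_diagonalisation[of n ?G] herm by blast
  have real: "herm_form n ?G (p i) (p i) = of_real (Re (herm_form n ?G (p i) (p i)))" for i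
    using herm_form_cnj[OF herm, where x = "p i" and y = "p i"] by (simp add: complex_eq_iff)
  have c: "frame_mat n p \<in> carrier_mat n n" by (simp add: frame_mat_def)
  have "conj_by (frame_mat n p) A = real_diag_mat n (\<lambda>i. Re (herm_form n ?G (p i) (p i)))"
    unfolding real_diag_mat_def using conj_by_carrier[OF c A]
    by (intro eq_matI) (auto simp: frame_conj_index[OF A] z real[symmetric])
  with p show ?thesis by (rule that)
qed

section \<open>Spectral gaps\<close>

lemma sq_diff_le: "(x - y)\<^sup>2 \<le> 2 * x\<^sup>2 + 2 * y\<^sup>2" for x y :: real
  using zero_le_power2[of "x + y"] by (simp add: power2_sum power2_diff)

text \<open>Two disjoint pairs cannot both have squared gap larger than the total, nor can all three
  pairs of a triple; hence the pairs with a large gap form a star.\<close>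

lemma large_gaps_star:
  fixes \<eta> :: "nat \<Rightarrow> real" and n :: nat
  defines "a \<equiv> \<Sum>i<n. (\<eta> i)\<^sup>2"
  defines "S \<equiv> {(i, j). i < n \<and> j < n \<and> a < (\<eta> i - \<eta> j)\<^sup>2}"
  assumes "S \<noteq> {}"
  obtains c where "c < n" "\<And>i j. (i, j) \<in> S \<Longrightarrow> i = c \<or> j = c"
proof -
  have sub: "(\<Sum>i\<in>I. (\<eta> i)\<^sup>2) \<le> a" if "I \<subseteq> {..<n}" for I
    unfolding a_def using that by (intro sum_mono2) auto
  have a0: "0 \<le> a" by (simp add: a_def sum_nonneg)
  have ne: "i \<noteq> j" if "(i, j) \<in> S" for i j
    using that a0 by (auto simp: S_def)
  have sym: "(j, i) \<in> S" if "(i, j) \<in> S" for i j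
    using that by (auto simp: S_def power2_commute)
  have meet: "i = k \<or> i = l \<or> j = k \<or> j = l" if ij: "(i, j) \<in> S" and kl: "(k, l) \<in> S" for i j k l
  proof (rule ccontr)
    assume d: "\<not> ?thesis"
    have "(\<eta> i)\<^sup>2 + (\<eta> j)\<^sup>2 + (\<eta> k)\<^sup>2 + (\<eta> l)\<^sup>2 \<le> a"
      using sub[of "{i, j, k, l}"] ij kl d ne[OF ij] ne[OF kl] by (auto simp: S_def)
    moreover have "a < (\<eta> i - \<eta> j)\<^sup>2" "a < (\<eta> k - \<eta> l)\<^sup>2" using ij kl by (auto simp: S_def)
    \<comment> \<open>A squared gap is at most twice the sum of its two squares, so disjoint pairs
      total at most \<open>2 a\<close>.\<close>
    ultimately show False using sq_diff_le[of "\<eta> i" "\<eta> j"] sq_diff_le[of "\<eta> k" "\<eta> l"] by linarith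
  qed
  have tri: False if "(i, j) \<in> S" "(j, k) \<in> S" "(i, k) \<in> S" for i j k
  proof -
    have "(\<eta> i)\<^sup>2 + (\<eta> j)\<^sup>2 + (\<eta> k)\<^sup>2 \<le> a"
      using sub[of "{i, j, k}"] that ne[OF that(1)] ne[OF that(2)] ne[OF that(3)] by (auto simp: S_def)
    moreover have "a < (\<eta> i - \<eta> j)\<^sup>2" "a < (\<eta> j - \<eta> k)\<^sup>2" "a < (\<eta> i - \<eta> k)\<^sup>2"
      using that by (auto simp: S_def)
    \<comment> \<open>By this identity the three squared gaps total at most \<open>3 a\<close>, yet
      each was assumed larger than \<open>a\<close>.\<close>
    moreover have "(\<eta> i - \<eta> j)\<^sup>2 + (\<eta> j - \<eta> k)\<^sup>2 + (\<eta> i - \<eta> k)\<^sup>2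
        = 3 * (\<eta> i)\<^sup>2 + 3 * (\<eta> j)\<^sup>2 + 3 * (\<eta> k)\<^sup>2 - (\<eta> i + \<eta> j + \<eta> k)\<^sup>2"
      by (simp add: power2_eq_square algebra_simps)
    ultimately show False using zero_le_power2[of "\<eta> i + \<eta> j + \<eta> k"] by linarith
  qed
  obtain i j where ij: "(i, j) \<in> S" using assms(3) by auto
  show ?thesis
  \<comment> \<open>If neither end of \<open>(i, j)\<close> is a centre, one large pair avoids
    \<open>i\<close> and another avoids \<open>j\<close>. Both meet \<open>{i, j}\<close>, hence
    have the form \<open>(j, l1)\<close> and \<open>(i, l2)\<close>; they also meet each other, so
    \<open>l1 = l2\<close> closes a forbidden triangle.\<close>
  proof (rule ccontr)
    assume no: "\<not> thesis"
    have "i < n" "j < n" using ij by (auto simp: S_def)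
    have "\<not> (\<forall>k l. (k, l) \<in> S \<longrightarrow> k = i \<or> l = i)" "\<not> (\<forall>k l. (k, l) \<in> S \<longrightarrow> k = j \<or> l = j)"
      using no that[OF \<open>i < n\<close>] that[OF \<open>j < n\<close>] by blast+
    then obtain k l k' l' where kl: "(k, l) \<in> S" "k \<noteq> i" "l \<noteq> i"
      and kl': "(k', l') \<in> S" "k' \<noteq> j" "l' \<noteq> j" by blast
    have "j = k \<or> j = l" using meet[OF ij kl(1)] kl by auto
    then obtain l1 where 1: "(j, l1) \<in> S" "l1 \<noteq> i" using kl sym by blast
    have "i = k' \<or> i = l'" using meet[OF ij kl'(1)] kl' by auto
    then obtain l2 where 2: "(i, l2) \<in> S" "l2 \<noteq> j" using kl' sym by blast
    have "l1 = l2" using meet[OF 1(1) 2(1)] ne[OF ij] 1 2 by auto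
    then show False using tri[OF ij 1(1)] 2 by simp
  qed
qed

text \<open>Only large gaps contribute, and they form a star. The double sum counts each of its
  pairs in both orders, so the excesses along the rays need to total at most
  \<open>a\<close>.\<close>

lemma excess_gap_sum:
  fixes \<eta> :: "nat \<Rightarrow> real" and n :: nat
  defines "a \<equiv> \<Sum>i<n. (\<eta> i)\<^sup>2"
  shows "(\<Sum>i<n. \<Sum>j<n. max 0 ((\<eta> i - \<eta> j)\<^sup>2 - a)) \<le> 2 * a"
proof -
  define S where "S = {(i, j). i < n \<and> j < n \<and> a < (\<eta> i - \<eta> j)\<^sup>2}"
  have a0: "0 \<le> a" by (simp add: a_def sum_nonneg)
  have fin: "finite S" unfolding S_def by (rule finite_subset[of _ "{..<n} \<times> {..<n}"]) auto
  have "(\<Sum>i<n. \<Sum>j<n. max 0 ((\<eta> i - \<eta> j)\<^sup>2 - a))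
    = (\<Sum>z\<in>{..<n} \<times> {..<n}. max 0 ((\<eta> (fst z) - \<eta> (snd z))\<^sup>2 - a))"
    by (simp add: sum.cartesian_product case_prod_beta)
  also have "\<dots> = (\<Sum>z\<in>S. max 0 ((\<eta> (fst z) - \<eta> (snd z))\<^sup>2 - a))"
    by (intro sum.mono_neutral_right) (auto simp: S_def)
  also have "\<dots> = (\<Sum>z\<in>S. (\<eta> (fst z) - \<eta> (snd z))\<^sup>2 - a)"
    by (intro sum.cong refl) (auto simp: S_def)
  also have "\<dots> \<le> 2 * a"
  proof (cases "S = {}")
    case False
    from large_gaps_star[of n \<eta>, folded a_def, folded S_def, OF this]
    obtain c where c: "c < n" "\<And>i j. (i, j) \<in> S \<Longrightarrow> i = c \<or> j = c" by blast
    define L where "L = {x. x < n \<and> a < (\<eta> c - \<eta> x)\<^sup>2}"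
    have L: "finite L" "c \<notin> L" "L \<subseteq> {..<n}" using a0 by (auto simp: L_def)
    have SL: "S = Pair c ` L \<union> (\<lambda>x. (x, c)) ` L"
    proof
      show "Pair c ` L \<union> (\<lambda>x. (x, c)) ` L \<subseteq> S"
        using c(1) by (auto simp: S_def L_def power2_commute)
      show "S \<subseteq> Pair c ` L \<union> (\<lambda>x. (x, c)) ` L"
      proof clarify
        fix x y assume xy: "(x, y) \<in> S" "(x, y) \<notin> (\<lambda>x. (x, c)) ` L"
        have "y \<noteq> c" using xy by (auto simp: S_def L_def power2_commute)
        then have "x = c" using c(2)[OF xy(1)] by simp
        moreover from this have "y \<in> L" using xy(1) by (simp add: S_def L_def)
        ultimately show "(x, y) \<in> Pair c ` L" by simp
      qed
    qed
    let ?g = "\<lambda>z. (\<eta> (fst z) - \<eta> (snd z))\<^sup>2 - a"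
    have "sum ?g S = sum ?g (Pair c ` L) + sum ?g ((\<lambda>x. (x, c)) ` L)"
      unfolding SL using L by (intro sum.union_disjoint) auto
    also have "\<dots> = 2 * (\<Sum>x\<in>L. (\<eta> c - \<eta> x)\<^sup>2 - a)"
      by (simp add: sum.reindex inj_on_def power2_commute)
    \<comment> \<open>With \<open>e\<close> for \<open>\<eta> c\<close>, \<open>k\<close> leaves,
      their sum \<open>s\<close> and square sum \<open>q\<close>, the left side is
      \<open>k e^2 - 2 e s + q - k a\<close>. From \<open>- 2 e s \<le> e^2 + s^2\<close> and
      \<open>s^2 \<le> k q\<close> it is at most \<open>(k + 1) (e^2 + q) - k a\<close>, hence at
      most \<open>a\<close>.\<close>
    also have "(\<Sum>x\<in>L. (\<eta> c - \<eta> x)\<^sup>2 - a) \<le> a"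
    proof -
      define q s k where "q = (\<Sum>x\<in>L. (\<eta> x)\<^sup>2)" and "s = (\<Sum>x\<in>L. \<eta> x)" and "k = real (card L)"
      have "(\<Sum>x\<in>insert c L. (\<eta> x)\<^sup>2) \<le> a"
        unfolding a_def using L c by (intro sum_mono2) auto
      then have qa: "(\<eta> c)\<^sup>2 + q \<le> a" using L by (simp add: q_def)
      have "(\<Sum>x\<in>L. (\<eta> c - \<eta> x)\<^sup>2 - a) = k * (\<eta> c)\<^sup>2 - 2 * \<eta> c * s + q - k * a"
        by (simp add: power2_diff sum_subtractf sum.distrib q_def s_def k_def sum_distrib_left)
      moreover have "s\<^sup>2 \<le> k * q"
      proof (cases "k = 0")
        case True
        then show ?thesis using L by (simp add: k_def s_def)
      next
        case False
        have "0 \<le> (\<Sum>x\<in>L. (k * \<eta> x - s)\<^sup>2)" by (intro sum_nonneg) simp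
        also have "\<dots> = (\<Sum>x\<in>L. k\<^sup>2 * (\<eta> x)\<^sup>2 - 2 * k * s * \<eta> x + s\<^sup>2)"
          by (intro sum.cong refl) (simp add: power2_diff power_mult_distrib)
        also have "\<dots> = k\<^sup>2 * q - 2 * k * s * s + k * s\<^sup>2"
          by (simp add: sum.distrib sum_subtractf q_def k_def s_def flip: sum_distrib_left)
        also have "\<dots> = k * (k * q - s\<^sup>2)" by (simp add: power2_eq_square algebra_simps)
        finally show ?thesis using False by (simp add: zero_le_mult_iff k_def)
      qed
      moreover have "0 \<le> (\<eta> c + s)\<^sup>2" by simp
      moreover have "(\<eta> c + s)\<^sup>2 = (\<eta> c)\<^sup>2 + 2 * \<eta> c * s + s\<^sup>2" by (simp add: power2_sum)
      moreover have "(k + 1) * ((\<eta> c)\<^sup>2 + q) \<le> (k + 1) * a"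
        using qa by (intro mult_left_mono) (auto simp: k_def)
      then have "k * (\<eta> c)\<^sup>2 + k * q + (\<eta> c)\<^sup>2 + q \<le> k * a + a" by (simp add: algebra_simps)
      ultimately show ?thesis by linarith
    qed
    finally show ?thesis by simp
  qed (use a0 in simp)
  finally show ?thesis .
qed

section \<open>Commutators with a Hermitian matrix\<close>

lemma diagonal_commutator_norm:
  fixes X :: "complex mat" and \<eta> :: "nat \<Rightarrow> real"
  assumes X: "X \<in> carrier_mat n n"
  defines "D \<equiv> real_diag_mat n \<eta>"
  shows "(frob_norm (commutator D X))\<^sup>2 = (\<Sum>i<n. \<Sum>j<n. (\<eta> i - \<eta> j)\<^sup>2 * (norm (X $$ (i, j)))\<^sup>2)"
    and "(frob_norm D)\<^sup>2 = (\<Sum>i<n. (\<eta> i)\<^sup>2)"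
proof -
  have D: "D \<in> carrier_mat n n" by (simp add: D_def real_diag_mat_def)
  have e: "commutator D X $$ (i, j) = of_real (\<eta> i - \<eta> j) * X $$ (i, j)" if ij: "i < n" "j < n" for i j
  proof -
    have "(D * X) $$ (i, j) = (\<Sum>k<n. if k = i then of_real (\<eta> i) * X $$ (k, j) else 0)"
      unfolding index_mult_mat_sum[OF D X ij] by (intro sum.cong) (use ij in \<open>auto simp: D_def real_diag_mat_def\<close>)
    moreover have "(X * D) $$ (i, j) = (\<Sum>k<n. if k = j then of_real (\<eta> j) * X $$ (i, k) else 0)"
      unfolding index_mult_mat_sum[OF X D ij] by (intro sum.cong) (use ij in \<open>auto simp: D_def real_diag_mat_def\<close>)
    ultimately show ?thesis
      unfolding commutator_def using X D ij by (simp add: algebra_simps del: index_mult_mat(1))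
  qed
  show "(frob_norm (commutator D X))\<^sup>2 = (\<Sum>i<n. \<Sum>j<n. (\<eta> i - \<eta> j)\<^sup>2 * (norm (X $$ (i, j)))\<^sup>2)"
    unfolding frob_norm_sq_sum[OF commutator_carrier[OF D X]]
    by (intro sum.cong refl) (simp add: e norm_mult power_mult_distrib del: of_real_diff)
  have "(frob_norm D)\<^sup>2 = (\<Sum>i<n. \<Sum>j<n. if j = i then (\<eta> i)\<^sup>2 else 0)"
    unfolding frob_norm_sq_sum[OF D] by (intro sum.cong refl) (auto simp: D_def real_diag_mat_def)
  then show "(frob_norm D)\<^sup>2 = (\<Sum>i<n. (\<eta> i)\<^sup>2)" by simp
qed

lemma pair_gap_le:
  fixes \<eta> :: "nat \<Rightarrow> real"
  assumes "i < n" "j < n"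
  shows "(\<eta> i - \<eta> j)\<^sup>2 \<le> 2 * (\<Sum>k<n. (\<eta> k)\<^sup>2)"
proof (cases "i = j")
  case False
  have "(\<Sum>k\<in>{i, j}. (\<eta> k)\<^sup>2) \<le> (\<Sum>k<n. (\<eta> k)\<^sup>2)"
    using assms by (intro sum_mono2) auto
  then show ?thesis using sq_diff_le[of "\<eta> i" "\<eta> j"] False by simp
qed (simp add: sum_nonneg)

text \<open>The Boettcher-Wenzel inequality with one factor Hermitian. In an eigenbasis the
  commutator multiplies the entry \<open>(i, j)\<close> by the gap
  \<open>\<eta> i - \<eta> j\<close>.\<close>

lemma hermitian_commutator_bound:
  fixes A X :: "complex mat"
  assumes A: "A \<in> carrier_mat n n" "mat_adjoint A = A" and X: "X \<in> carrier_mat n n"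
  shows "(frob_norm (commutator A X))\<^sup>2 \<le> 2 * (frob_norm A)\<^sup>2 * (frob_norm X)\<^sup>2"
proof -
  obtain p \<eta> where p: "orthonormal_frame n UNIV p"
    and D: "conj_by (frame_mat n p) A = real_diag_mat n \<eta>"
    using hermitian_diagonalisation[OF A] .
  note U = frame_mat_unitary[OF p]
  let ?Y = "conj_by (frame_mat n p) X"
  have Y: "?Y \<in> carrier_mat n n" using unitary_group_carrier[OF U] X by simp
  let ?a = "\<Sum>i<n. (\<eta> i)\<^sup>2"
  have "(frob_norm (commutator A X))\<^sup>2 = (\<Sum>i<n. \<Sum>j<n. (\<eta> i - \<eta> j)\<^sup>2 * (norm (?Y $$ (i, j)))\<^sup>2)"
    unfolding conj_by_commutator_norm[OF U A(1) X, symmetric] D by (rule diagonal_commutator_norm[OF Y])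
  also have "\<dots> \<le> (\<Sum>i<n. \<Sum>j<n. (2 * ?a) * (norm (?Y $$ (i, j)))\<^sup>2)"
    by (intro sum_mono mult_right_mono pair_gap_le) auto
  also have "\<dots> = 2 * ?a * (frob_norm ?Y)\<^sup>2"
    unfolding frob_norm_sq_sum[OF Y] by (simp add: sum_distrib_left)
  also have "?a = (frob_norm A)\<^sup>2"
    unfolding conj_by_norm[OF U A(1), symmetric] D by (rule diagonal_commutator_norm(2)[OF Y, symmetric])
  also have "(frob_norm ?Y)\<^sup>2 = (frob_norm X)\<^sup>2" by (rule conj_by_norm[OF U X])
  finally show ?thesis .
qed

text \<open>Hermitian symmetry gains the factor \<open>1/2\<close>, as \<open>X\<^sub>j\<^sub>i\<close> contributes as much as \<open>X\<^sub>i\<^sub>j\<close>.\<close>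

lemma hermitian_bessel_functional:
  fixes X :: "nat \<Rightarrow> complex mat"
  assumes fin: "finite T" and X: "\<And>s. s \<in> T \<Longrightarrow> X s \<in> carrier_mat n n" "\<And>s. s \<in> T \<Longrightarrow> mat_adjoint (X s) = X s"
    and orth: "\<And>s t. s \<in> T \<Longrightarrow> t \<in> T \<Longrightarrow> s \<noteq> t \<Longrightarrow> Re (frob_inner (X s) (X t)) = 0"
    and nz: "\<And>s. s \<in> T \<Longrightarrow> frob_norm (X s) \<noteq> 0"
    and ij: "i < n" "j < n" "i \<noteq> j" and \<omega>: "norm \<omega> = 1"
  shows "(\<Sum>s\<in>T. (Re (\<omega> * X s $$ (i, j)))\<^sup>2 / (frob_norm (X s))\<^sup>2) \<le> 1/2"
proof -
  define c where "c s = Re (\<omega> * X s $$ (i, j))" for s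
  define U where "U = (\<Sum>s\<in>T. (c s)\<^sup>2 / (frob_norm (X s))\<^sup>2)"
  define d where "d s = c s / (frob_norm (X s))\<^sup>2" for s
  \<comment> \<open>\<open>Y\<close> represents the functional sending \<open>Z\<close> to
    \<open>Re (\<omega> * Z $$ (i, j))\<close> on the real span of the family: its squared norm and
    its value under the functional are both \<open>U\<close>.\<close>
  define Y where "Y = mat_sum n (\<lambda>s. of_real (d s) \<cdot>\<^sub>m X s) T"
  have Yc: "Y \<in> carrier_mat n n" by (simp add: Y_def)
  have sc: "of_real (d s) \<cdot>\<^sub>m X s \<in> carrier_mat n n" if "s \<in> T" for s using X(1)[OF that] by simp
  have Yi: "Y $$ (k, l) = (\<Sum>s\<in>T. of_real (d s) * X s $$ (k, l))" if "k < n" "l < n" for k l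
    using that X by (auto simp: Y_def intro!: sum.cong dest!: X(1))
  have "(frob_norm Y)\<^sup>2 = (\<Sum>s\<in>T. \<Sum>t\<in>T. d s * (d t * Re (frob_inner (X s) (X t))))"
  proof -
    have "frob_inner Y Y = (\<Sum>s\<in>T. frob_inner (of_real (d s) \<cdot>\<^sub>m X s) Y)"
      unfolding Y_def by (rule frob_inner_mat_sum_left) (use sc in auto)
    also have "\<dots> = (\<Sum>s\<in>T. \<Sum>t\<in>T. of_real (d s) * (of_real (d t) * frob_inner (X s) (X t)))"
    proof (intro sum.cong refl)
      fix s assume s: "s \<in> T"
      have "frob_inner (of_real (d s) \<cdot>\<^sub>m X s) Y = (\<Sum>t\<in>T. frob_inner (of_real (d s) \<cdot>\<^sub>m X s) (of_real (d t) \<cdot>\<^sub>m X t))"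
        unfolding Y_def by (rule frob_inner_mat_sum_right[OF sc sc[OF s]])
      also have "\<dots> = (\<Sum>t\<in>T. of_real (d s) * (of_real (d t) * frob_inner (X s) (X t)))"
        using X(1) s by (intro sum.cong refl) (simp add: frob_inner_smult_left frob_inner_smult_right[of _ n])
      finally show "frob_inner (of_real (d s) \<cdot>\<^sub>m X s) Y
        = (\<Sum>t\<in>T. of_real (d s) * (of_real (d t) * frob_inner (X s) (X t)))" .
    qed
    finally show ?thesis unfolding frob_norm_sq_inner by simp
  qed
  also have "\<dots> = (\<Sum>s\<in>T. \<Sum>t\<in>T. if t = s then (c s)\<^sup>2 / (frob_norm (X s))\<^sup>2 else 0)"
  proof (intro sum.cong refl)
    fix s t assume st: "s \<in> T" "t \<in> T"
    show "d s * (d t * Re (frob_inner (X s) (X t))) = (if t = s then (c s)\<^sup>2 / (frob_norm (X s))\<^sup>2 else 0)"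
    proof (cases "t = s")
      case True
      then show ?thesis using nz[OF st(1)]
        unfolding True frob_norm_sq_inner[symmetric] by (simp add: d_def power2_eq_square)
    next
      case False
      then show ?thesis using orth[OF st] by simp
    qed
  qed
  also have "\<dots> = U" unfolding U_def using fin by (simp add: sum.delta)
  finally have YU: "(frob_norm Y)\<^sup>2 = U" .
  have Yh: "Y $$ (j, i) = cnj (Y $$ (i, j))"
    using ij X by (simp add: Yi hermitian_index[of "X _" n i j])
  have "2 * (norm (Y $$ (i, j)))\<^sup>2 = (\<Sum>z\<in>{(i, j), (j, i)}. (norm (Y $$ z))\<^sup>2)"
    using ij Yh by simp
  also have "\<dots> \<le> (\<Sum>z\<in>{..<n} \<times> {..<n}. (norm (Y $$ z))\<^sup>2)"
    using ij by (intro sum_mono2) auto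
  also have "\<dots> = U"
    unfolding YU[symmetric] frob_norm_sq_sum[OF Yc] by (simp add: sum.cartesian_product)
  finally have le: "2 * (norm (Y $$ (i, j)))\<^sup>2 \<le> U" .
  have "Re (\<omega> * Y $$ (i, j)) = (\<Sum>s\<in>T. Re (\<omega> * (of_real (d s) * X s $$ (i, j))))"
    unfolding Yi[OF ij(1,2)] by (simp only: sum_distrib_left Re_sum)
  also have "\<dots> = (\<Sum>s\<in>T. d s * c s)"
    by (intro sum.cong refl) (simp add: c_def algebra_simps)
  also have "\<dots> = U" unfolding U_def d_def by (simp add: power2_eq_square)
  finally have "U \<le> norm (\<omega> * Y $$ (i, j))" by (metis complex_Re_le_cmod)
  then have "U \<le> norm (Y $$ (i, j))" using \<omega> by (simp add: norm_mult)
  moreover have U0: "0 \<le> U" unfolding U_def by (intro sum_nonneg) simp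
  \<comment> \<open>With \<open>y\<close> the modulus of the entry, \<open>U \<le> y\<close> and
    \<open>2 y^2 \<le> U\<close> leave only \<open>U \<le> 1/2\<close>.\<close>
  ultimately have "U\<^sup>2 \<le> (norm (Y $$ (i, j)))\<^sup>2" by (rule power_mono)
  then have "2 * U\<^sup>2 \<le> U" using le by linarith
  then have "U * (2 * U - 1) \<le> 0" by (simp add: power2_eq_square algebra_simps)
  then have "U \<le> 1/2" using U0 by (auto simp: mult_le_0_iff)
  then show ?thesis unfolding U_def c_def .
qed

text \<open>The squared modulus of \<open>z\<close> is the sum of the squares of \<open>Re z\<close>
  and \<open>Re (\<i> * z)\<close>; the phases 1 and \<open>\<i>\<close> contribute 1/2
  each.\<close>

lemma hermitian_bessel:
  fixes X :: "nat \<Rightarrow> complex mat"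
  assumes fin: "finite T" and X: "\<And>s. s \<in> T \<Longrightarrow> X s \<in> carrier_mat n n" "\<And>s. s \<in> T \<Longrightarrow> mat_adjoint (X s) = X s"
    and orth: "\<And>s t. s \<in> T \<Longrightarrow> t \<in> T \<Longrightarrow> s \<noteq> t \<Longrightarrow> Re (frob_inner (X s) (X t)) = 0"
    and nz: "\<And>s. s \<in> T \<Longrightarrow> frob_norm (X s) \<noteq> 0"
    and ij: "i < n" "j < n" "i \<noteq> j"
  shows "(\<Sum>s\<in>T. (norm (X s $$ (i, j)))\<^sup>2 / (frob_norm (X s))\<^sup>2) \<le> 1"
proof -
  note b = hermitian_bessel_functional[OF fin X orth nz ij]
  have "(\<Sum>s\<in>T. (norm (X s $$ (i, j)))\<^sup>2 / (frob_norm (X s))\<^sup>2)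
    = (\<Sum>s\<in>T. (Re (1 * X s $$ (i, j)))\<^sup>2 / (frob_norm (X s))\<^sup>2)
      + (\<Sum>s\<in>T. (Re (\<i> * X s $$ (i, j)))\<^sup>2 / (frob_norm (X s))\<^sup>2)"
    unfolding sum.distrib[symmetric] by (simp add: cmod_power2 add_divide_distrib)
  also have "\<dots> \<le> 1/2 + 1/2"
    using b[where \<omega> = 1] b[where \<omega> = \<i>] by (intro add_mono) auto
  finally show ?thesis by simp
qed

text \<open>In an eigenbasis of \<open>A\<close> the left side sums
  \<open>(\<eta> i - \<eta> j)^2 - a\<close> over all positions, weighted by the mass
  \<open>w i j\<close> that the normalised family puts there. As \<open>w i j \<le> 1\<close> off
  the diagonal, the positive parts give a bound independent of the size of \<open>T\<close>.\<close>

lemma orthogonal_family_commutator_bound: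
  fixes X :: "nat \<Rightarrow> complex mat"
  assumes fin: "finite T" and X: "\<And>s. s \<in> T \<Longrightarrow> X s \<in> carrier_mat n n" "\<And>s. s \<in> T \<Longrightarrow> mat_adjoint (X s) = X s"
    and orth: "\<And>s t. s \<in> T \<Longrightarrow> t \<in> T \<Longrightarrow> s \<noteq> t \<Longrightarrow> Re (frob_inner (X s) (X t)) = 0"
    and nz: "\<And>s. s \<in> T \<Longrightarrow> frob_norm (X s) \<noteq> 0"
    and A: "A \<in> carrier_mat n n" "mat_adjoint A = A"
  shows "(\<Sum>s\<in>T. (frob_norm (commutator A (X s)))\<^sup>2 / (frob_norm (X s))\<^sup>2 - (frob_norm A)\<^sup>2) \<le> 2 * (frob_norm A)\<^sup>2"
proof -
  obtain p \<eta> where p: "orthonormal_frame n UNIV p"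
    and D: "conj_by (frame_mat n p) A = real_diag_mat n \<eta>"
    using hermitian_diagonalisation[OF A] .
  note U = frame_mat_unitary[OF p]
  note P = unitary_group_carrier[OF U]
  define Y where "Y s = conj_by (frame_mat n p) (X s)" for s
  have Y: "Y s \<in> carrier_mat n n" "mat_adjoint (Y s) = Y s" if "s \<in> T" for s
    unfolding Y_def using X[OF that] P by (auto intro: conj_by_hermitian)
  have nY: "(frob_norm (Y s))\<^sup>2 = (frob_norm (X s))\<^sup>2" if "s \<in> T" for s
    unfolding Y_def by (rule conj_by_norm[OF U X(1)[OF that]])
  define a where "a = (\<Sum>i<n. (\<eta> i)\<^sup>2)"
  define w where "w i j = (\<Sum>s\<in>T. (norm (Y s $$ (i, j)))\<^sup>2 / (frob_norm (Y s))\<^sup>2)" for i j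
  have a: "(frob_norm A)\<^sup>2 = a"
    unfolding conj_by_norm[OF U A(1), symmetric] D a_def by (rule diagonal_commutator_norm(2)[OF P])
  have a0: "0 \<le> a" by (simp add: a_def sum_nonneg)
  have w0: "0 \<le> w i j" for i j unfolding w_def by (intro sum_nonneg) simp
  have w1: "w i j \<le> 1" if "i < n" "j < n" "i \<noteq> j" for i j
    unfolding w_def
  proof (rule hermitian_bessel[OF fin Y _ _ that])
    show "Re (frob_inner (Y s) (Y t)) = 0" if "s \<in> T" "t \<in> T" "s \<noteq> t" for s t
      unfolding Y_def conj_by_inner[OF U X(1)[OF that(1)] X(1)[OF that(2)]] by (rule orth[OF that])
    show "frob_norm (Y s) \<noteq> 0" if "s \<in> T" for s using nY[OF that] nz[OF that] by auto
  qed
  have sw: "(\<Sum>i<n. \<Sum>j<n. g i j * w i j)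
    = (\<Sum>s\<in>T. (\<Sum>i<n. \<Sum>j<n. g i j * (norm (Y s $$ (i, j)))\<^sup>2) / (frob_norm (Y s))\<^sup>2)" for g :: "nat \<Rightarrow> nat \<Rightarrow> real"
  proof -
    have "(\<Sum>i<n. \<Sum>j<n. g i j * w i j)
      = (\<Sum>i<n. \<Sum>j<n. \<Sum>s\<in>T. g i j * (norm (Y s $$ (i, j)))\<^sup>2 / (frob_norm (Y s))\<^sup>2)"
      by (simp add: w_def sum_distrib_left)
    also have "\<dots> = (\<Sum>i<n. \<Sum>s\<in>T. \<Sum>j<n. g i j * (norm (Y s $$ (i, j)))\<^sup>2 / (frob_norm (Y s))\<^sup>2)"
      by (intro sum.cong refl sum.swap)
    also have "\<dots> = (\<Sum>s\<in>T. \<Sum>i<n. \<Sum>j<n. g i j * (norm (Y s $$ (i, j)))\<^sup>2 / (frob_norm (Y s))\<^sup>2)"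
      by (rule sum.swap)
    finally show ?thesis by (simp add: sum_divide_distrib)
  qed
  have "(\<Sum>s\<in>T. (frob_norm (commutator A (X s)))\<^sup>2 / (frob_norm (X s))\<^sup>2 - (frob_norm A)\<^sup>2)
    = (\<Sum>s\<in>T. (\<Sum>i<n. \<Sum>j<n. ((\<eta> i - \<eta> j)\<^sup>2 - a) * (norm (Y s $$ (i, j)))\<^sup>2) / (frob_norm (Y s))\<^sup>2)"
  proof (intro sum.cong refl)
    fix s assume s: "s \<in> T"
    have 1: "(frob_norm (commutator A (X s)))\<^sup>2 = (\<Sum>i<n. \<Sum>j<n. (\<eta> i - \<eta> j)\<^sup>2 * (norm (Y s $$ (i, j)))\<^sup>2)"
      unfolding conj_by_commutator_norm[OF U A(1) X(1)[OF s], symmetric] D Y_def[symmetric]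
      by (rule diagonal_commutator_norm[OF Y(1)[OF s]])
    have "(\<Sum>i<n. \<Sum>j<n. ((\<eta> i - \<eta> j)\<^sup>2 - a) * (norm (Y s $$ (i, j)))\<^sup>2)
      = (frob_norm (commutator A (X s)))\<^sup>2 - a * (frob_norm (Y s))\<^sup>2"
      unfolding 1 frob_norm_sq_sum[OF Y(1)[OF s]] by (simp add: left_diff_distrib sum_subtractf sum_distrib_left)
    then show "(frob_norm (commutator A (X s)))\<^sup>2 / (frob_norm (X s))\<^sup>2 - (frob_norm A)\<^sup>2
      = (\<Sum>i<n. \<Sum>j<n. ((\<eta> i - \<eta> j)\<^sup>2 - a) * (norm (Y s $$ (i, j)))\<^sup>2) / (frob_norm (Y s))\<^sup>2"
      using nz[OF s] by (simp add: nY[OF s] a diff_divide_distrib)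
  qed
  also have "\<dots> = (\<Sum>i<n. \<Sum>j<n. ((\<eta> i - \<eta> j)\<^sup>2 - a) * w i j)" by (rule sw[symmetric])
  also have "\<dots> \<le> (\<Sum>i<n. \<Sum>j<n. max 0 ((\<eta> i - \<eta> j)\<^sup>2 - a))"
  proof (intro sum_mono)
    fix i j assume "i \<in> {..<n}" "j \<in> {..<n}"
    then have ij: "i < n" "j < n" by auto
    show "((\<eta> i - \<eta> j)\<^sup>2 - a) * w i j \<le> max 0 ((\<eta> i - \<eta> j)\<^sup>2 - a)"
    \<comment> \<open>Bessel's inequality is available off the diagonal; on the diagonal the gap is
      0 and the coefficient \<open>- a\<close> is nonpositive.\<close>
    proof (cases "i \<noteq> j \<and> (\<eta> i - \<eta> j)\<^sup>2 - a \<ge> 0")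
      case True
      then have "((\<eta> i - \<eta> j)\<^sup>2 - a) * w i j \<le> ((\<eta> i - \<eta> j)\<^sup>2 - a) * 1"
        using w1[OF ij] by (intro mult_left_mono) auto
      then show ?thesis by simp
    next
      case False
      then have "(\<eta> i - \<eta> j)\<^sup>2 - a \<le> 0" using a0 by auto
      then have "((\<eta> i - \<eta> j)\<^sup>2 - a) * w i j \<le> 0" using w0[of i j] by (rule mult_nonpos_nonneg)
      then show ?thesis by simp
    qed
  qed
  also have "\<dots> \<le> 2 * a" unfolding a_def by (rule excess_gap_sum)
  finally show ?thesis unfolding a .
qed

section \<open>The inequality for Hermitian matrices\<close>

text \<open>A small linear program: with \<open>\<sigma>\<close> at most \<open>a\<close> on the
  largest weight and at most \<open>2 a\<close> on every subset, the optimum puts \<open>a\<close>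
  on each of the two largest weights. In the proof negative terms are dropped and the weights other
  than \<open>b p\<close> are raised to \<open>b q\<close>.\<close>

lemma top_two_weighted_sum:
  fixes b \<sigma> :: "nat \<Rightarrow> real"
  assumes fin: "finite I" and pq: "p \<in> I" "q \<in> I" "p \<noteq> q"
    and b: "\<And>s. s \<in> I \<Longrightarrow> 0 \<le> b s" "b q \<le> b p" "\<And>s. s \<in> I \<Longrightarrow> s \<noteq> p \<Longrightarrow> b s \<le> b q"
    and \<sigma>: "\<sigma> p \<le> a" "\<And>T. T \<subseteq> I \<Longrightarrow> sum \<sigma> T \<le> 2 * a"
  shows "(\<Sum>s\<in>I. b s * \<sigma> s) \<le> a * (b p + b q)"
proof -
  define J where "J = {s \<in> I - {p}. 0 < \<sigma> s}"
  have J: "finite J" "p \<notin> J" "insert p J \<subseteq> I" using fin pq by (auto simp: J_def)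
  have "(\<Sum>s\<in>I. b s * \<sigma> s) = b p * \<sigma> p + (\<Sum>s\<in>I - {p}. b s * \<sigma> s)"
    using fin pq by (simp add: sum.remove)
  also have "(\<Sum>s\<in>I - {p}. b s * \<sigma> s) \<le> (\<Sum>s\<in>I - {p}. if 0 < \<sigma> s then b q * \<sigma> s else 0)"
    using b by (intro sum_mono) (auto intro: mult_right_mono mult_nonneg_nonpos)
  also have "\<dots> = (\<Sum>s\<in>J. b q * \<sigma> s)"
    unfolding J_def using fin by (intro sum.inter_filter[symmetric]) simp
  also have "\<dots> = b q * sum \<sigma> J" by (simp add: sum_distrib_left)
  also have "\<dots> \<le> b q * (2 * a - \<sigma> p)"
  proof (rule mult_left_mono)
    show "sum \<sigma> J \<le> 2 * a - \<sigma> p" using \<sigma>(2)[OF J(3)] J by simp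
  qed (use b pq in auto)
  finally have "(\<Sum>s\<in>I. b s * \<sigma> s) \<le> (b p - b q) * \<sigma> p + 2 * a * b q"
    by (simp add: algebra_simps)
  also have "\<dots> \<le> (b p - b q) * a + 2 * a * b q"
    using b(2) \<sigma>(1) by (simp add: mult_left_mono)
  finally show ?thesis by (simp add: algebra_simps)
qed

text \<open>\<open>x\<close>, \<open>y\<close>, \<open>z\<close> stand for the three largest squared
  norms and \<open>t\<close> for the sum of the rest; each bracket is a row bound, with the two
  largest partners counted again. The squares on the right vanish together exactly for
  \<open>x = y = z\<close> and \<open>t = 0\<close>.\<close>

lemma ddvv_quadratic_identity:
  fixes x y z t :: real
  shows "4 * (x + y + z + t)\<^sup>2 - 3 * (x * (y + z + t + y + z) + y * (x + z + t + x + z) + z * (x + y + t + x + y)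
      + t * (x + y + z + t + x + y))
    = 3 * (x - y)\<^sup>2 + (x + y - 2 * z - t / 2)\<^sup>2 + 3 / 4 * t\<^sup>2"
  by (simp add: power2_eq_square field_simps)

lemma sum_split_three:
  fixes f :: "nat \<Rightarrow> 'a::comm_monoid_add"
  assumes "3 \<le> M"
  shows "sum f {..<M} = f 0 + f 1 + f 2 + sum f {3..<M}"
proof -
  have "{..<M} = {0, 1, 2} \<union> {3..<M}" using assms by auto
  then have "sum f {..<M} = sum f {0, 1, 2} + sum f {3..<M}"
    by (simp only:) (rule sum.union_disjoint, auto)
  then show ?thesis by (simp add: add.assoc)
qed

context
  fixes C :: "nat \<Rightarrow> complex mat" and n M :: nat
  assumes M: "3 \<le> M"
    and C: "\<And>l. l < M \<Longrightarrow> C l \<in> carrier_mat n n" "\<And>l. l < M \<Longrightarrow> mat_adjoint (C l) = C l"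
    and orth: "\<And>l l'. l < M \<Longrightarrow> l' < M \<Longrightarrow> l \<noteq> l' \<Longrightarrow> Re (frob_inner (C l) (C l')) = 0"
    and sorted: "\<And>l l'. l \<le> l' \<Longrightarrow> l' < M \<Longrightarrow> (frob_norm (C l'))\<^sup>2 \<le> (frob_norm (C l))\<^sup>2"
begin

text \<open>\<open>p < q\<close> are the two smallest indices other than \<open>r\<close>, hence the
  positions of the two largest remaining norms.\<close>

lemma sorted_row_bound:
  assumes r: "r < M" and pq: "p < M" "q < M" "p \<noteq> r" "q \<noteq> r" "p < q"
    and top: "\<And>s. s < M \<Longrightarrow> s \<noteq> r \<Longrightarrow> s \<noteq> p \<Longrightarrow> q \<le> s"
  shows "(\<Sum>s<M. (frob_norm (commutator (C r) (C s)))\<^sup>2)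
    \<le> (frob_norm (C r))\<^sup>2 * ((\<Sum>s\<in>{..<M} - {r}. (frob_norm (C s))\<^sup>2) + (frob_norm (C p))\<^sup>2 + (frob_norm (C q))\<^sup>2)"
proof -
  define I where "I = {..<M} - {r}"
  define b where "b s = (frob_norm (C s))\<^sup>2" for s
  define f where "f s = (frob_norm (commutator (C r) (C s)))\<^sup>2" for s
  \<comment> \<open>The commutator normalised by \<open>b s\<close>, in excess of
    \<open>b r\<close>. Vanishing members get 0 and stay out of the family bound; \<open>bs\<close>
    remains true for them because \<open>f s\<close> vanishes too.\<close>
  define \<sigma> where "\<sigma> s = (if b s = 0 then 0 else f s / b s - b r)" for s
  have b0: "0 \<le> b s" for s by (simp add: b_def)
  have f2: "f s \<le> 2 * b r * b s" if "s < M" for s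
    unfolding f_def b_def by (rule hermitian_commutator_bound[OF C(1)[OF r] C(2)[OF r] C(1)[OF that]])
  have bs: "b s * \<sigma> s = f s - b r * b s" if "s < M" for s
  proof (cases "b s = 0")
    case True
    moreover have "0 \<le> f s" by (simp add: f_def)
    ultimately show ?thesis using f2[OF that] by (simp add: \<sigma>_def)
  next
    case False
    then show ?thesis by (simp add: \<sigma>_def right_diff_distrib)
  qed
  have \<sigma>1: "\<sigma> s \<le> b r" if "s < M" for s
  proof (cases "b s = 0")
    case False
    then have "b s > 0" using b0[of s] by simp
    then show ?thesis using f2[OF that] False by (simp add: \<sigma>_def divide_le_eq)
  qed (simp add: \<sigma>_def b0)
  have \<sigma>2: "sum \<sigma> T \<le> 2 * b r" if T: "T \<subseteq> I" for T
  proof -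
    define T' where "T' = {s \<in> T. b s \<noteq> 0}"
    have fin: "finite T" using T by (auto simp: I_def intro: finite_subset)
    have T': "finite T'" "\<And>s. s \<in> T' \<Longrightarrow> s < M" "\<And>s. s \<in> T' \<Longrightarrow> frob_norm (C s) \<noteq> 0"
      using fin T by (auto simp: T'_def I_def b_def)
    have "sum \<sigma> T = (\<Sum>s\<in>T'. f s / b s - b r)"
      unfolding T'_def \<sigma>_def using fin by (intro sum.mono_neutral_cong_right) auto
    also have "\<dots> \<le> 2 * b r"
      unfolding f_def b_def
      by (rule orthogonal_family_commutator_bound[OF T'(1)]) (use T' C r orth in auto)
    finally show ?thesis .
  qed
  have "(\<Sum>s\<in>I. b s * \<sigma> s) \<le> b r * (b p + b q)"
  proof (rule top_two_weighted_sum)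
    show "finite I" "p \<in> I" "q \<in> I" "p \<noteq> q" using pq by (auto simp: I_def)
    show "b q \<le> b p" unfolding b_def using pq by (intro sorted) auto
    show "b s \<le> b q" if "s \<in> I" "s \<noteq> p" for s
      unfolding b_def using that top by (intro sorted) (auto simp: I_def)
  qed (use b0 \<sigma>1 \<sigma>2 pq in auto)
  also have "(\<Sum>s\<in>I. b s * \<sigma> s) = (\<Sum>s\<in>I. f s) - b r * (\<Sum>s\<in>I. b s)"
    using bs by (simp add: I_def sum_subtractf sum_distrib_left)
  also have "(\<Sum>s\<in>I. f s) = (\<Sum>s<M. f s)"
  proof -
    have "f r \<le> 0"
      unfolding f_def commutator_def using C(1)[OF r] by (simp add: frob_norm_def)
    then have "f r = 0" by (simp add: f_def)
    then show ?thesis using r by (simp add: I_def sum.remove[of "{..<M}" r])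
  qed
  finally show ?thesis unfolding f_def b_def I_def by (simp add: algebra_simps)
qed

text \<open>The squares are kept on the left, so that the inequality and its equality case both
  follow from this one estimate.\<close>

lemma sorted_defect_bound:
  defines "b \<equiv> \<lambda>l. (frob_norm (C l))\<^sup>2"
  defines "t \<equiv> \<Sum>l = 3..<M. b l"
  shows "3 * commutator_sum M C + (3 * (b 0 - b 1)\<^sup>2 + (b 0 + b 1 - 2 * b 2 - t / 2)\<^sup>2 + 3 / 4 * t\<^sup>2)
    \<le> 4 * (\<Sum>l<M. b l)\<^sup>2"
proof -
  define F where "F r = (\<Sum>s<M. (frob_norm (commutator (C r) (C s)))\<^sup>2)" for r
  have S: "(\<Sum>l<M. b l) = b 0 + b 1 + b 2 + t" unfolding t_def by (rule sum_split_three[OF M])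
  have rest: "(\<Sum>s\<in>{..<M} - {r}. b s) = (\<Sum>l<M. b l) - b r" if "r < M" for r
    using that by (simp add: sum_diff1)
  have row: "F r \<le> b r * ((\<Sum>l<M. b l) - b r + b p + b q)"
    if "r < M" "p < M" "q < M" "p \<noteq> r" "q \<noteq> r" "p < q"
      "\<And>s. s < M \<Longrightarrow> s \<noteq> r \<Longrightarrow> s \<noteq> p \<Longrightarrow> q \<le> s" for r p q
    using sorted_row_bound[OF that] rest[OF that(1)] unfolding F_def b_def by simp
  have "F 0 \<le> b 0 * ((\<Sum>l<M. b l) - b 0 + b 1 + b 2)"
    by (rule row) (use M in auto)
  moreover have "F 1 \<le> b 1 * ((\<Sum>l<M. b l) - b 1 + b 0 + b 2)"
    by (rule row) (use M in auto)
  moreover have "F 2 \<le> b 2 * ((\<Sum>l<M. b l) - b 2 + b 0 + b 1)"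
    by (rule row) (use M in auto)
  moreover have "(\<Sum>r = 3..<M. F r) \<le> (\<Sum>r = 3..<M. b r * ((\<Sum>l<M. b l) + b 0 + b 1))"
  proof (rule sum_mono)
    fix r assume "r \<in> {3..<M}"
    then have r: "3 \<le> r" "r < M" by auto
    have "F r \<le> b r * ((\<Sum>l<M. b l) - b r + b 0 + b 1)"
      by (rule row) (use r in auto)
    \<comment> \<open>The row's own term \<open>- b r\<close> is given up, so that the tail enters
      only through its sum \<open>t\<close>.\<close>
    also have "\<dots> \<le> b r * ((\<Sum>l<M. b l) + b 0 + b 1)"
      by (intro mult_left_mono) (auto simp: b_def)
    finally show "F r \<le> b r * ((\<Sum>l<M. b l) + b 0 + b 1)" .
  qed
  then have "(\<Sum>r = 3..<M. F r) \<le> t * ((\<Sum>l<M. b l) + b 0 + b 1)"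
    by (simp add: t_def sum_distrib_right)
  moreover have "commutator_sum M C = F 0 + F 1 + F 2 + (\<Sum>r = 3..<M. F r)"
    unfolding commutator_sum_def F_def by (rule sum_split_three[OF M])
  ultimately have "commutator_sum M C \<le> b 0 * (b 1 + b 2 + t + b 1 + b 2) + b 1 * (b 0 + b 2 + t + b 0 + b 2)
      + b 2 * (b 0 + b 1 + t + b 0 + b 1) + t * (b 0 + b 1 + b 2 + t + b 0 + b 1)"
    unfolding S by (simp add: algebra_simps)
  moreover have "3 * x + D \<le> 4 * s" if "x \<le> Q" "4 * s - 3 * Q = D" for x Q s D :: real
    using that by linarith
  ultimately show ?thesis
    unfolding S using ddvv_quadratic_identity[of "b 0" "b 1" "b 2" t] by blast
qed

lemma sorted_bound:
  "commutator_sum M C \<le> 4/3 * (\<Sum>l<M. (frob_norm (C l))\<^sup>2)\<^sup>2"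
proof -
  have "0 \<le> 3 * ((frob_norm (C 0))\<^sup>2 - (frob_norm (C 1))\<^sup>2)\<^sup>2
      + ((frob_norm (C 0))\<^sup>2 + (frob_norm (C 1))\<^sup>2 - 2 * (frob_norm (C 2))\<^sup>2 - (\<Sum>l = 3..<M. (frob_norm (C l))\<^sup>2) / 2)\<^sup>2
      + 3 / 4 * (\<Sum>l = 3..<M. (frob_norm (C l))\<^sup>2)\<^sup>2"
    by (intro add_nonneg_nonneg) auto
  then show ?thesis using sorted_defect_bound by linarith
qed

lemma sorted_equality:
  assumes eq: "commutator_sum M C = 4/3 * (\<Sum>l<M. (frob_norm (C l))\<^sup>2)\<^sup>2"
  defines "\<beta> \<equiv> (frob_norm (C 0))\<^sup>2"
  shows "(frob_norm (C 1))\<^sup>2 = \<beta>" "(frob_norm (C 2))\<^sup>2 = \<beta>" "\<And>l. 3 \<le> l \<Longrightarrow> l < M \<Longrightarrow> C l = 0\<^sub>m n n"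
    "(frob_norm (commutator (C 0) (C 1)))\<^sup>2 = 2 * \<beta>\<^sup>2" "(frob_norm (commutator (C 0) (C 2)))\<^sup>2 = 2 * \<beta>\<^sup>2"
proof -
  define b where "b l = (frob_norm (C l))\<^sup>2" for l
  define f where "f r s = (frob_norm (commutator (C r) (C s)))\<^sup>2" for r s
  define t where "t = (\<Sum>l = 3..<M. b l)"
  have le0: "3 * (b 0 - b 1)\<^sup>2 + (b 0 + b 1 - 2 * b 2 - t / 2)\<^sup>2 + 3 / 4 * t\<^sup>2 \<le> 0"
    using sorted_defect_bound eq unfolding b_def t_def by linarith
  have "t\<^sup>2 \<le> 0" "(b 0 - b 1)\<^sup>2 \<le> 0" "(b 0 + b 1 - 2 * b 2 - t / 2)\<^sup>2 \<le> 0"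
    using le0 zero_le_power2[of t] zero_le_power2[of "b 0 - b 1"] zero_le_power2[of "b 0 + b 1 - 2 * b 2 - t / 2"]
    by linarith+
  then have t: "t = 0" and b1: "b 1 = b 0" and b2: "b 2 = b 0" by auto
  show "(frob_norm (C 1))\<^sup>2 = \<beta>" "(frob_norm (C 2))\<^sup>2 = \<beta>"
    using b1 b2 unfolding b_def \<beta>_def by auto
  have bz: "b l = 0" if "3 \<le> l" "l < M" for l
    using t that unfolding t_def by (subst (asm) sum_nonneg_eq_0_iff) (auto simp: b_def)
  show Cz: "C l = 0\<^sub>m n n" if "3 \<le> l" "l < M" for l
    using bz[OF that] frob_norm_eq_0_iff[OF C(1)[OF that(2)]] by (simp add: b_def)
  have f_le: "f r s \<le> 2 * b r * b s" if "r < M" "s < M" for r s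
    unfolding f_def b_def by (rule hermitian_commutator_bound) (use C that in auto)
  have f0: "0 \<le> f r s" for r s by (simp add: f_def)
  have fz: "f r s = 0" if "r < M" "s < M" "3 \<le> r \<or> 3 \<le> s" for r s
    using f_le[OF that(1,2)] f0[of r s] bz that by (auto intro: antisym)
  have fd: "f r r = 0" if "r < M" for r
    unfolding f_def commutator_def using C(1)[OF that] by (simp add: frob_norm_def)
  have fs: "f r s = f s r" if "r < M" "s < M" for r s
    unfolding f_def using frob_norm_commutator_swap[OF C(1)[OF that(1)] C(1)[OF that(2)]] by simp
  have F: "(\<Sum>s<M. f r s) = f r 0 + f r 1 + f r 2" if "r < M" for r
    using fz[OF that] by (simp add: sum_split_three[OF M])
  have "commutator_sum M C = (\<Sum>s<M. f 0 s) + (\<Sum>s<M. f 1 s) + (\<Sum>s<M. f 2 s) + (\<Sum>r = 3..<M. \<Sum>s<M. f r s)"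
    unfolding commutator_sum_def f_def by (rule sum_split_three[OF M])
  also have "(\<Sum>r = 3..<M. \<Sum>s<M. f r s) = 0"
    by (intro sum.neutral ballI) (simp add: fz)
  finally have "commutator_sum M C = 2 * f 0 1 + 2 * f 0 2 + 2 * f 1 2"
    using M F[of 0] F[of 1] F[of 2] fd[of 0] fd[of 1] fd[of 2] fs[of 1 0] fs[of 2 0] fs[of 2 1] by simp
  moreover have "(\<Sum>l<M. b l) = 3 * b 0"
    unfolding sum_split_three[OF M] using t b1 b2 by (simp add: t_def)
  then have "4/3 * (\<Sum>l<M. (frob_norm (C l))\<^sup>2)\<^sup>2 = 12 * (b 0)\<^sup>2"
    unfolding b_def by (simp add: power_mult_distrib)
  ultimately have "2 * f 0 1 + 2 * f 0 2 + 2 * f 1 2 = 12 * (b 0)\<^sup>2" using eq by simp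
  \<comment> \<open>Three unordered pairs, each at most \<open>2 (b 0)^2\<close>, have to total
    \<open>6 (b 0)^2\<close>, so every bound is attained.\<close>
  moreover have "f 0 1 \<le> 2 * (b 0)\<^sup>2" "f 0 2 \<le> 2 * (b 0)\<^sup>2" "f 1 2 \<le> 2 * (b 0)\<^sup>2"
    using M f_le[of 0 1] f_le[of 0 2] f_le[of 1 2] by (simp_all add: b1[simplified] b2 power2_eq_square mult.assoc)
  ultimately have "f 0 1 = 2 * (b 0)\<^sup>2" "f 0 2 = 2 * (b 0)\<^sup>2" by linarith+
  then show "(frob_norm (commutator (C 0) (C 1)))\<^sup>2 = 2 * \<beta>\<^sup>2" "(frob_norm (commutator (C 0) (C 2)))\<^sup>2 = 2 * \<beta>\<^sup>2"
    unfolding f_def b_def \<beta>_def by auto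
qed

end

section \<open>The equality case for Hermitian matrices\<close>

lemma diag_pad_carrier:
  assumes "2 \<le> n" "H \<in> carrier_mat 2 2"
  shows "diag_pad n H \<in> carrier_mat n n"
  using assms by (auto simp: diag_pad_def)

lemma diag_pad_index:
  assumes "2 \<le> n" "H \<in> carrier_mat 2 2" "i < n" "j < n"
  shows "diag_pad n H $$ (i, j) = (if i < 2 \<and> j < 2 then H $$ (i, j) else 0)"
  using assms by (auto simp: diag_pad_def)

lemma pauli_carrier: "H1 l \<in> carrier_mat 2 2" "H2 l \<in> carrier_mat 2 2" "H3 l \<in> carrier_mat 2 2"
  by (auto simp: H1_def H2_def H3_def mat_of_rows_list_def)

lemma H1_index: "i < 2 \<Longrightarrow> j < 2 \<Longrightarrow>
    H1 l $$ (i, j) = (if i = j then (if i = 0 then of_real l else - of_real l) else 0)"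
  and H2_index: "i < 2 \<Longrightarrow> j < 2 \<Longrightarrow> H2 l $$ (i, j) = (if i = j then 0 else of_real l)"
  and H3_index: "i < 2 \<Longrightarrow> j < 2 \<Longrightarrow>
    H3 l $$ (i, j) = (if i = j then 0 else if i = 0 then - of_real l * \<i> else of_real l * \<i>)"
  by (auto simp: H1_def H2_def H3_def mat_of_rows_list_def less_2_cases_iff)

lemma sum_two_point_support:
  fixes g :: "nat \<Rightarrow> nat \<Rightarrow> 'a::comm_monoid_add"
  assumes "i < n" "j < n" "i \<noteq> j"
    and "\<And>k l. k < n \<Longrightarrow> l < n \<Longrightarrow> (k, l) \<noteq> (i, j) \<Longrightarrow> (k, l) \<noteq> (j, i) \<Longrightarrow> g k l = 0"
  shows "(\<Sum>k<n. \<Sum>l<n. g k l) = g i j + g j i"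
proof -
  have "(\<Sum>k<n. \<Sum>l<n. g k l) = (\<Sum>z\<in>{..<n} \<times> {..<n}. g (fst z) (snd z))"
    by (simp add: sum.cartesian_product case_prod_beta)
  also have "\<dots> = (\<Sum>z\<in>{(i, j), (j, i)}. g (fst z) (snd z))"
  proof (rule sum.mono_neutral_right)
    show "\<forall>z\<in>{..<n} \<times> {..<n} - {(i, j), (j, i)}. g (fst z) (snd z) = 0"
    proof
      fix z assume "z \<in> {..<n} \<times> {..<n} - {(i, j), (j, i)}"
      then show "g (fst z) (snd z) = 0" using assms(4)[of "fst z" "snd z"] by (cases z) auto
    qed
  qed (use assms(1,2) in auto)
  finally show ?thesis using assms by simp
qed

text \<open>Writing \<open>x\<close> and \<open>y\<close> for the two eigenvalues, both steps of
  \<open>(x - y)^2 \<le> 2 x^2 + 2 y^2 \<le> 2 a\<close> are tight: the first loses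
  \<open>(x + y)^2\<close>, the second twice the squares of all other eigenvalues.\<close>

lemma extremal_gap:
  fixes \<eta> :: "nat \<Rightarrow> real"
  assumes ij: "i < n" "j < n" and gap: "(\<eta> i - \<eta> j)\<^sup>2 = 2 * (\<Sum>k<n. (\<eta> k)\<^sup>2)"
    and pos: "0 < (\<Sum>k<n. (\<eta> k)\<^sup>2)"
  shows "i \<noteq> j" "\<eta> j = - \<eta> i" "2 * (\<eta> i)\<^sup>2 = (\<Sum>k<n. (\<eta> k)\<^sup>2)"
    "\<And>k. k < n \<Longrightarrow> k \<noteq> i \<Longrightarrow> k \<noteq> j \<Longrightarrow> \<eta> k = 0"
proof -
  let ?a = "\<Sum>k<n. (\<eta> k)\<^sup>2"
  show ne: "i \<noteq> j" using gap pos by auto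
  have split: "?a = (\<eta> i)\<^sup>2 + (\<eta> j)\<^sup>2 + (\<Sum>k\<in>{..<n} - {i, j}. (\<eta> k)\<^sup>2)"
    using ij ne by (subst sum.subset_diff[of "{i, j}"]) auto
  have r: "0 \<le> (\<Sum>k\<in>{..<n} - {i, j}. (\<eta> k)\<^sup>2)" by (intro sum_nonneg) simp
  have "(\<eta> i - \<eta> j)\<^sup>2 = 2 * (\<eta> i)\<^sup>2 + 2 * (\<eta> j)\<^sup>2 - (\<eta> i + \<eta> j)\<^sup>2"
    by (simp add: power2_sum power2_diff)
  then have z: "(\<eta> i + \<eta> j)\<^sup>2 \<le> 0" "(\<Sum>k\<in>{..<n} - {i, j}. (\<eta> k)\<^sup>2) = 0"
    using gap split r zero_le_power2[of "\<eta> i + \<eta> j"] by linarith+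
  then have "\<eta> i + \<eta> j = 0" by simp
  then show o: "\<eta> j = - \<eta> i" by simp
  show "2 * (\<eta> i)\<^sup>2 = ?a" using split z(2) o by simp
  show "\<eta> k = 0" if "k < n" "k \<noteq> i" "k \<noteq> j" for k
    using z(2) that by (subst (asm) sum_nonneg_eq_0_iff) auto
qed

text \<open>The defect is a sum of squared entries with nonnegative weights
  \<open>2 a - (\<eta> k - \<eta> l)^2\<close>; if it is 0, the weight vanishes wherever the entry
  does not.\<close>

lemma commutator_extremal_support:
  fixes X :: "complex mat" and \<eta> :: "nat \<Rightarrow> real" and n :: nat
  defines "D \<equiv> real_diag_mat n \<eta>"
  defines "a \<equiv> \<Sum>k<n. (\<eta> k)\<^sup>2"
  assumes X: "X \<in> carrier_mat n n"
    and eq: "(frob_norm (commutator D X))\<^sup>2 = 2 * a * (frob_norm X)\<^sup>2"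
    and kl: "k < n" "l < n" "X $$ (k, l) \<noteq> 0"
  shows "(\<eta> k - \<eta> l)\<^sup>2 = 2 * a"
proof -
  have nn: "0 \<le> (2 * a - (\<eta> i - \<eta> j)\<^sup>2) * (norm (X $$ (i, j)))\<^sup>2" if "i < n" "j < n" for i j
    using pair_gap_le[OF that, of \<eta>] by (simp add: a_def)
  have total: "(\<Sum>i<n. \<Sum>j<n. (2 * a - (\<eta> i - \<eta> j)\<^sup>2) * (norm (X $$ (i, j)))\<^sup>2) = 0"
    using eq unfolding D_def diagonal_commutator_norm(1)[OF X] frob_norm_sq_sum[OF X]
    by (simp add: left_diff_distrib sum_subtractf sum_distrib_left)
  have row: "(\<Sum>j<n. (2 * a - (\<eta> k - \<eta> j)\<^sup>2) * (norm (X $$ (k, j)))\<^sup>2) = 0"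
    by (rule sum_nonneg_0[OF _ _ total]) (use nn kl in \<open>auto intro!: sum_nonneg simp del: zero_le_mult_iff\<close>)
  have "(2 * a - (\<eta> k - \<eta> l)\<^sup>2) * (norm (X $$ (k, l)))\<^sup>2 = 0"
    by (rule sum_nonneg_0[OF _ _ row]) (use nn kl in auto)
  then show ?thesis using kl by auto
qed

text \<open>The permutation moves the two active eigenvectors to the front; a phase then makes the
  surviving entry of \<open>X\<close> real.\<close>

lemma rearranged_frame:
  assumes p: "orthonormal_frame n UNIV p" and \<tau>: "bij_betw \<tau> {..<n} {..<n}"
    and \<phi>: "\<And>k. norm (\<phi> k) = 1"
  shows "orthonormal_frame n UNIV (\<lambda>k a. \<phi> k * p (\<tau> k) a)"
  unfolding orthonormal_frame_iff_herm_form
proof (intro conjI allI impI)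
  fix k l assume kl: "k < n" "l < n"
  let ?e = "herm_form n (\<lambda>a b. if a = b then 1 else 0)"
  have t: "\<tau> k < n" "\<tau> l < n" "\<tau> k = \<tau> l \<longleftrightarrow> k = l"
    using \<tau> kl by (auto simp: bij_betw_def inj_on_def)
  have "?e (p (\<tau> k)) (p (\<tau> l)) = (if k = l then 1 else 0)"
    using p t unfolding orthonormal_frame_iff_herm_form by simp
  moreover have "cnj (\<phi> l) * \<phi> l = 1"
    using complex_norm_square[of "\<phi> l"] \<phi>[of l] by (simp add: mult.commute)
  ultimately show "?e (\<lambda>a. \<phi> k * p (\<tau> k) a) (\<lambda>a. \<phi> l * p (\<tau> l) a) = (if k = l then 1 else 0)"
    by (simp add: herm_form_scale_left herm_form_scale_right mult.assoc)
qed auto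

lemma permutation_to_front:
  fixes i j n :: nat
  assumes "i < n" "j < n" "i \<noteq> j"
  obtains \<tau> where "bij_betw \<tau> {..<n} {..<n}" "\<tau> 0 = i" "\<tau> (Suc 0) = j"
proof -
  have n: "2 \<le> n" using assms by auto
  let ?s = "Transposition.transpose 0 i"
  \<comment> \<open>The first transposition moves \<open>j\<close> when \<open>j = 0\<close>. Hence
    \<open>Suc 0\<close> is sent to \<open>?s j\<close>, which \<open>?s\<close> takes back to
    \<open>j\<close>.\<close>
  let ?j = "?s j"
  have j: "?j < n" "?j \<noteq> 0" using assms by (auto simp: Transposition.transpose_def)
  have bij: "bij_betw (Transposition.transpose a b) {..<n} {..<n}" if "a < n" "b < n" for a b :: nat
    using that by (intro bij_betw_byWitness[where f' = "Transposition.transpose a b"])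
      (auto simp: Transposition.transpose_def)
  show ?thesis
  proof (rule that[of "?s \<circ> Transposition.transpose (Suc 0) ?j"])
    show "bij_betw (?s \<circ> Transposition.transpose (Suc 0) ?j) {..<n} {..<n}"
      by (rule bij_betw_trans[OF bij bij]) (use j n assms in auto)
    show "(?s \<circ> Transposition.transpose (Suc 0) ?j) 0 = i"
      using j by (simp add: Transposition.transpose_def)
    show "(?s \<circ> Transposition.transpose (Suc 0) ?j) (Suc 0) = j" by simp
  qed
qed

text \<open>Extremality confines \<open>X\<close> and \<open>Y\<close> to the entries
  \<open>(i, j)\<close> and \<open>(j, i)\<close> of the two nonzero eigenvalues. Their norms fix
  the moduli, and orthogonality makes the phases differ by a quarter turn, in one of two
  directions.\<close>

lemma pauli_normal_form_diagonal:
  fixes X Y :: "complex mat" and \<eta> :: "nat \<Rightarrow> real" and n :: nat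
  defines "D \<equiv> real_diag_mat n \<eta>"
  defines "a \<equiv> \<Sum>k<n. (\<eta> k)\<^sup>2"
  assumes pos: "0 < a"
    and X: "X \<in> carrier_mat n n" "mat_adjoint X = X" "(frob_norm X)\<^sup>2 = a"
    and Y: "Y \<in> carrier_mat n n" "mat_adjoint Y = Y" "(frob_norm Y)\<^sup>2 = a"
    and orth: "Re (frob_inner X Y) = 0"
    and DX: "(frob_norm (commutator D X))\<^sup>2 = 2 * a\<^sup>2" and DY: "(frob_norm (commutator D Y))\<^sup>2 = 2 * a\<^sup>2"
  obtains i j \<mu> \<omega> z where "i < n" "j < n" "i \<noteq> j" "0 \<le> \<mu>" "norm \<omega> = 1" "\<eta> i = \<mu>" "\<eta> j = - \<mu>"
    "\<And>k. k < n \<Longrightarrow> k \<noteq> i \<Longrightarrow> k \<noteq> j \<Longrightarrow> \<eta> k = 0"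
    "\<And>k l. k < n \<Longrightarrow> l < n \<Longrightarrow> (k, l) \<noteq> (i, j) \<Longrightarrow> (k, l) \<noteq> (j, i) \<Longrightarrow> X $$ (k, l) = 0 \<and> Y $$ (k, l) = 0"
    "\<omega> * X $$ (i, j) = of_real \<mu>" "\<omega> * Y $$ (i, j) = z" "z = \<i> * of_real \<mu> \<or> z = - (\<i> * of_real \<mu>)"
proof -
  have suppX: "(\<eta> k - \<eta> l)\<^sup>2 = 2 * a" if "k < n" "l < n" "X $$ (k, l) \<noteq> 0" for k l
  proof -
    have "(frob_norm (commutator D X))\<^sup>2 = 2 * a * (frob_norm X)\<^sup>2"
      unfolding DX X(3) by (simp add: power2_eq_square)
    from commutator_extremal_support[OF X(1) this[unfolded D_def a_def] that] show ?thesis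
      by (simp add: a_def)
  qed
  have suppY: "(\<eta> k - \<eta> l)\<^sup>2 = 2 * a" if "k < n" "l < n" "Y $$ (k, l) \<noteq> 0" for k l
  proof -
    have "(frob_norm (commutator D Y))\<^sup>2 = 2 * a * (frob_norm Y)\<^sup>2"
      unfolding DY Y(3) by (simp add: power2_eq_square)
    from commutator_extremal_support[OF Y(1) this[unfolded D_def a_def] that] show ?thesis
      by (simp add: a_def)
  qed
  have "\<exists>i j. i < n \<and> j < n \<and> X $$ (i, j) \<noteq> 0"
  proof (rule ccontr)
    assume "\<not> ?thesis"
    then have "(frob_norm X)\<^sup>2 = 0" unfolding frob_norm_sq_sum[OF X(1)] by auto
    then show False using X(3) pos by simp
  qed
  then obtain i0 j0 where ij0: "i0 < n" "j0 < n" "X $$ (i0, j0) \<noteq> 0" by blast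
  \<comment> \<open>\<open>H1\<close> lists the positive eigenvalue first, so the indices are
    exchanged if necessary; by Hermitian symmetry the transposed entry is nonzero as well.\<close>
  have "\<exists>i j. i < n \<and> j < n \<and> X $$ (i, j) \<noteq> 0 \<and> 0 \<le> \<eta> i"
  proof (cases "0 \<le> \<eta> i0")
    case False
    have "\<eta> j0 = - \<eta> i0"
      using extremal_gap(2)[OF ij0(1,2)] suppX[OF ij0] pos by (simp add: a_def)
    moreover have "X $$ (j0, i0) \<noteq> 0" using ij0 hermitian_index[OF X(1,2) ij0(1,2)] by simp
    ultimately show ?thesis using False ij0 by (intro exI[of _ j0] exI[of _ i0]) simp
  qed (use ij0 in blast)
  then obtain i j where ij: "i < n" "j < n" and Xij: "X $$ (i, j) \<noteq> 0" and \<eta>0: "0 \<le> \<eta> i" by blast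
  have g: "(\<eta> i - \<eta> j)\<^sup>2 = 2 * (\<Sum>k<n. (\<eta> k)\<^sup>2)" "0 < (\<Sum>k<n. (\<eta> k)\<^sup>2)"
    using suppX[OF ij Xij] pos by (simp_all add: a_def)
  note eg = extremal_gap[OF ij g]
  define \<mu> where "\<mu> = \<eta> i"
  have \<mu>: "a = 2 * \<mu>\<^sup>2" "0 < \<mu>"
    using eg(3) \<eta>0 pos by (auto simp: \<mu>_def a_def order_less_le)
  have off: "X $$ (k, l) = 0 \<and> Y $$ (k, l) = 0"
    if kl: "k < n" "l < n" "(k, l) \<noteq> (i, j)" "(k, l) \<noteq> (j, i)" for k l
  proof -
    have "(\<eta> k - \<eta> l)\<^sup>2 \<noteq> 2 * a"
    proof
      assume e: "(\<eta> k - \<eta> l)\<^sup>2 = 2 * a"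
      then have e': "(\<eta> k - \<eta> l)\<^sup>2 = 2 * (\<Sum>k<n. (\<eta> k)\<^sup>2)" by (simp add: a_def)
      note eg' = extremal_gap[OF kl(1,2) e' g(2)]
      have "\<eta> k \<noteq> 0" "\<eta> l \<noteq> 0" using eg'(2,3) g(2) by auto
      then have "k = i \<or> k = j" "l = i \<or> l = j" using eg(4) kl by blast+
      then show False using eg'(1) kl by auto
    qed
    then show ?thesis using suppX suppY kl by blast
  qed
  have modulus: "norm (Z $$ (i, j)) = \<mu>"
    if Z: "Z \<in> carrier_mat n n" "mat_adjoint Z = Z" "(frob_norm Z)\<^sup>2 = a"
      and off: "\<And>k l. k < n \<Longrightarrow> l < n \<Longrightarrow> (k, l) \<noteq> (i, j) \<Longrightarrow> (k, l) \<noteq> (j, i) \<Longrightarrow> Z $$ (k, l) = 0" for Z :: "complex mat"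
  proof -
    have "a = (norm (Z $$ (i, j)))\<^sup>2 + (norm (Z $$ (j, i)))\<^sup>2"
      unfolding Z(3)[symmetric] frob_norm_sq_sum[OF Z(1)]
      by (rule sum_two_point_support[OF ij eg(1)]) (simp add: off)
    also have "\<dots> = 2 * (norm (Z $$ (i, j)))\<^sup>2"
      using hermitian_index[OF Z(1,2) ij] by simp
    finally have "(norm (Z $$ (i, j)))\<^sup>2 = \<mu>\<^sup>2" using \<mu> by simp
    then show ?thesis using \<mu>(2) by (simp add: power2_eq_iff_nonneg)
  qed
  have nX: "norm (X $$ (i, j)) = \<mu>" and nY: "norm (Y $$ (i, j)) = \<mu>"
    using modulus[OF X] modulus[OF Y] off by blast+
  define \<omega> where "\<omega> = of_real \<mu> / X $$ (i, j)"
  define z where "z = \<omega> * Y $$ (i, j)"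
  have \<omega>: "norm \<omega> = 1" "\<omega> * X $$ (i, j) = of_real \<mu>"
    using nX \<mu>(2) Xij by (simp_all add: \<omega>_def norm_divide)
  have "frob_inner X Y = X $$ (i, j) * cnj (Y $$ (i, j)) + X $$ (j, i) * cnj (Y $$ (j, i))"
    unfolding frob_inner_sum[OF X(1)]
    by (rule sum_two_point_support[OF ij eg(1)]) (simp add: off)
  \<comment> \<open>The two summands are complex conjugates, so each has half of the real
    part.\<close>
  then have R: "Re (X $$ (i, j) * cnj (Y $$ (i, j))) = 0"
    using orth hermitian_index[OF X(1,2) ij] hermitian_index[OF Y(1,2) ij] by simp
  have "of_real \<mu> * cnj z = (\<omega> * cnj \<omega>) * (X $$ (i, j) * cnj (Y $$ (i, j)))"
    unfolding \<omega>(2)[symmetric] z_def by (simp add: mult_ac)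
  also have "\<omega> * cnj \<omega> = 1" using complex_norm_square[of \<omega>] \<omega>(1) by simp
  finally have "Re (of_real \<mu> * cnj z) = 0" using R by simp
  then have Rz: "Re z = 0" using \<mu>(2) by simp
  have "norm z = \<mu>" unfolding z_def norm_mult \<omega>(1) nY by simp
  then have "(Im z)\<^sup>2 = \<mu>\<^sup>2" using Rz cmod_power2[of z] by simp
  then have "Im z = \<mu> \<or> Im z = - \<mu>" by (simp add: power2_eq_iff)
  then have zz: "z = \<i> * of_real \<mu> \<or> z = - (\<i> * of_real \<mu>)" using Rz by (auto simp: complex_eq_iff)
  have m: "0 \<le> \<mu>" "\<eta> i = \<mu>" "\<eta> j = - \<mu>" using \<mu>(2) eg(2) by (simp_all add: \<mu>_def)
  show ?thesis
    by (rule that[of i j \<mu> \<omega> z])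
      (fact ij(1) ij(2) eg(1) m \<omega> zz z_def[symmetric] | erule (2) eg(4) | erule (3) off)+
qed

text \<open>The sign \<open>\<epsilon>\<close> is genuine: for nonzero \<open>\<mu>\<close>, a
  conjugation preserving the first two matrices preserves their product and with it
  \<open>H3\<close>. Absorbing the sign is left to the orthogonal group.\<close>

lemma pauli_normal_form:
  assumes n: "2 \<le> n"
    and A: "A \<in> carrier_mat n n" "mat_adjoint A = A" "(frob_norm A)\<^sup>2 = \<beta>"
    and X: "X \<in> carrier_mat n n" "mat_adjoint X = X" "(frob_norm X)\<^sup>2 = \<beta>"
    and Y: "Y \<in> carrier_mat n n" "mat_adjoint Y = Y" "(frob_norm Y)\<^sup>2 = \<beta>"
    and orth: "Re (frob_inner X Y) = 0"
    and AX: "(frob_norm (commutator A X))\<^sup>2 = 2 * \<beta>\<^sup>2" and AY: "(frob_norm (commutator A Y))\<^sup>2 = 2 * \<beta>\<^sup>2"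
  obtains P \<mu> \<epsilon> where "P \<in> unitary_group n" "0 \<le> \<mu>" "\<epsilon> = 1 \<or> \<epsilon> = - (1 :: real)"
    "conj_by P A = diag_pad n (H1 \<mu>)" "conj_by P X = diag_pad n (H2 \<mu>)"
    "of_real \<epsilon> \<cdot>\<^sub>m conj_by P Y = diag_pad n (H3 \<mu>)"
proof -
  obtain p \<eta> where p: "orthonormal_frame n UNIV p"
    and D: "conj_by (frame_mat n p) A = real_diag_mat n \<eta>"
    using hermitian_diagonalisation[OF A(1,2)] .
  note U = frame_mat_unitary[OF p]
  note Pc = unitary_group_carrier[OF U]
  have \<beta>: "\<beta> = (\<Sum>k<n. (\<eta> k)\<^sup>2)"
    unfolding A(3)[symmetric] conj_by_norm[OF U A(1), symmetric] D by (rule diagonal_commutator_norm(2)[OF Pc])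
  show ?thesis
  proof (cases "\<beta> = 0")
    case True
    then have z: "A = 0\<^sub>m n n" "X = 0\<^sub>m n n" "Y = 0\<^sub>m n n"
      using A X Y frob_norm_eq_0_iff by (metis power2_eq_iff_nonneg zero_eq_power2)+
    have cz: "conj_by (frame_mat n p) (0\<^sub>m n n) = 0\<^sub>m n n"
      using Pc unfolding conj_by_def by simp
    have dz: "diag_pad n H = 0\<^sub>m n n"
      if H: "H \<in> carrier_mat 2 2" "\<And>i j. i < 2 \<Longrightarrow> j < 2 \<Longrightarrow> H $$ (i, j) = 0" for H
      using diag_pad_carrier[OF n H(1)] by (intro eq_matI) (auto simp: diag_pad_index[OF n H(1)] H(2))
    have "diag_pad n (H1 0) = 0\<^sub>m n n" "diag_pad n (H2 0) = 0\<^sub>m n n" "diag_pad n (H3 0) = 0\<^sub>m n n"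
      by (intro dz pauli_carrier; simp add: H1_index H2_index H3_index)+
    then show ?thesis
      using that[OF U, of 0 1] by (simp add: z cz)
  next
    case False
    then have pos: "0 < (\<Sum>k<n. (\<eta> k)\<^sup>2)" using \<beta> by (simp add: order_less_le sum_nonneg)
    let ?c = "conj_by (frame_mat n p)"
    have c: "?c X \<in> carrier_mat n n" "?c Y \<in> carrier_mat n n"
      "mat_adjoint (?c X) = ?c X" "mat_adjoint (?c Y) = ?c Y"
      using Pc X Y by (auto intro: conj_by_hermitian)
    obtain i j \<mu> \<omega> z where ij: "i < n" "j < n" "i \<noteq> j" and \<mu>: "0 \<le> \<mu>" and \<omega>: "norm \<omega> = 1"
      and \<eta>: "\<eta> i = \<mu>" "\<eta> j = - \<mu>" "\<And>k. k < n \<Longrightarrow> k \<noteq> i \<Longrightarrow> k \<noteq> j \<Longrightarrow> \<eta> k = 0"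
      and off: "\<And>k l. k < n \<Longrightarrow> l < n \<Longrightarrow> (k, l) \<noteq> (i, j) \<Longrightarrow> (k, l) \<noteq> (j, i) \<Longrightarrow> ?c X $$ (k, l) = 0 \<and> ?c Y $$ (k, l) = 0"
      and Xij: "\<omega> * ?c X $$ (i, j) = of_real \<mu>" and Yij: "\<omega> * ?c Y $$ (i, j) = z"
      and z: "z = \<i> * of_real \<mu> \<or> z = - (\<i> * of_real \<mu>)"
    proof (rule pauli_normal_form_diagonal[OF pos c(1,3) _ c(2,4)])
      show "(frob_norm (?c X))\<^sup>2 = (\<Sum>k<n. (\<eta> k)\<^sup>2)" "(frob_norm (?c Y))\<^sup>2 = (\<Sum>k<n. (\<eta> k)\<^sup>2)"
        using X(3) Y(3) \<beta> by (simp_all add: conj_by_norm[OF U X(1)] conj_by_norm[OF U Y(1)])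
      show "Re (frob_inner (?c X) (?c Y)) = 0"
        unfolding conj_by_inner[OF U X(1) Y(1)] by (rule orth)
      show "(frob_norm (commutator (real_diag_mat n \<eta>) (?c X)))\<^sup>2
          = 2 * (\<Sum>k<n. (\<eta> k)\<^sup>2)\<^sup>2"
        unfolding D[symmetric] conj_by_commutator_norm[OF U A(1) X(1)] AX \<beta> ..
      show "(frob_norm (commutator (real_diag_mat n \<eta>) (?c Y)))\<^sup>2
          = 2 * (\<Sum>k<n. (\<eta> k)\<^sup>2)\<^sup>2"
        unfolding D[symmetric] conj_by_commutator_norm[OF U A(1) Y(1)] AY \<beta> ..
    qed blast
    obtain \<tau> where \<tau>: "bij_betw \<tau> {..<n} {..<n}" "\<tau> 0 = i" "\<tau> (Suc 0) = j"
      using permutation_to_front[OF ij] .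
    \<comment> \<open>Conjugation multiplies entry \<open>(k, l)\<close> by
      \<open>cnj (\<phi> k) * \<phi> l\<close>, so a phase on the second vector alone turns the
      surviving entry of \<open>X\<close> into \<open>\<mu>\<close> and leaves the diagonal of
      \<open>A\<close> unchanged.\<close>
    define \<phi> where "\<phi> k = (if k = Suc 0 then \<omega> else 1)" for k
    define q where "q = (\<lambda>k a. \<phi> k * p (\<tau> k) a)"
    have "norm (\<phi> k) = 1" for k using \<omega> by (simp add: \<phi>_def)
    from rearranged_frame[OF p \<tau>(1) this] have q: "orthonormal_frame n UNIV q" unfolding q_def .
    note V = frame_mat_unitary[OF q]
    have \<tau>n: "\<tau> k < n" "\<tau> k = i \<longleftrightarrow> k = 0" "\<tau> k = j \<longleftrightarrow> k = Suc 0" if "k < n" for k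
    proof -
      have "0 < n" "Suc 0 < n" using n by auto
      then show "\<tau> k < n" "\<tau> k = i \<longleftrightarrow> k = 0" "\<tau> k = j \<longleftrightarrow> k = Suc 0"
        using \<tau> that unfolding bij_betw_def inj_on_def by (blast, metis lessThan_iff, metis lessThan_iff)
    qed
    have entry: "conj_by (frame_mat n q) Z $$ (k, l) = cnj (\<phi> k) * (\<phi> l * ?c Z $$ (\<tau> k, \<tau> l))"
      if Z: "Z \<in> carrier_mat n n" and kl: "k < n" "l < n" for Z k l
      using \<tau>n[OF kl(1)] \<tau>n[OF kl(2)]
      by (simp add: frame_conj_index[OF Z kl] frame_conj_index[OF Z] q_def herm_form_scale_left herm_form_scale_right)
    have n2: "0 < n" "Suc 0 < n" using n by auto
    have \<omega>1: "cnj \<omega> * \<omega> = 1" using complex_norm_square[of \<omega>] \<omega> by (simp add: mult.commute)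
    have Vc: "conj_by (frame_mat n q) Z \<in> carrier_mat n n" if "Z \<in> carrier_mat n n" for Z
      using that unitary_group_carrier[OF V] by simp
    have eqI: "W = diag_pad n H" if W: "W \<in> carrier_mat n n" and H: "H \<in> carrier_mat 2 2"
      and e: "\<And>k l. k < n \<Longrightarrow> l < n \<Longrightarrow> W $$ (k, l) = (if k < 2 \<and> l < 2 then H $$ (k, l) else 0)" for W H
      using W diag_pad_carrier[OF n H] by (intro eq_matI) (auto simp: diag_pad_index[OF n H] e)
    have eA: "conj_by (frame_mat n q) A = diag_pad n (H1 \<mu>)"
    proof (rule eqI[OF Vc[OF A(1)] pauli_carrier(1)])
      fix k l assume kl: "k < n" "l < n"
      have inj: "\<tau> k = \<tau> l \<longleftrightarrow> k = l" using \<tau>(1) kl by (auto simp: bij_betw_def inj_on_def)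
      have "conj_by (frame_mat n q) A $$ (k, l) = (if k = l then cnj (\<phi> k) * \<phi> k * of_real (\<eta> (\<tau> k)) else 0)"
        using \<tau>n[OF kl(1)] \<tau>n[OF kl(2)] inj by (simp add: entry[OF A(1) kl] D real_diag_mat_def)
      also have "\<dots> = (if k < 2 \<and> l < 2 then H1 \<mu> $$ (k, l) else 0)"
      proof (cases "k = l \<and> 2 \<le> k")
        case True
        then have "\<eta> (\<tau> k) = 0" using \<tau>n[OF kl(1)] by (intro \<eta>(3)) auto
        then show ?thesis using True by simp
      next
        case False
        then show ?thesis
          using \<omega>1 \<tau> \<eta> by (cases "k = l") (auto simp: H1_index \<phi>_def less_2_cases_iff not_le)
      qed
      finally show "conj_by (frame_mat n q) A $$ (k, l) = (if k < 2 \<and> l < 2 then H1 \<mu> $$ (k, l) else 0)" .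
    qed
    have offq: "conj_by (frame_mat n q) Z $$ (k, l) = 0"
      if Z: "Z \<in> carrier_mat n n" and kl: "k < n" "l < n"
        and o: "\<And>k l. k < n \<Longrightarrow> l < n \<Longrightarrow> (k, l) \<noteq> (i, j) \<Longrightarrow> (k, l) \<noteq> (j, i) \<Longrightarrow> ?c Z $$ (k, l) = 0"
        and ne: "(k, l) \<noteq> (0, Suc 0)" "(k, l) \<noteq> (Suc 0, 0)" for Z k l
    proof -
      have "?c Z $$ (\<tau> k, \<tau> l) = 0"
        using \<tau>n[OF kl(1)] \<tau>n[OF kl(2)] ne by (intro o) auto
      then show ?thesis by (simp add: entry[OF Z kl])
    qed
    have on: "conj_by (frame_mat n q) Z $$ (0, Suc 0) = \<omega> * ?c Z $$ (i, j)"
      "conj_by (frame_mat n q) Z $$ (Suc 0, 0) = cnj (\<omega> * ?c Z $$ (i, j))"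
      if Z: "Z \<in> carrier_mat n n" "mat_adjoint (?c Z) = ?c Z" for Z
      using n2 \<tau> hermitian_index[OF conj_by_carrier[OF Pc Z(1)] Z(2) ij(1,2)]
      by (simp_all add: entry[OF Z(1)] \<phi>_def)
    have eX: "conj_by (frame_mat n q) X = diag_pad n (H2 \<mu>)"
    proof (rule eqI[OF Vc[OF X(1)] pauli_carrier(2)])
      fix k l assume kl: "k < n" "l < n"
      show "conj_by (frame_mat n q) X $$ (k, l) = (if k < 2 \<and> l < 2 then H2 \<mu> $$ (k, l) else 0)"
        using on[OF X(1) c(3)] offq[OF X(1) kl] off
        by (cases "(k, l) = (0, Suc 0) \<or> (k, l) = (Suc 0, 0)") (auto simp: H2_index Xij less_2_cases_iff)
    qed
    \<comment> \<open>Chosen such that \<open>\<epsilon> z\<close> is \<open>- \<mu> \<i>\<close>,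
      the upper right entry of \<open>H3 \<mu>\<close>.\<close>
    define \<epsilon> :: real where "\<epsilon> = (if z = - (\<i> * of_real \<mu>) then 1 else - 1)"
    have \<epsilon>: "\<epsilon> = 1 \<or> \<epsilon> = - 1" "of_real \<epsilon> * z = - of_real \<mu> * \<i>" using z by (auto simp: \<epsilon>_def)
    have \<epsilon>': "of_real \<epsilon> * cnj z = of_real \<mu> * \<i>"
    proof -
      have "cnj (of_real \<epsilon> * z) = cnj (- of_real \<mu> * \<i>)" unfolding \<epsilon>(2) ..
      then show ?thesis by simp
    qed
    have eY: "of_real \<epsilon> \<cdot>\<^sub>m conj_by (frame_mat n q) Y = diag_pad n (H3 \<mu>)"
    proof (rule eqI[OF _ pauli_carrier(3)])
      show "of_real \<epsilon> \<cdot>\<^sub>m conj_by (frame_mat n q) Y \<in> carrier_mat n n" using Vc[OF Y(1)] by simp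
      fix k l assume kl: "k < n" "l < n"
      have "(of_real \<epsilon> \<cdot>\<^sub>m conj_by (frame_mat n q) Y) $$ (k, l) = of_real \<epsilon> * conj_by (frame_mat n q) Y $$ (k, l)"
        using Vc[OF Y(1)] kl by simp
      also have "\<dots> = (if k < 2 \<and> l < 2 then H3 \<mu> $$ (k, l) else 0)"
        using on[OF Y(1) c(4)] offq[OF Y(1) kl] off \<epsilon> \<epsilon>'
        by (cases "(k, l) = (0, Suc 0) \<or> (k, l) = (Suc 0, 0)") (auto simp: H3_index Yij less_2_cases_iff)
      finally show "(of_real \<epsilon> \<cdot>\<^sub>m conj_by (frame_mat n q) Y) $$ (k, l) = (if k < 2 \<and> l < 2 then H3 \<mu> $$ (k, l) else 0)" .
    qed
    show ?thesis by (rule that[OF V \<mu> \<epsilon>(1) eA eX eY])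
  qed
qed

section \<open>Rotating a Hermitian family into normal form\<close>

definition rot_mat :: "nat \<Rightarrow> (nat \<Rightarrow> nat \<Rightarrow> real) \<Rightarrow> real mat" where
  "rot_mat M r = mat M M (\<lambda>(a, l). r l a)"

lemma rot_mat_orthogonal:
  fixes r :: "nat \<Rightarrow> nat \<Rightarrow> real"
  assumes "\<And>l l'. l < M \<Longrightarrow> l' < M \<Longrightarrow> (\<Sum>a<M. r l a * r l' a) = (if l = l' then 1 else 0)"
  shows "rot_mat M r \<in> orthogonal_group M"
proof -
  let ?R = "rot_mat M r"
  have c: "?R \<in> carrier_mat M M" "transpose_mat ?R \<in> carrier_mat M M"
    by (auto simp: rot_mat_def)
  have "transpose_mat ?R * ?R = 1\<^sub>m M"
  proof (rule eq_matI)
    fix i j assume "i < dim_row (1\<^sub>m M)" "j < dim_col (1\<^sub>m M)"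
    then have ij: "i < M" "j < M" by auto
    have "(transpose_mat ?R * ?R) $$ (i, j) = (\<Sum>k<M. r i k * r j k)"
      using ij by (subst index_mult_mat_sum[OF c(2,1)]) (simp_all add: rot_mat_def)
    then show "(transpose_mat ?R * ?R) $$ (i, j) = 1\<^sub>m M $$ (i, j)"
      using assms ij by (simp del: index_mult_mat(1))
  qed (use c in auto)
  then show ?thesis using c by (simp add: orthogonal_group_def)
qed

text \<open>\<open>rot_mat\<close> stores the vector \<open>r l\<close> as column \<open>l\<close>,
  in agreement with the column sums of the group action.\<close>

lemma rot_family_rot_mat:
  assumes "l < M"
  shows "rot_family n M (rot_mat M r) A l = mat_sum n (\<lambda>j. complex_of_real (r l j) \<cdot>\<^sub>m A j) {..<M}"
  unfolding rot_family_def using assms by (intro mat_sum_cong) (simp add: rot_mat_def)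

lemma rot_family_hermitian:
  assumes B: "\<And>j. j < M \<Longrightarrow> B j \<in> carrier_mat n n" "\<And>j. j < M \<Longrightarrow> mat_adjoint (B j) = B j"
  shows "mat_adjoint (rot_family n M R B l) = rot_family n M R B l"
proof (rule eq_matI)
  let ?C = "rot_family n M R B l"
  have c: "?C \<in> carrier_mat n n" by simp
  show "dim_row (mat_adjoint ?C) = dim_row ?C" "dim_col (mat_adjoint ?C) = dim_col ?C" by simp_all
  fix i j assume "i < dim_row ?C" "j < dim_col ?C"
  then have ij: "i < n" "j < n" using c by auto
  have "mat_adjoint ?C $$ (i, j) = cnj (?C $$ (j, i))"
    using c ij by (intro mat_adjoint_index) auto
  also have "\<dots> = (\<Sum>k<M. of_real (R $$ (k, l)) * cnj (B k $$ (j, i)))"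
    by (subst rot_family_index[of M B n]) (use B(1) ij in auto)
  also have "\<dots> = (\<Sum>k<M. of_real (R $$ (k, l)) * B k $$ (i, j))"
    by (intro sum.cong refl arg_cong2[of _ _ _ _ "(*)"] hermitian_index[symmetric, OF B ij(2,1)]) auto
  also have "\<dots> = ?C $$ (i, j)"
    by (rule rot_family_index[of M B n, symmetric]) (use B(1) ij in auto)
  finally show "mat_adjoint ?C $$ (i, j) = ?C $$ (i, j)" .
qed

text \<open>The coefficients are real, so the real part of the Gram matrix transforms by itself, and
  diagonalisation over \<open>\<real>\<close> applies to it.\<close>

lemma frob_inner_lincomb:
  fixes u v :: "nat \<Rightarrow> real"
  assumes B: "\<And>j. j < M \<Longrightarrow> B j \<in> carrier_mat n n"
  shows "Re (frob_inner (mat_sum n (\<lambda>j. complex_of_real (u j) \<cdot>\<^sub>m B j) {..<M})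
      (mat_sum n (\<lambda>j. complex_of_real (v j) \<cdot>\<^sub>m B j) {..<M}))
    = (\<Sum>a<M. \<Sum>b<M. u a * Re (frob_inner (B a) (B b)) * v b)"
proof -
  let ?U = "\<lambda>j. complex_of_real (u j) \<cdot>\<^sub>m B j" and ?V = "\<lambda>j. complex_of_real (v j) \<cdot>\<^sub>m B j"
  have c: "?U j \<in> carrier_mat n n" "?V j \<in> carrier_mat n n" if "j < M" for j using B[OF that] by auto
  have "frob_inner (mat_sum n ?U {..<M}) (mat_sum n ?V {..<M}) = (\<Sum>a<M. frob_inner (?U a) (mat_sum n ?V {..<M}))"
    by (rule frob_inner_mat_sum_left) (use c in auto)
  also have "\<dots> = (\<Sum>a<M. \<Sum>b<M. frob_inner (?U a) (?V b))"
    by (intro sum.cong refl frob_inner_mat_sum_right) (use c in auto)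
  also have "\<dots> = (\<Sum>a<M. \<Sum>b<M. of_real (u a) * (of_real (v b) * frob_inner (B a) (B b)))"
    using B by (intro sum.cong refl) (simp add: frob_inner_smult_left frob_inner_smult_right[of _ n])
  finally show ?thesis by (simp add: mult_ac)
qed

text \<open>The Gram matrix of the family is diagonalised by an orthogonal rotation.\<close>

lemma sorted_orthogonal_rotation:
  assumes B: "\<And>j. j < M \<Longrightarrow> B j \<in> carrier_mat n n"
  obtains r :: "nat \<Rightarrow> nat \<Rightarrow> real"
  where "\<And>l l'. l < M \<Longrightarrow> l' < M \<Longrightarrow> (\<Sum>a<M. r l a * r l' a) = (if l = l' then 1 else 0)"
    and "\<And>l l'. l < M \<Longrightarrow> l' < M \<Longrightarrow> l \<noteq> l' \<Longrightarrow>
      Re (frob_inner (rot_family n M (rot_mat M r) B l)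
        (rot_family n M (rot_mat M r) B l')) = 0"
    and "\<And>l l'. l \<le> l' \<Longrightarrow> l' < M \<Longrightarrow>
      (frob_norm (rot_family n M (rot_mat M r) B l'))\<^sup>2
        \<le> (frob_norm (rot_family n M (rot_mat M r) B l))\<^sup>2"
proof -
  have sym: "Re (frob_inner (B b) (B a)) = Re (frob_inner (B a) (B b))" if "a < M" "b < M" for a b
    using frob_inner_cnj[OF B[OF that(1)] B[OF that(2)]] by (metis cnj.simps(1))
  obtain r :: "nat \<Rightarrow> nat \<Rightarrow> real"
    where r: "\<And>l l'. l < M \<Longrightarrow> l' < M \<Longrightarrow> (\<Sum>a<M. r l a * r l' a) = (if l = l' then 1 else 0)"
      "\<And>l l'. l < M \<Longrightarrow> l' < M \<Longrightarrow> l \<noteq> l' \<Longrightarrow> (\<Sum>a<M. \<Sum>b<M. r l a * Re (frob_inner (B a) (B b)) * r l' b) = 0"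
      "\<And>l l'. l \<le> l' \<Longrightarrow> l' < M \<Longrightarrow> (\<Sum>a<M. \<Sum>b<M. r l' a * Re (frob_inner (B a) (B b)) * r l' b)
        \<le> (\<Sum>a<M. \<Sum>b<M. r l a * Re (frob_inner (B a) (B b)) * r l b)"
    using real_form_diagonalisation[of M "\<lambda>a b. Re (frob_inner (B a) (B b))"] sym by blast
  show ?thesis
  proof (rule that[of r])
    fix l l' assume "l < M" "l' < M" "l \<noteq> l'"
    then show "Re (frob_inner (rot_family n M (rot_mat M r) B l)
        (rot_family n M (rot_mat M r) B l')) = 0"
      by (simp add: rot_family_rot_mat frob_inner_lincomb[OF B] r(2))
  next
    fix l l' assume "l \<le> l'" "l' < M"
    then show "(frob_norm (rot_family n M (rot_mat M r) B l'))\<^sup>2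
        \<le> (frob_norm (rot_family n M (rot_mat M r) B l))\<^sup>2"
      unfolding frob_norm_sq_inner by (simp add: rot_family_rot_mat frob_inner_lincomb[OF B] r(3))
  qed (rule r(1))
qed

definition pauli_tuple :: "nat \<Rightarrow> real \<Rightarrow> nat \<Rightarrow> complex mat" where
  "pauli_tuple n l k = (if k = 0 then diag_pad n (H1 l) else if k = 1 then diag_pad n (H2 l)
     else if k = 2 then diag_pad n (H3 l) else 0\<^sub>m n n)"

theorem hermitian_commutator_bound_family:
  assumes M: "3 \<le> M"
    and B: "\<And>j. j < M \<Longrightarrow> B j \<in> carrier_mat n n" "\<And>j. j < M \<Longrightarrow> mat_adjoint (B j) = B j"
  shows "commutator_sum M B \<le> 4/3 * (\<Sum>j<M. (frob_norm (B j))\<^sup>2)\<^sup>2"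
    and "2 \<le> n \<Longrightarrow> commutator_sum M B = 4/3 * (\<Sum>j<M. (frob_norm (B j))\<^sup>2)\<^sup>2 \<Longrightarrow>
      \<exists>P\<in>unitary_group n. \<exists>R\<in>orthogonal_group M. \<exists>l\<ge>0. \<forall>k<M.
        rot_family n M R (\<lambda>j. conj_by P (B j)) k = pauli_tuple n l k"
proof -
  obtain r :: "nat \<Rightarrow> nat \<Rightarrow> real"
    where r: "\<And>l l'. l < M \<Longrightarrow> l' < M \<Longrightarrow> (\<Sum>a<M. r l a * r l' a) = (if l = l' then 1 else 0)"
      "\<And>l l'. l < M \<Longrightarrow> l' < M \<Longrightarrow> l \<noteq> l' \<Longrightarrow>
        Re (frob_inner (rot_family n M (rot_mat M r) B l)
          (rot_family n M (rot_mat M r) B l')) = 0"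
      "\<And>l l'. l \<le> l' \<Longrightarrow> l' < M \<Longrightarrow>
        (frob_norm (rot_family n M (rot_mat M r) B l'))\<^sup>2
          \<le> (frob_norm (rot_family n M (rot_mat M r) B l))\<^sup>2"
    using sorted_orthogonal_rotation[of M B n] B(1) by blast
  define R where "R = rot_mat M r"
  have R: "R \<in> orthogonal_group M" unfolding R_def by (rule rot_mat_orthogonal[OF r(1)])
  define C where "C = rot_family n M R B"
  have C: "C l \<in> carrier_mat n n" "mat_adjoint (C l) = C l" for l
    unfolding C_def by (simp, rule rot_family_hermitian[OF B])
  have orth: "Re (frob_inner (C l) (C l')) = 0" if "l < M" "l' < M" "l \<noteq> l'" for l l'
    using r(2)[OF that] unfolding C_def R_def .
  have sorted: "(frob_norm (C l'))\<^sup>2 \<le> (frob_norm (C l))\<^sup>2" if "l \<le> l'" "l' < M" for l l'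
    using r(3)[OF that] unfolding C_def R_def .
  have sums: "commutator_sum M C = commutator_sum M B" "(\<Sum>l<M. (frob_norm (C l))\<^sup>2) = (\<Sum>j<M. (frob_norm (B j))\<^sup>2)"
    unfolding C_def using commutator_sum_rotate[OF R B(1)] rot_family_norm[OF R B(1)] by auto
  show "commutator_sum M B \<le> 4/3 * (\<Sum>j<M. (frob_norm (B j))\<^sup>2)\<^sup>2"
    using sorted_bound[where C = C and n = n, OF M C orth sorted] unfolding sums .
  assume n: "2 \<le> n" and eq: "commutator_sum M B = 4/3 * (\<Sum>j<M. (frob_norm (B j))\<^sup>2)\<^sup>2"
  have eqC: "commutator_sum M C = 4/3 * (\<Sum>j<M. (frob_norm (C j))\<^sup>2)\<^sup>2" unfolding sums by (rule eq)
  note E = sorted_equality[where C = C and n = n, OF M C orth sorted eqC]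
  have o12: "Re (frob_inner (C 1) (C 2)) = 0" using M by (intro orth) auto
  obtain P l \<epsilon> where P: "P \<in> unitary_group n" and l: "0 \<le> l" and \<epsilon>: "\<epsilon> = 1 \<or> \<epsilon> = - (1 :: real)"
    and eP: "conj_by P (C 0) = diag_pad n (H1 l)" "conj_by P (C 1) = diag_pad n (H2 l)"
      "of_real \<epsilon> \<cdot>\<^sub>m conj_by P (C 2) = diag_pad n (H3 l)"
    using pauli_normal_form[OF n C refl C E(1) C E(2) o12 E(4,5)] .
  note Pc = unitary_group_carrier[OF P]
  \<comment> \<open>Reversing the third rotation vector absorbs the sign left by the normal form and
    keeps the system orthonormal.\<close>
  define r' where "r' k a = (if k = 2 then \<epsilon> else 1) * r k a" for k a
  define R' where "R' = rot_mat M r'"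
  have R': "R' \<in> orthogonal_group M" unfolding R'_def
  proof (rule rot_mat_orthogonal)
    fix l l' assume l: "l < M" "l' < M"
    have "(\<Sum>a<M. r' l a * r' l' a) = (if l = 2 then \<epsilon> else 1) * (if l' = 2 then \<epsilon> else 1) * (\<Sum>a<M. r l a * r l' a)"
      unfolding r'_def by (simp only: sum_distrib_left mult_ac)
    then show "(\<Sum>a<M. r' l a * r' l' a) = (if l = l' then 1 else 0)"
      using \<epsilon> by (auto simp: r(1)[OF l])
  qed
  have "rot_family n M R' (\<lambda>j. conj_by P (B j)) k = pauli_tuple n l k" if k: "k < M" for k
  proof -
    have UB: "conj_by P (B j) \<in> carrier_mat n n" if "j < M" for j using Pc B(1)[OF that] by simp
    have "rot_family n M R' (\<lambda>j. conj_by P (B j)) k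
      = of_real (if k = 2 then \<epsilon> else 1) \<cdot>\<^sub>m rot_family n M R (\<lambda>j. conj_by P (B j)) k" (is "?L = ?c \<cdot>\<^sub>m ?K")
    proof (rule eq_matI)
      have cL: "?L \<in> carrier_mat n n" and cK: "?K \<in> carrier_mat n n" by simp_all
      show "dim_row ?L = dim_row (?c \<cdot>\<^sub>m ?K)" "dim_col ?L = dim_col (?c \<cdot>\<^sub>m ?K)" by auto
      fix i j assume "i < dim_row (?c \<cdot>\<^sub>m ?K)" "j < dim_col (?c \<cdot>\<^sub>m ?K)"
      then have ij: "i < n" "j < n" using cK by auto
      have "?L $$ (i, j) = (\<Sum>a<M. complex_of_real (r' k a) * conj_by P (B a) $$ (i, j))"
        by (subst rot_family_index[of M "\<lambda>j. conj_by P (B j)" n]) (use UB ij k in \<open>auto simp: R'_def rot_mat_def\<close>)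
      also have "\<dots> = ?c * (\<Sum>a<M. complex_of_real (r k a) * conj_by P (B a) $$ (i, j))"
        by (simp only: r'_def of_real_mult sum_distrib_left mult.assoc)
      also have "\<dots> = ?c * ?K $$ (i, j)"
        by (subst rot_family_index[of M "\<lambda>j. conj_by P (B j)" n]) (use UB ij k in \<open>auto simp: R_def rot_mat_def\<close>)
      finally show "?L $$ (i, j) = (?c \<cdot>\<^sub>m ?K) $$ (i, j)" using cK ij by simp
    qed
    also have "rot_family n M R (\<lambda>j. conj_by P (B j)) k = conj_by P (C k)"
      unfolding C_def by (rule conj_by_rotate[OF Pc B(1)])
    also have "of_real (if k = 2 then \<epsilon> else 1) \<cdot>\<^sub>m conj_by P (C k) = pauli_tuple n l k"
    proof (cases "k < 3")
      case True
      then consider "k = 0" | "k = 1" | "k = 2" by linarith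
      then show ?thesis
      proof cases
        case 3
        then show ?thesis using eP(3) by (simp add: pauli_tuple_def)
      qed (use eP in \<open>auto simp: pauli_tuple_def intro!: eq_matI\<close>)
    next
      case False
      then have "C k = 0\<^sub>m n n" using E(3)[of k] k by simp
      moreover have "conj_by P (0\<^sub>m n n) = 0\<^sub>m n n" using Pc unfolding conj_by_def by simp
      ultimately show ?thesis using False by (simp add: pauli_tuple_def)
    qed
    finally show ?thesis .
  qed
  then show "\<exists>P\<in>unitary_group n. \<exists>R\<in>orthogonal_group M. \<exists>l\<ge>0. \<forall>k<M.
        rot_family n M R (\<lambda>j. conj_by P (B j)) k = pauli_tuple n l k"
    using P R' l by blast
qed

section \<open>Padded Pauli matrices attain the bound\<close>

lemma diag_pad_commutator_norm:
  assumes n: "2 \<le> n" and H: "H \<in> carrier_mat 2 2" and K: "K \<in> carrier_mat 2 2"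
  shows "(frob_norm (commutator (diag_pad n H) (diag_pad n K)))\<^sup>2
      = (\<Sum>i<2. \<Sum>j<2. (norm ((\<Sum>k<2. H $$ (i, k) * K $$ (k, j)) - (\<Sum>k<2. K $$ (i, k) * H $$ (k, j))))\<^sup>2)"
    and "(frob_norm (diag_pad n H))\<^sup>2 = (\<Sum>i<2. \<Sum>j<2. (norm (H $$ (i, j)))\<^sup>2)"
proof -
  note c = diag_pad_carrier[OF n]
  have cut: "sum f {..<n} = sum f {..<2}" if "\<And>k. 2 \<le> k \<Longrightarrow> k < n \<Longrightarrow> f k = 0" for f :: "nat \<Rightarrow> 'a::comm_monoid_add"
    using n that by (intro sum.mono_neutral_right) auto
  show "(frob_norm (diag_pad n H))\<^sup>2 = (\<Sum>i<2. \<Sum>j<2. (norm (H $$ (i, j)))\<^sup>2)"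
  proof -
    have "(\<Sum>j<n. (norm (diag_pad n H $$ (i, j)))\<^sup>2) = (\<Sum>j<2. (norm (diag_pad n H $$ (i, j)))\<^sup>2)" if "i < n" for i
      using that by (intro cut) (simp add: diag_pad_index[OF n H])
    then have "(frob_norm (diag_pad n H))\<^sup>2 = (\<Sum>i<n. \<Sum>j<2. (norm (diag_pad n H $$ (i, j)))\<^sup>2)"
      unfolding frob_norm_sq_sum[OF c[OF H]] by simp
    also have "\<dots> = (\<Sum>i<2. \<Sum>j<2. (norm (diag_pad n H $$ (i, j)))\<^sup>2)"
      using n by (intro cut) (simp add: diag_pad_index[OF n H])
    finally show ?thesis using n by (simp add: diag_pad_index[OF n H])
  qed
  have prod: "(diag_pad n X * diag_pad n Y) $$ (i, j) = (if i < 2 \<and> j < 2 then (\<Sum>k<2. X $$ (i, k) * Y $$ (k, j)) else 0)"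
    if X: "X \<in> carrier_mat 2 2" and Y: "Y \<in> carrier_mat 2 2" and ij: "i < n" "j < n" for X Y i j
  proof -
    have "(diag_pad n X * diag_pad n Y) $$ (i, j) = (\<Sum>k<2. diag_pad n X $$ (i, k) * diag_pad n Y $$ (k, j))"
      unfolding index_mult_mat_sum[OF c[OF X] c[OF Y] ij]
      using ij by (intro cut) (simp add: diag_pad_index[OF n X])
    then show ?thesis using n ij by (simp add: diag_pad_index[OF n X] diag_pad_index[OF n Y])
  qed
  let ?D = "\<lambda>i j. (\<Sum>k<2. H $$ (i, k) * K $$ (k, j)) - (\<Sum>k<2. K $$ (i, k) * H $$ (k, j))"
  have e: "commutator (diag_pad n H) (diag_pad n K) $$ (i, j) = (if i < 2 \<and> j < 2 then ?D i j else 0)"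
    if ij: "i < n" "j < n" for i j
    unfolding commutator_def using c[OF H] c[OF K] ij
    by (simp add: prod[OF H K ij] prod[OF K H ij] del: index_mult_mat(1))
  have "(frob_norm (commutator (diag_pad n H) (diag_pad n K)))\<^sup>2
    = (\<Sum>i<n. \<Sum>j<n. (norm (if i < 2 \<and> j < 2 then ?D i j else 0))\<^sup>2)"
    unfolding frob_norm_sq_sum[OF commutator_carrier[OF c[OF H] c[OF K]]]
    by (intro sum.cong refl) (simp only: e lessThan_iff)
  also have "\<dots> = (\<Sum>i<n. \<Sum>j<2. (norm (if i < 2 \<and> j < 2 then ?D i j else 0))\<^sup>2)"
    by (intro sum.cong refl cut) simp
  also have "\<dots> = (\<Sum>i<2. \<Sum>j<2. (norm (if i < 2 \<and> j < 2 then ?D i j else 0))\<^sup>2)"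
    by (intro cut) simp
  finally show "(frob_norm (commutator (diag_pad n H) (diag_pad n K)))\<^sup>2 = (\<Sum>i<2. \<Sum>j<2. (norm (?D i j))\<^sup>2)"
    by simp
qed

text \<open>The commutator of two of the matrices is, up to sign, \<open>2 l \<i>\<close> times the
  third, of squared norm \<open>4 l^2 * 2 l^2\<close>. Six ordered pairs give \<open>48 l^4\<close>,
  which is \<open>4/3 (6 l^2)^2\<close>.\<close>

lemma pauli_tuple_sums:
  assumes n: "2 \<le> n" and M: "3 \<le> M"
  shows "(\<Sum>k<M. (frob_norm (pauli_tuple n l k))\<^sup>2) = 6 * l\<^sup>2"
    and "commutator_sum M (pauli_tuple n l) = 48 * l ^ 4"
proof -
  note c = diag_pad_carrier[OF n]
  have pc: "pauli_tuple n l k \<in> carrier_mat n n" for k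
    unfolding pauli_tuple_def using c pauli_carrier by simp
  note ind = H1_index H2_index H3_index
  have s2: "(\<Sum>k<2. f k) = f 0 + f (1 :: nat)" for f :: "nat \<Rightarrow> 'b::comm_monoid_add"
    by (simp add: numeral_2_eq_2)
  have nrm: "(frob_norm (diag_pad n (H1 l)))\<^sup>2 = 2 * l\<^sup>2" "(frob_norm (diag_pad n (H2 l)))\<^sup>2 = 2 * l\<^sup>2"
    "(frob_norm (diag_pad n (H3 l)))\<^sup>2 = 2 * l\<^sup>2"
    by (simp_all add: diag_pad_commutator_norm(2)[OF n pauli_carrier(1) pauli_carrier(1)]
        diag_pad_commutator_norm(2)[OF n pauli_carrier(2) pauli_carrier(1)]
        diag_pad_commutator_norm(2)[OF n pauli_carrier(3) pauli_carrier(1)] s2 ind norm_mult)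
  have z: "frob_norm (0\<^sub>m n n :: complex mat) = 0" using frob_norm_eq_0_iff[of "0\<^sub>m n n :: complex mat" n n] by simp
  have "(\<Sum>k<M. (frob_norm (pauli_tuple n l k))\<^sup>2) = 2 * l\<^sup>2 + 2 * l\<^sup>2 + 2 * l\<^sup>2 + (\<Sum>k = 3..<M. (frob_norm (pauli_tuple n l k))\<^sup>2)"
    unfolding sum_split_three[OF M] by (simp add: pauli_tuple_def nrm)
  also have "(\<Sum>k = 3..<M. (frob_norm (pauli_tuple n l k))\<^sup>2) = 0"
    by (intro sum.neutral ballI) (simp add: pauli_tuple_def z)
  finally show "(\<Sum>k<M. (frob_norm (pauli_tuple n l k))\<^sup>2) = 6 * l\<^sup>2" by simp
  define f where "f r s = (frob_norm (commutator (pauli_tuple n l r) (pauli_tuple n l s)))\<^sup>2" for r s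
  have fs: "f r s = f s r" for r s
    unfolding f_def using frob_norm_commutator_swap[OF pc pc] by simp
  have fd: "f r r = 0" for r
    unfolding f_def commutator_def using pc[of r] by (simp add: frob_norm_def)
  have f12: "f 0 1 = 8 * l ^ 4" "f 0 2 = 8 * l ^ 4" "f 1 2 = 8 * l ^ 4"
    unfolding f_def pauli_tuple_def
    by (simp_all add: diag_pad_commutator_norm(1)[OF n] pauli_carrier s2 ind cmod_power2)
      (simp_all add: power2_eq_square power4_eq_xxxx algebra_simps)
  have fz: "f r s = 0" if "3 \<le> r \<or> 3 \<le> s" for r s
  proof -
    have "commutator (pauli_tuple n l r) (pauli_tuple n l s) = 0\<^sub>m n n"
      unfolding commutator_def using that pc[of r] pc[of s] by (auto simp: pauli_tuple_def)
    then show ?thesis by (simp add: f_def z)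
  qed
  have F: "(\<Sum>s<M. f r s) = f r 0 + f r 1 + f r 2" for r
    unfolding sum_split_three[OF M] by (simp add: fz)
  have "commutator_sum M (pauli_tuple n l) = (\<Sum>s<M. f 0 s) + (\<Sum>s<M. f 1 s) + (\<Sum>s<M. f 2 s) + (\<Sum>r = 3..<M. \<Sum>s<M. f r s)"
    unfolding commutator_sum_def f_def by (rule sum_split_three[OF M])
  also have "(\<Sum>r = 3..<M. \<Sum>s<M. f r s) = 0"
    by (intro sum.neutral ballI) (simp add: fz)
  finally show "commutator_sum M (pauli_tuple n l) = 48 * l ^ 4"
    unfolding F using fd fs[of 1 0] fs[of 2 0] fs[of 2 1] f12 by simp
qed

text \<open>Both sides are invariant under conjugation and rotation, so the converse has to be
  checked on the Pauli tuple only.\<close>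

theorem hermitian_commutator_equality_iff:
  assumes M: "3 \<le> M" and n: "2 \<le> n"
    and B: "\<And>j. j < M \<Longrightarrow> B j \<in> carrier_mat n n" "\<And>j. j < M \<Longrightarrow> mat_adjoint (B j) = B j"
  shows "commutator_sum M B = 4/3 * (\<Sum>j<M. (frob_norm (B j))\<^sup>2)\<^sup>2 \<longleftrightarrow>
      (\<exists>P\<in>unitary_group n. \<exists>R\<in>orthogonal_group M. \<exists>l\<ge>0. \<forall>k<M.
        rot_family n M R (\<lambda>j. conj_by P (B j)) k = pauli_tuple n l k)"
proof
  assume "\<exists>P\<in>unitary_group n. \<exists>R\<in>orthogonal_group M. \<exists>l\<ge>0. \<forall>k<M.
        rot_family n M R (\<lambda>j. conj_by P (B j)) k = pauli_tuple n l k"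
  then obtain P R l where P: "P \<in> unitary_group n" and R: "R \<in> orthogonal_group M"
    and e: "\<And>k. k < M \<Longrightarrow> rot_family n M R (\<lambda>j. conj_by P (B j)) k = pauli_tuple n l k" by blast
  let ?U = "\<lambda>j. conj_by P (B j)"
  have U: "?U j \<in> carrier_mat n n" if "j < M" for j
    using unitary_group_carrier[OF P] B(1)[OF that] by simp
  have "commutator_sum M B = commutator_sum M ?U"
    unfolding commutator_sum_def using conj_by_commutator_norm[OF P] B(1) by (auto intro!: sum.cong)
  also have "\<dots> = commutator_sum M (rot_family n M R ?U)"
    by (rule commutator_sum_rotate[OF R U, symmetric])
  also have "\<dots> = commutator_sum M (pauli_tuple n l)"
    unfolding commutator_sum_def using e by simp
  finally have 1: "commutator_sum M B = 48 * l ^ 4" using pauli_tuple_sums[OF n M] by simp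
  have "(\<Sum>j<M. (frob_norm (B j))\<^sup>2) = (\<Sum>j<M. (frob_norm (?U j))\<^sup>2)"
    using conj_by_norm[OF P] B(1) by (auto intro!: sum.cong)
  also have "\<dots> = (\<Sum>k<M. (frob_norm (rot_family n M R ?U k))\<^sup>2)"
    by (rule rot_family_norm[OF R U, symmetric])
  also have "\<dots> = 6 * l\<^sup>2" using e pauli_tuple_sums[OF n M] by simp
  finally show "commutator_sum M B = 4/3 * (\<Sum>j<M. (frob_norm (B j))\<^sup>2)\<^sup>2"
    unfolding 1 by (simp add: power_mult_distrib flip: power_mult)
qed (rule hermitian_commutator_bound_family(2)[OF M B n])

section \<open>The complex representation of quaternionic matrices\<close>

lemma cpart_add: "cpart1 (p + q) = cpart1 p + cpart1 q" "cpart2 (p + q) = cpart2 p + cpart2 q"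
  and cpart_minus: "cpart1 (p - q) = cpart1 p - cpart1 q" "cpart2 (p - q) = cpart2 p - cpart2 q"
  and cpart_zero: "cpart1 0 = 0" "cpart2 0 = 0"
  by (simp_all add: cpart1_def cpart2_def complex_eq_iff)

text \<open>Moving \<open>qj\<close> past a complex number conjugates it, and
  \<open>qj * qj = - 1\<close>.\<close>

lemma cpart_mult:
  "cpart1 (p * q) = cpart1 p * cpart1 q - cpart2 p * cnj (cpart2 q)"
  "cpart2 (p * q) = cpart1 p * cpart2 q + cpart2 p * cnj (cpart1 q)"
  by (simp_all add: cpart1_def cpart2_def complex_eq_iff algebra_simps)

lemma cpart_sum: "cpart1 (sum f A) = (\<Sum>a\<in>A. cpart1 (f a))" "cpart2 (sum f A) = (\<Sum>a\<in>A. cpart2 (f a))"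
  by (induction A rule: infinite_finite_induct) (simp_all add: cpart_add cpart_zero)

lemma cpart_norm: "(norm (cpart1 p))\<^sup>2 + (norm (cpart2 p))\<^sup>2 = (norm p)\<^sup>2"
  unfolding cmod_power2 quat_norm_sq by (simp add: cpart1_def cpart2_def)

lemma Psi_carrier:
  assumes "X \<in> carrier_mat n n"
  shows "Psi X \<in> carrier_mat (2 * n) (2 * n)"
  using assms by (auto simp: Psi_def Let_def)

lemma Psi_index:
  assumes "X \<in> carrier_mat n n" "i < n" "j < n"
  shows "Psi X $$ (i, j) = cpart1 (X $$ (i, j))" "Psi X $$ (i, n + j) = cpart2 (X $$ (i, j))"
    "Psi X $$ (n + i, j) = - cnj (cpart2 (X $$ (i, j)))" "Psi X $$ (n + i, n + j) = cnj (cpart1 (X $$ (i, j)))"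
  using assms by (auto simp: Psi_def Let_def)

lemma sum_lessThan_double:
  fixes f :: "nat \<Rightarrow> 'a::comm_monoid_add"
  shows "sum f {..<2 * n} = (\<Sum>k<n. f k) + (\<Sum>k<n. f (n + k))"
proof -
  have "sum f {..<n + m} = (\<Sum>k<n. f k) + (\<Sum>k<m. f (n + k))" for m
    by (induction m) (simp_all add: add.assoc)
  from this[of n] show ?thesis by (simp add: mult_2)
qed

lemma double_index_cases:
  fixes i n :: nat
  assumes "i < 2 * n"
  obtains "i < n" | i' where "i' < n" "i = n + i'"
  using assms by (metis add_less_cancel_left le_add_diff_inverse mult_2 not_le)

lemma Psi_mult:
  assumes X: "X \<in> carrier_mat n n" and Y: "Y \<in> carrier_mat n n"
  shows "Psi (X * Y) = Psi X * Psi Y"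
proof (rule eq_matI)
  have XY: "X * Y \<in> carrier_mat n n" using X Y by auto
  note c = Psi_carrier[OF X] Psi_carrier[OF Y] Psi_carrier[OF XY]
  show "dim_row (Psi (X * Y)) = dim_row (Psi X * Psi Y)" "dim_col (Psi (X * Y)) = dim_col (Psi X * Psi Y)"
    using c by auto
  fix i j assume "i < dim_row (Psi X * Psi Y)" "j < dim_col (Psi X * Psi Y)"
  then have ij: "i < 2 * n" "j < 2 * n" using c by auto
  note prod = index_mult_mat_sum[OF c(1,2)] index_mult_mat_sum[OF X Y] sum_lessThan_double
  show "Psi (X * Y) $$ (i, j) = (Psi X * Psi Y) $$ (i, j)"
  proof (cases rule: double_index_cases[OF ij(1)])
    case 1
    note i = this
    show ?thesis
    proof (cases rule: double_index_cases[OF ij(2)])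
      case 1
      with i show ?thesis
        by (simp add: prod Psi_index[OF X] Psi_index[OF Y] Psi_index[OF XY] cpart_sum cpart_mult
            sum_subtractf sum_negf del: index_mult_mat(1))
    next
      case (2 j')
      with i ij show ?thesis
        by (simp add: prod Psi_index[OF X] Psi_index[OF Y] Psi_index[OF XY] cpart_sum cpart_mult
            sum.distrib del: index_mult_mat(1))
    qed
  next
    case (2 i')
    note i = this
    show ?thesis
    proof (cases rule: double_index_cases[OF ij(2)])
      case 1
      with i ij show ?thesis
        by (simp add: prod Psi_index[OF X] Psi_index[OF Y] Psi_index[OF XY] cpart_sum cpart_mult
            sum.distrib sum_negf del: index_mult_mat(1))
    next
      case (2 j')
      with i ij show ?thesis
        by (simp add: prod Psi_index[OF X] Psi_index[OF Y] Psi_index[OF XY] cpart_sum cpart_mult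
            sum_subtractf sum_negf del: index_mult_mat(1))
    qed
  qed
qed

lemma Psi_minus:
  assumes X: "X \<in> carrier_mat n n" and Y: "Y \<in> carrier_mat n n"
  shows "Psi (X - Y) = Psi X - Psi Y"
  by (rule eq_matI) (use X Y in \<open>auto simp: Psi_def Let_def cpart_minus\<close>)

lemma Psi_commutator:
  assumes X: "X \<in> carrier_mat n n" and Y: "Y \<in> carrier_mat n n"
  shows "Psi (commutator X Y) = commutator (Psi X) (Psi Y)"
proof -
  have "X * Y \<in> carrier_mat n n" "Y * X \<in> carrier_mat n n" using X Y by auto
  from Psi_minus[OF this] show ?thesis
    unfolding commutator_def Psi_mult[OF X Y] Psi_mult[OF Y X] .
qed

text \<open>Each complex component of an entry occurs once in the upper and once in the lower
  blocks.\<close>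

lemma Psi_norm:
  assumes X: "X \<in> carrier_mat n n"
  shows "(frob_norm (Psi X))\<^sup>2 = 2 * (frob_norm X)\<^sup>2"
proof -
  have "(frob_norm (Psi X))\<^sup>2
    = (\<Sum>i<n. \<Sum>j<n. (norm (cpart1 (X $$ (i, j))))\<^sup>2 + (norm (cpart2 (X $$ (i, j))))\<^sup>2)
    + (\<Sum>i<n. \<Sum>j<n. (norm (cpart1 (X $$ (i, j))))\<^sup>2 + (norm (cpart2 (X $$ (i, j))))\<^sup>2)"
    unfolding frob_norm_sq_sum[OF Psi_carrier[OF X]] sum_lessThan_double
    by (simp add: Psi_index[OF X] sum.distrib)
  then show ?thesis unfolding cpart_norm using X by (simp add: frob_norm_sq)
qed

section \<open>Transfer to quaternionic matrices\<close>

text \<open>Passes from tuples as lists to families indexed by the numbers below \<open>M\<close>,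
  for which the invariance results are stated.\<close>

lemma K_act_eq_iff:
  assumes M: "3 \<le> M"
  shows "K_act n M (P, R) As = [diag_pad n (H1 l), diag_pad n (H2 l), diag_pad n (H3 l)] @ replicate (M - 3) (0\<^sub>m n n)
    \<longleftrightarrow> (\<forall>k<M. rot_family n M R (\<lambda>j. conj_by P (As ! j)) k = pauli_tuple n l k)"
proof -
  have 1: "K_act n M (P, R) As = map (rot_family n M R (\<lambda>j. conj_by P (As ! j))) [0..<M]"
    by (simp add: K_act_def rot_family_def conj_by_def)
  have 2: "[diag_pad n (H1 l), diag_pad n (H2 l), diag_pad n (H3 l)] @ replicate (M - 3) (0\<^sub>m n n)
    = map (pauli_tuple n l) [0..<M]"
  proof (rule nth_equalityI)
    fix k assume "k < length ([diag_pad n (H1 l), diag_pad n (H2 l), diag_pad n (H3 l)] @ replicate (M - 3) (0\<^sub>m n n))"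
    then have k: "k < M" using M by simp
    show "([diag_pad n (H1 l), diag_pad n (H2 l), diag_pad n (H3 l)] @ replicate (M - 3) (0\<^sub>m n n)) ! k
      = map (pauli_tuple n l) [0..<M] ! k"
    proof (cases "k < 3")
      case True
      then consider "k = 0" | "k = 1" | "k = 2" by linarith
      then show ?thesis using M by cases (simp_all add: pauli_tuple_def)
    next
      case False
      then show ?thesis using k by (simp add: nth_append pauli_tuple_def)
    qed
  qed (use M in simp)
  show ?thesis unfolding 1 2 by auto
qed

text \<open>List positions count from 0 and matrices from 1: for \<open>j < m\<close>, position
  \<open>j\<close> holds \<open>C (j + 1)\<close> and position \<open>m + j\<close> holds
  \<open>D (j + 1)\<close>.\<close>

lemma sum_nth_append_map:
  fixes g :: "'a \<Rightarrow> real"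
  shows "(\<Sum>j<2 * m. g ((map C [1..<Suc m] @ map D [1..<Suc m]) ! j)) = (\<Sum>r = 1..m. g (C r) + g (D r))"
proof -
  let ?L = "map C [1..<Suc m] @ map D [1..<Suc m]"
  have "(\<Sum>j<2 * m. g (?L ! j)) = (\<Sum>j<length ?L. map g ?L ! j)"
  proof (rule sum.cong)
    show "{..<2 * m} = {..<length ?L}" by (simp add: mult_2 del: upt_Suc)
    show "g (?L ! j) = map g ?L ! j" if "j \<in> {..<length ?L}" for j
      using that by (simp only: nth_map lessThan_iff)
  qed
  also have "\<dots> = sum_list (map g ?L)" by (simp add: sum_list_sum_nth atLeast0LessThan)
  also have "\<dots> = (\<Sum>r\<leftarrow>[1..<Suc m]. g (C r)) + (\<Sum>r\<leftarrow>[1..<Suc m]. g (D r))"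
    by (simp add: comp_def del: upt_Suc)
  also have "\<dots> = (\<Sum>r = 1..m. g (C r)) + (\<Sum>r = 1..m. g (D r))"
    by (simp add: interv_sum_list_conv_sum_set_nat atLeastLessThanSuc_atLeastAtMost del: upt_Suc)
  finally show ?thesis by (simp add: sum.distrib)
qed

lemma quat_commutator_sum:
  fixes B :: "nat \<Rightarrow> quat mat"
  assumes n: "1 \<le> n" and m: "3 \<le> m" and B: "\<And>r. r \<in> {1..m} \<Longrightarrow> B r \<in> carrier_mat n n"
  defines "S \<equiv> (\<Sum>r\<in>{1..m}. \<Sum>s\<in>{1..m}. (frob_norm (commutator (B r) (B s)))\<^sup>2)"
    and "T \<equiv> (\<Sum>r\<in>{1..m}. (frob_norm (B r))\<^sup>2)"
    and "Z \<equiv> mat_sum (2 * n) (\<lambda>r. commutator (Psi (B r)) (mat_adjoint (Psi (B r)))) {1..m}"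
    and "As \<equiv> map (\<lambda>r. herm_part (Psi (B r))) [1..<Suc m] @ map (\<lambda>r. \<i> \<cdot>\<^sub>m skew_part (Psi (B r))) [1..<Suc m]"
  shows "S \<le> 8/3 * T\<^sup>2"
    and "S = 8/3 * T\<^sup>2 \<longleftrightarrow> Z = 0\<^sub>m (2 * n) (2 * n) \<and>
      (\<exists>PR\<in>K_group (2 * n) (2 * m). \<exists>l\<ge>0. K_act (2 * n) (2 * m) PR As
        = [diag_pad (2 * n) (H1 l), diag_pad (2 * n) (H2 l), diag_pad (2 * n) (H3 l)]
          @ replicate (2 * m - 3) (0\<^sub>m (2 * n) (2 * n)))"
proof -
  let ?N = "2 * n" and ?M = "2 * m"
  have N: "2 \<le> ?N" and M: "3 \<le> ?M" using n m by auto
  define A where "A r = Psi (B r)" for r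
  define C where "C r = herm_part (A r)" for r
  define D where "D r = i_skew_part (A r)" for r
  have A: "A r \<in> carrier_mat ?N ?N" if "r \<in> {1..m}" for r
    unfolding A_def by (rule Psi_carrier[OF B[OF that]])
  have As: "As = map C [1..<Suc m] @ map D [1..<Suc m]"
    unfolding As_def C_def D_def A_def i_skew_part_def ..
  have AsX: "As ! j \<in> carrier_mat ?N ?N" "mat_adjoint (As ! j) = As ! j" if "j < ?M" for j
  proof -
    have "As ! j \<in> set As" using that by (intro nth_mem) (simp add: As)
    also have "set As = C ` {1..m} \<union> D ` {1..m}"
      by (simp add: As atLeastLessThanSuc_atLeastAtMost del: upt_Suc)
    finally obtain r where "r \<in> {1..m}" "As ! j = C r \<or> As ! j = D r" by blast
    then show "As ! j \<in> carrier_mat ?N ?N" "mat_adjoint (As ! j) = As ! j"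
      using herm_part_carrier[OF A] i_skew_part_carrier[OF A] herm_part_hermitian[OF A] i_skew_part_hermitian[OF A]
      unfolding C_def D_def by metis+
  qed
  have T2: "(\<Sum>j<?M. (frob_norm (As ! j))\<^sup>2) = 2 * T"
  proof -
    have "(\<Sum>j<?M. (frob_norm (As ! j))\<^sup>2) = (\<Sum>r = 1..m. (frob_norm (C r))\<^sup>2 + (frob_norm (D r))\<^sup>2)"
      unfolding As by (rule sum_nth_append_map)
    also have "\<dots> = (\<Sum>r = 1..m. 2 * (frob_norm (B r))\<^sup>2)"
    proof (intro sum.cong refl)
      fix r assume r: "r \<in> {1..m}"
      show "(frob_norm (C r))\<^sup>2 + (frob_norm (D r))\<^sup>2 = 2 * (frob_norm (B r))\<^sup>2"
        unfolding C_def D_def frob_norm_cartesian[OF A[OF r], symmetric] unfolding A_def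
        by (rule Psi_norm[OF B[OF r]])
    qed
    finally show ?thesis by (simp add: T_def sum_distrib_left)
  qed
  \<comment> \<open>The double sum over the concatenated list splits into the four blocks formed by
    \<open>C\<close> and \<open>D\<close>; the factor 2 of \<open>S\<close> comes from
    \<open>Psi_norm\<close>.\<close>
  have S2: "2 * S + (1/2) * (frob_norm Z)\<^sup>2 = commutator_sum ?M (\<lambda>j. As ! j)"
  proof -
    have "2 * S = (\<Sum>r\<in>{1..m}. \<Sum>s\<in>{1..m}. (frob_norm (commutator (A r) (A s)))\<^sup>2)"
      unfolding S_def sum_distrib_left
    proof (intro sum.cong refl)
      fix r s assume r: "r \<in> {1..m}" and s: "s \<in> {1..m}"
      show "2 * (frob_norm (commutator (B r) (B s)))\<^sup>2 = (frob_norm (commutator (A r) (A s)))\<^sup>2"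
        unfolding A_def Psi_commutator[OF B[OF r] B[OF s], symmetric]
        by (rule Psi_norm[of _ n, symmetric]) (use B[OF r] B[OF s] in simp)
    qed
    moreover have "(\<Sum>r\<in>{1..m}. \<Sum>s\<in>{1..m}. (frob_norm (commutator (A r) (A s)))\<^sup>2) + (1/2) * (frob_norm Z)\<^sup>2
      = (\<Sum>r\<in>{1..m}. \<Sum>s\<in>{1..m}. (frob_norm (commutator (C r) (C s)))\<^sup>2 + (frob_norm (commutator (C r) (D s)))\<^sup>2
       + (frob_norm (commutator (D r) (C s)))\<^sup>2 + (frob_norm (commutator (D r) (D s)))\<^sup>2)"
      unfolding Z_def A_def[symmetric] C_def D_def by (rule sum_commutators_cartesian[OF A])
    moreover have "commutator_sum ?M (\<lambda>j. As ! j)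
      = (\<Sum>r\<in>{1..m}. (\<Sum>s\<in>{1..m}. (frob_norm (commutator (C r) (C s)))\<^sup>2 + (frob_norm (commutator (C r) (D s)))\<^sup>2)
       + (\<Sum>s\<in>{1..m}. (frob_norm (commutator (D r) (C s)))\<^sup>2 + (frob_norm (commutator (D r) (D s)))\<^sup>2))"
      unfolding commutator_sum_def As
      by (simp only: sum_nth_append_map[of "\<lambda>Y. (frob_norm (commutator _ Y))\<^sup>2"]
          sum_nth_append_map[of "\<lambda>X. \<Sum>s = 1..m. (frob_norm (commutator X (C s)))\<^sup>2 + (frob_norm (commutator X (D s)))\<^sup>2"])
    ultimately show ?thesis by (simp add: sum.distrib add.assoc)
  qed
  have le: "commutator_sum ?M (\<lambda>j. As ! j) \<le> 4/3 * (2 * T)\<^sup>2"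
    using hermitian_commutator_bound_family(1)[where B = "\<lambda>j. As ! j", OF M AsX] unfolding T2 .
  have sq: "(2 * T)\<^sup>2 = 4 * T\<^sup>2" by (simp add: power_mult_distrib)
  have Z0: "0 \<le> (frob_norm Z)\<^sup>2" by simp
  show "S \<le> 8/3 * T\<^sup>2" using S2 le Z0 unfolding sq by linarith
  \<comment> \<open>Two nonnegative losses separate \<open>S\<close> from the bound, the term in
    \<open>Z\<close> and the Hermitian defect; equality means that both are 0.\<close>
  have "S = 8/3 * T\<^sup>2 \<longleftrightarrow> (frob_norm Z)\<^sup>2 = 0 \<and> commutator_sum ?M (\<lambda>j. As ! j) = 4/3 * (2 * T)\<^sup>2"
    using S2 le Z0 unfolding sq by linarith
  also have "(frob_norm Z)\<^sup>2 = 0 \<longleftrightarrow> Z = 0\<^sub>m ?N ?N"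
    using frob_norm_eq_0_iff[of Z ?N ?N] by (simp add: Z_def)
  also have "commutator_sum ?M (\<lambda>j. As ! j) = 4/3 * (2 * T)\<^sup>2 \<longleftrightarrow>
    (\<exists>P\<in>unitary_group ?N. \<exists>R\<in>orthogonal_group ?M. \<exists>l\<ge>0. \<forall>k<?M.
        rot_family ?N ?M R (\<lambda>j. conj_by P (As ! j)) k = pauli_tuple ?N l k)"
    using hermitian_commutator_equality_iff[where B = "\<lambda>j. As ! j", OF M N AsX] unfolding T2 .
  also have "\<dots> \<longleftrightarrow> (\<exists>PR\<in>K_group ?N ?M. \<exists>l\<ge>0. K_act ?N ?M PR As
        = [diag_pad ?N (H1 l), diag_pad ?N (H2 l), diag_pad ?N (H3 l)] @ replicate (?M - 3) (0\<^sub>m ?N ?N))"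
    unfolding K_group_def K_act_eq_iff[OF M, symmetric] by (simp only: bex_simps Bex_def mem_Sigma_iff split_paired_Ex) blast
  finally show "S = 8/3 * T\<^sup>2 \<longleftrightarrow> Z = 0\<^sub>m ?N ?N \<and>
      (\<exists>PR\<in>K_group ?N ?M. \<exists>l\<ge>0. K_act ?N ?M PR As
        = [diag_pad ?N (H1 l), diag_pad ?N (H2 l), diag_pad ?N (H3 l)] @ replicate (?M - 3) (0\<^sub>m ?N ?N))" .
qed

theorem theorem3p7:
  fixes n m :: nat and B :: "nat \<Rightarrow> quat mat"
  assumes n: "n \<ge> 1"
    and B: "\<And>r. r \<in> {1..m} \<Longrightarrow> B r \<in> carrier_mat n n"
  shows
    "(m \<ge> 3 \<longrightarrow>
        (\<Sum>r\<in>{1..m}. \<Sum>s\<in>{1..m}. (frob_norm (commutator (B r) (B s)))\<^sup>2)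
          \<le> 8/3 * (\<Sum>r\<in>{1..m}. (frob_norm (B r))\<^sup>2)\<^sup>2
      \<and> ((\<Sum>r\<in>{1..m}. \<Sum>s\<in>{1..m}. (frob_norm (commutator (B r) (B s)))\<^sup>2)
            = 8/3 * (\<Sum>r\<in>{1..m}. (frob_norm (B r))\<^sup>2)\<^sup>2
         \<longleftrightarrow>
           mat_sum (2*n) (\<lambda>r. commutator (Psi (B r)) (mat_adjoint (Psi (B r)))) {1..m}
             = 0\<^sub>m (2*n) (2*n)
         \<and> (\<exists>PR \<in> K_group (2*n) (2*m). \<exists>l::real. l \<ge> 0 \<and>
              K_act (2*n) (2*m) PR
                 (map (\<lambda>r. herm_part (Psi (B r))) [1..<Suc m]
                    @ map (\<lambda>r. \<i> \<cdot>\<^sub>m skew_part (Psi (B r))) [1..<Suc m])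
               = [diag_pad (2*n) (H1 l), diag_pad (2*n) (H2 l), diag_pad (2*n) (H3 l)]
                   @ replicate (2*m - 3) (0\<^sub>m (2*n) (2*n)))))
     \<and>
     (m = 2 \<longrightarrow>
        (\<Sum>r\<in>{1..2}. \<Sum>s\<in>{1..2}. (frob_norm (commutator (B r) (B s)))\<^sup>2)
          \<le> 2 * (\<Sum>r\<in>{1..2}. (frob_norm (B r))\<^sup>2)\<^sup>2
      \<and> ((\<Sum>r\<in>{1..2}. \<Sum>s\<in>{1..2}. (frob_norm (commutator (B r) (B s)))\<^sup>2)
            = 2 * (\<Sum>r\<in>{1..2}. (frob_norm (B r))\<^sup>2)\<^sup>2
         \<longleftrightarrow>
           (\<exists>u \<in> carrier_mat n 1. \<exists>p q :: quat.
              frob_norm u = 1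
              \<and> qRe p = 0 \<and> qRe q = 0 \<and> inner p q = 0 \<and> norm p = norm q
              \<and> B 1 = u * mat 1 1 (\<lambda>_. p) * quat_adjoint u
              \<and> B 2 = u * mat 1 1 (\<lambda>_. q) * quat_adjoint u)))" (is "(_ \<longrightarrow> ?P) \<and> (_ \<longrightarrow> ?Q)")
proof (rule conjI; intro impI)
  assume m: "3 \<le> m"
  show ?P
    by (intro conjI quat_commutator_sum[OF n m B])
next
  assume m: "m = 2"
  have B12: "B 1 \<in> carrier_mat n n" "B 2 \<in> carrier_mat n n" using B m by auto
  have two: "{1..2} = {1, 2 :: nat}" by auto
  have z: "frob_norm (commutator X X) = 0" if "X \<in> carrier_mat n n" for X :: "quat mat"
    unfolding commutator_def using that by (simp add: frob_norm_def)
  have S: "(\<Sum>r\<in>{1..2}. \<Sum>s\<in>{1..2}. (frob_norm (commutator (B r) (B s)))\<^sup>2)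
      = 2 * (frob_norm (commutator (B 1) (B 2)))\<^sup>2"
    unfolding two using z[OF B12(1)] z[OF B12(2)] frob_norm_commutator_swap[OF B12] by simp
  have T: "(\<Sum>r\<in>{1..2}. (frob_norm (B r))\<^sup>2) = (frob_norm (B 1))\<^sup>2 + (frob_norm (B 2))\<^sup>2"
    unfolding two by simp
  show ?Q
    unfolding S T using two_quat_matrices[OF B12 n] unfolding quat_rank_one_def by blast
qed

end
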